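(* Let $r\in\mathbb{N}_0$, $\alpha>-r-1$ and $\beta>0$. Then there is a constant $c=c(\alpha,r)>0$, independent of $\beta,N,s,u$, such that for every $u\in H^r_{w^{\alpha+r}}(\Lambda)$ and all nonnegative integers $N,s>-\alpha-1$ with $r\ge s$, $$\|u-\pi^{\alpha,\beta}_Nu\|_{s,\alpha,\beta}\le c\,(\beta N)^{\frac{s-r}{2}}\,\|u-\pi^{\alpha,\beta}_Nu\|_{r,\alpha,\beta}\le c\,(\beta N)^{\frac{s-r}{2}}\,\|u\|_{r,\alpha,\beta},$$ where for $N=0$ and $s<r$ the factor $(\beta N)^{(s-r)/2}$ is understood as $+\infty$ (i.e. nothing is asserted in that case).
   Context: $\Lambda=(0,\infty)$, $w^{\alpha}(x)=x^{\alpha}$, $(u,v)_{w^{\alpha}}=\int_\Lambda uv\,x^{\alpha}dx$, and for a weight $\varpi$ and an integer $m\ge0$, $H^m_{\varpi}(\Lambda)=\{v:\partial_x^kv\in L^2_{\varpi}(\Lambda),\ 0\le k\le m\}$. For $r\in\mathbb{N}_0$, $$a^{\alpha,\beta}_r(u,v)=\sum_{\nu=0}^{r}\binom{r}{\nu}\frac{\beta^{2r-2\nu}}{2^{2r-2\nu}}(\partial_x^{\nu}u,\partial_x^{\nu}v)_{w^{\alpha+r}},\qquad \|u\|_{r,\alpha,\beta}=\big[a^{\alpha,\beta}_r(u,u)\big]^{1/2}.$$ $X^{\beta}_N=\{e^{-\frac12\beta x}p(x):p\text{ a real polynomial of degree}\le N\}$. For $\alpha>-r-1$, the orthogonal projection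 $\pi^{\alpha,\beta}_N=\pi^{\alpha,\beta}_{r,N}:H^r_{w^{\alpha+r}}(\Lambda)\to X^{\beta}_N$ is defined by $$a^{\alpha,\beta}_r(u-\pi^{\alpha,\beta}_{r,N}u,v)=0\qquad\text{for all }v\in X^{\beta}_N;$$ it does not depend on the admissible choice of $r$, which is why the subscript $r$ is dropped. *)

theory Defs
  imports "HOL-Analysis.Analysis" "HOL-Computational_Algebra.Polynomial"
begin

definition half_line :: "real set" (\<open>\<Lambda>\<close>)
  where "\<Lambda> = {0<..}"

definition wt :: "real \<Rightarrow> real \<Rightarrow> real"
  where "wt \<alpha> x = x powr \<alpha>"

text \<open>Elements of the function spaces over \<open>\<Lambda>\<close> are represented by functions on the whole real
  line, whose values outside \<open>\<Lambda>\<close> play no role, rather than by classes modulo null sets.\<close>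

definition weighted_L2 :: "(real \<Rightarrow> real) \<Rightarrow> (real \<Rightarrow> real) set"
  where "weighted_L2 \<omega> = {v. v \<in> borel_measurable (lebesgue_on \<Lambda>) \<and>
           (\<lambda>x. (v x)\<^sup>2 * \<omega> x) absolutely_integrable_on \<Lambda>}"

definition weighted_inner :: "(real \<Rightarrow> real) \<Rightarrow> (real \<Rightarrow> real) \<Rightarrow> (real \<Rightarrow> real) \<Rightarrow> real"
  where "weighted_inner \<omega> u v = (LINT x:\<Lambda>|lebesgue. u x * v x * \<omega> x)"

definition test_functions :: "(real \<Rightarrow> real) set"
  where "test_functions = {\<phi>. (\<forall>n x. (deriv ^^ n) \<phi> differentiable (at x)) \<and>
           (\<exists>a b. 0 < a \<and> a \<le> b \<and> (\<forall>x. x \<notin> {a..b} \<longrightarrow> \<phi> x = 0))}"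

definition locally_integrable :: "(real \<Rightarrow> real) \<Rightarrow> bool"
  where "locally_integrable v \<longleftrightarrow> (\<forall>a b. 0 < a \<longrightarrow> v absolutely_integrable_on {a..b})"

definition has_weak_deriv :: "nat \<Rightarrow> (real \<Rightarrow> real) \<Rightarrow> (real \<Rightarrow> real) \<Rightarrow> bool"
  where "has_weak_deriv k v g \<longleftrightarrow> locally_integrable v \<and> locally_integrable g \<and>
           (\<forall>\<phi>\<in>test_functions.
             (LINT x:\<Lambda>|lebesgue. v x * (deriv ^^ k) \<phi> x) =
             (-1) ^ k * (LINT x:\<Lambda>|lebesgue. g x * \<phi> x))"

text \<open>Weak derivatives are unique only almost everywhere on \<open>\<Lambda>\<close>; \<open>weak_deriv\<close> selects one
  representative, and it is only used below under integrals.\<close>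

definition weak_deriv :: "nat \<Rightarrow> (real \<Rightarrow> real) \<Rightarrow> (real \<Rightarrow> real)"
  where "weak_deriv k v = (SOME g. has_weak_deriv k v g)"

definition weighted_Sobolev :: "nat \<Rightarrow> (real \<Rightarrow> real) \<Rightarrow> (real \<Rightarrow> real) set"
  where "weighted_Sobolev m \<omega> = {v. \<forall>k\<le>m. \<exists>g\<in>weighted_L2 \<omega>. has_weak_deriv k v g}"

definition a_form :: "nat \<Rightarrow> real \<Rightarrow> real \<Rightarrow> (real \<Rightarrow> real) \<Rightarrow> (real \<Rightarrow> real) \<Rightarrow> real"
  where "a_form r \<alpha> \<beta> u v =
           (\<Sum>\<nu>=0..r. real (r choose \<nu>) * (\<beta> ^ (2 * r - 2 * \<nu>) / 2 ^ (2 * r - 2 * \<nu>)) *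
              weighted_inner (wt (\<alpha> + real r)) (weak_deriv \<nu> u) (weak_deriv \<nu> v))"

text \<open>This value is meaningful only for \<open>u\<close> in the Sobolev space of order \<open>r\<close> with weight
  \<open>wt (\<alpha> + r)\<close>, since divergent Lebesgue integrals are \<open>0\<close> by convention.\<close>

definition a_norm :: "nat \<Rightarrow> real \<Rightarrow> real \<Rightarrow> (real \<Rightarrow> real) \<Rightarrow> real"
  where "a_norm r \<alpha> \<beta> u = sqrt (a_form r \<alpha> \<beta> u u)"

text \<open>The elements are functions on all of the real line; each is determined by its restriction
  to \<open>\<Lambda>\<close>, so the description by \<open>THE\<close> in \<open>laguerre_proj\<close> is unaffected by this.\<close>

definition laguerre_space :: "real \<Rightarrow> nat \<Rightarrow> (real \<Rightarrow> real) set"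
  where "laguerre_space \<beta> N = {\<lambda>x. exp (- (1/2) * \<beta> * x) * poly p x | p :: real poly. degree p \<le> N}"

definition laguerre_proj :: "nat \<Rightarrow> real \<Rightarrow> real \<Rightarrow> nat \<Rightarrow> (real \<Rightarrow> real) \<Rightarrow> (real \<Rightarrow> real)"
  where "laguerre_proj r \<alpha> \<beta> N u =
           (THE p. p \<in> laguerre_space \<beta> N \<and>
              (\<forall>v\<in>laguerre_space \<beta> N. a_form r \<alpha> \<beta> (\<lambda>x. u x - p x) v = 0))"

text \<open>The factor \<open>(\<beta> N)\<^bsup>(s - r)/2\<^esup>\<close>. The case distinction is needed because \<open>0 powr 0 = 0\<close>, while the
  factor is \<open>1\<close> for \<open>s = r\<close>, also when \<open>N = 0\<close>. The value for \<open>N = 0\<close> and \<open>s < r\<close> is irrelevant.\<close>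

definition rate :: "real \<Rightarrow> nat \<Rightarrow> nat \<Rightarrow> nat \<Rightarrow> real"
  where "rate \<beta> N s r = (if s = r then 1 else (\<beta> * real N) powr ((real s - real r) / 2))"

end

theory Submission
  imports Defs
begin

text \<open>Write \<open>b = \<beta>/2\<close>, let \<open>D\<close> be differentiation, \<open>A = D + b\<close> and \<open>B = D - b\<close>. Since
\<open>(Au)\<^sup>2 + (Bu)\<^sup>2 = 2 ((Du)\<^sup>2 + b\<^sup>2 u\<^sup>2)\<close>, the form of order \<open>r\<close> is the average, over the \<open>2\<^sup>r\<close> words of length
\<open>r\<close> in \<open>A\<close> and \<open>B\<close>, of the inner products with weight \<open>x\<close> to the power \<open>\<alpha> + r\<close> of the functions obtained by
applying the word (lemma \<open>jet_form_Suc\<close> splits off one letter). On \<open>exp (- b x) p(x)\<close> the operator \<open>A\<close>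
acts as \<open>p \<mapsto> p'\<close> and \<open>B\<close> as \<open>p \<mapsto> p' - 2bp\<close>, and integration by parts moves either of them to the other
factor, where it again acts on the polynomial, while the exponent of the weight drops from \<open>\<gamma> + 1\<close> to
\<open>\<gamma>\<close> (\<open>inner_shift_expoly\<close>); this requires \<open>\<gamma> > -1\<close>. In this way the orthogonality that defines the projection
turns into a statement about single words: if \<open>e\<close> is the projection error, then a word with \<open>j\<close> letters
\<open>A\<close>, applied to \<open>e\<close>, is orthogonal to \<open>exp (- b x) q(x)\<close> for every \<open>q\<close> of degree at most \<open>N - j\<close>
(\<open>pure_branch_orthogonal\<close>, \<open>orth_of_pure_branch\<close>). The adjoint of \<open>B\<close> is a bijection on the
polynomials of any bounded degree, and so this property descends from words of length \<open>r\<close> to shorter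
ones (\<open>orth_lower\<close>); this is the reason why the projection does not depend on the order.

For the estimate it suffices to pass from order \<open>t + 1\<close> to order \<open>t\<close>. Compared word by word, the two
forms differ by one first-order form, and the estimate is a spectral gap: if \<open>w\<close> is orthogonal, with
respect to the weight with exponent \<open>\<gamma> > -1\<close>, to \<open>exp (- b x) q(x)\<close> for all \<open>q\<close> of degree less than \<open>M\<close>,
then the integral of \<open>(Dw)\<^sup>2 + b\<^sup>2 w\<^sup>2\<close> with exponent \<open>\<gamma> + 1\<close> is at least \<open>b (2M + \<gamma> + 1)\<close> times the integral
of \<open>w\<^sup>2\<close> with exponent \<open>\<gamma>\<close> (\<open>spectral_gap\<close>, \<open>form_gap\<close>). The first-order form is represented on
polynomials by the Laguerre operator, which is symmetric and triangular with diagonal entries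
\<open>b (2n + \<gamma> + 1)\<close>. Density of the functions
\<open>exp (- b x) p(x)\<close> transfers the inequality from polynomials to all \<open>w\<close>. The factor
\<open>2M + \<gamma> + 1\<close> is at least a constant times \<open>N\<close>: for large \<open>N\<close> because \<open>M\<close> differs from \<open>N\<close> by a bounded number,
for the finitely many other \<open>N\<close> because \<open>\<gamma> + 1 > 0\<close>. Multiplying the gaps for \<open>t = s, \<dots>, r - 1\<close> gives the first inequality
(\<open>form_descent\<close>); the second one is Pythagoras.

The computations are carried out on jets, that is, sequences of functions each of which is absolutely
continuous with the next one as its derivative. The passage from weak derivatives to jets is the
lemma of du Bois-Reymond (\<open>du_Bois_Reymond\<close>), together with uniqueness of weak derivatives almost
everywhere; test functions for both come from \<open>exp (- 1/x)\<close>.\<close>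

section \<open>Integration by parts for absolutely continuous functions\<close>

text \<open>Fubini on the plane: the product of the two integrals is the integral of \<open>f(x) g(y)\<close>, and the plane is the
union of the half-planes \<open>y \<le> x\<close> and \<open>x \<le> y\<close>, which overlap only in the diagonal.\<close>

lemma integral_by_parts_lborel:
  fixes f g :: "real \<Rightarrow> real"
  assumes f: "integrable lborel f" and g: "integrable lborel g"
  shows "integrable lborel (\<lambda>x. f x * (LINT y|lborel. indicator {..x} y * g y))" (is ?I)
    and "(LINT x|lborel. f x * (LINT y|lborel. indicator {..x} y * g y)) +
         (LINT x|lborel. g x * (LINT y|lborel. indicator {..x} y * f y)) =
         (LINT x|lborel. f x) * (LINT x|lborel. g x)" (is ?E)
proof -
  have [measurable]: "f \<in> borel_measurable borel" "g \<in> borel_measurable borel"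
    using f g by auto
  have prod: "integrable (lborel \<Otimes>\<^sub>M lborel) (\<lambda>(x, y). f x * (indicator {..x} y * g y))"
    if f: "integrable lborel f" and g: "integrable lborel g" for f g :: "real \<Rightarrow> real"
  proof -
    have [measurable]: "f \<in> borel_measurable borel" "g \<in> borel_measurable borel"
      using f g by auto
    have "integrable (lborel \<Otimes>\<^sub>M lborel) (\<lambda>(x, y). f x * g y)"
    proof (rule lborel_pair.Fubini_integrable)
      show "integrable lborel (\<lambda>x. LINT y|lborel. norm (case (x, y) of (x, y) \<Rightarrow> f x * g y))"
        using f g by (simp add: abs_mult)
      show "AE x in lborel. integrable lborel (\<lambda>y. case (x, y) of (x, y) \<Rightarrow> f x * g y)"
        using g by simp
    qed (use f g in measurable)
    then show ?thesis
    proof (rule Bochner_Integration.integrable_bound)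
      have eq: "(\<lambda>(x, y). f x * (indicator {..x} y * g y)) = (\<lambda>p. f (fst p) * ((if snd p \<le> fst p then 1 else 0) * g (snd p)))"
        by (auto simp: indicator_def fun_eq_iff)
      show "(\<lambda>(x, y). f x * (indicator {..x} y * g y)) \<in> borel_measurable (lborel \<Otimes>\<^sub>M lborel)"
        unfolding eq by measurable
    qed (auto simp: indicator_def)
  qed
  note fg = prod[OF f g] and gf = prod[OF g f]
  have I1: "integrable lborel (\<lambda>x. f x * (LINT y|lborel. indicator {..x} y * g y))"
    using lborel_pair.integrable_fst[OF fg] by simp
  then show ?I .
  have I2: "integrable lborel (\<lambda>x. LINT y|lborel. g y * (indicator {..y} x * f x))"
    using lborel_pair.integrable_snd[of "\<lambda>x y. g x * (indicator {..x} y * f y)"] gf by simp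
  have "(LINT x|lborel. g x * (LINT y|lborel. indicator {..x} y * f y)) =
      (LINT x|lborel. (LINT y|lborel. g x * (indicator {..x} y * f y)))" by simp
  also have "\<dots> = (LINT y|lborel. (LINT x|lborel. g x * (indicator {..x} y * f y)))"
    by (rule lborel_pair.Fubini_integral[symmetric]) (use gf in simp)
  finally have swap: "(LINT x|lborel. g x * (LINT y|lborel. indicator {..x} y * f y)) =
     (LINT x|lborel. (LINT y|lborel. g y * (indicator {..y} x * f x)))" .
  have inner: "f x * (LINT y|lborel. indicator {..x} y * g y) +
         (LINT y|lborel. g y * (indicator {..y} x * f x)) = f x * (LINT y|lborel. g y)" for x
  proof -
    have "integrable lborel (\<lambda>y. indicator {..x} y *\<^sub>R g y)" "integrable lborel (\<lambda>y. indicator {x..} y *\<^sub>R g y)"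
      using g by (intro integrable_mult_indicator; simp)+
    moreover have i: "indicator {..y} x = (indicator {x..} y :: real)" for y
      by (simp add: indicator_def)
    ultimately have "(LINT y|lborel. indicator {..x} y * g y) + (LINT y|lborel. indicator {..y} x * g y)
         = (LINT y|lborel. indicator {..x} y * g y + indicator {x..} y * g y)"
      unfolding i by simp
    also have "\<dots> = (LINT y|lborel. g y)"
      by (rule integral_cong_AE) (auto intro!: eventually_mono[OF AE_lborel_singleton[of x]] simp: indicator_def)
    finally have "f x * ((LINT y|lborel. indicator {..x} y * g y) + (LINT y|lborel. indicator {..y} x * g y)) = f x * (LINT y|lborel. g y)"
      by simp
    moreover have "(LINT y|lborel. g y * (indicator {..y} x * f x)) = f x * (LINT y|lborel. indicator {..y} x * g y)"
      by (subst Bochner_Integration.integral_mult_right_zero[symmetric]) (simp add: mult_ac)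
    ultimately show ?thesis by (simp add: distrib_left)
  qed
  show ?E
    unfolding swap by (subst Bochner_Integration.integral_add[symmetric, OF I1 I2]) (simp add: inner)
qed

text \<open>Fubini's theorem is applied to \<open>lborel\<close>, whereas absolute integrability refers to its completion; Borel
representatives connect the two.\<close>

lemma borel_representative:
  fixes f :: "real \<Rightarrow> real"
  assumes "f absolutely_integrable_on S"
  shows "\<exists>f1. integrable lborel f1 \<and> (AE x in lebesgue. indicator S x * f x = f1 x)"
proof -
  have i: "integrable lebesgue (\<lambda>x. indicator S x * f x)"
    using assms by (simp add: set_integrable_def)
  then obtain f1 where f1: "f1 \<in> borel_measurable lborel" "AE x in lborel. indicator S x * f x = f1 x"
    using completion_ex_borel_measurable_real[of "\<lambda>x. indicator S x * f x" lborel] by auto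
  then have ae: "AE x in lebesgue. indicator S x * f x = f1 x"
    by (intro AE_completion)
  have "integrable lebesgue f1"
    by (rule integrable_cong_AE_imp[OF i]) (use f1 ae in \<open>auto simp: measurable_completion elim: eventually_mono\<close>)
  then show ?thesis using f1 ae by (auto simp: integrable_completion)
qed

lemma borel_representative_integral:
  fixes f f1 :: "real \<Rightarrow> real"
  assumes f: "f absolutely_integrable_on {a..b}" and f1: "integrable lborel f1" "AE x in lebesgue. indicator {a..b} x * f x = f1 x"
    and S: "S \<in> sets borel" "{a..b} \<inter> S = {a..d}" "d \<le> b"
  shows "(LINT x|lborel. indicator S x * f1 x) = integral {a..d} f"
proof -
  have fm: "f1 \<in> borel_measurable borel" using f1(1) by auto
  have fd: "f absolutely_integrable_on {a..d}"
    by (rule absolutely_integrable_on_subinterval[OF f]) (use S in auto)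
  have "(LINT x|lborel. indicator S x * f1 x) = (LINT x|lebesgue. indicator S x * f1 x)"
    by (rule integral_completion[symmetric]) (use S fm in auto)
  also have "\<dots> = (LINT x|lebesgue. indicator {a..d} x * f x)"
  proof (rule integral_cong_AE)
    show "(\<lambda>x. indicat_real S x * f1 x) \<in> borel_measurable lebesgue"
      by (rule measurable_completion) (use S fm in auto)
    show "(\<lambda>x. indicat_real {a..d} x * f x) \<in> borel_measurable lebesgue"
      using fd by (auto simp: set_integrable_def)
    show "AE x in lebesgue. indicator S x * f1 x = indicator {a..d} x * f x"
      using f1(2)
    proof eventually_elim
      case (elim x)
      have "indicator S x * f1 x = (indicator {a..b} x * indicator S x) * f x" unfolding elim[symmetric] by simp
      also have "\<dots> = indicator ({a..b} \<inter> S) x * f x" by (simp only: indicator_inter_arith)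
      finally show ?case by (simp only: S(2))
    qed
  qed
  also have "\<dots> = integral {a..d} f"
    using set_lebesgue_integral_eq_integral(2)[OF fd] by (simp add: set_lebesgue_integral_def)
  finally show ?thesis .
qed

lemma integral_by_parts_Icc:
  fixes f g :: "real \<Rightarrow> real"
  assumes f: "f absolutely_integrable_on {a..b}" and g: "g absolutely_integrable_on {a..b}"
  shows "(\<lambda>x. f x * integral {a..x} g) absolutely_integrable_on {a..b}"
    and "integral {a..b} (\<lambda>x. f x * integral {a..x} g) + integral {a..b} (\<lambda>x. g x * integral {a..x} f)
       = integral {a..b} f * integral {a..b} g"
proof -
  have step: "(\<lambda>x. f x * integral {a..x} g) absolutely_integrable_on {a..b} \<and>
       integral {a..b} (\<lambda>x. f x * integral {a..x} g) = (LINT x|lborel. f1 x * (LINT y|lborel. indicator {..x} y * g1 y))"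
    if f: "f absolutely_integrable_on {a..b}" and f1: "integrable lborel f1" "AE x in lebesgue. indicator {a..b} x * f x = f1 x"
      and g: "g absolutely_integrable_on {a..b}" and g1: "integrable lborel g1" "AE x in lebesgue. indicator {a..b} x * g x = g1 x"
    for f g f1 g1 :: "real \<Rightarrow> real"
  proof -
    let ?h = "\<lambda>x. f1 x * (LINT y|lborel. indicator {..x} y * g1 y)"
    have h: "integrable lborel ?h" by (rule integral_by_parts_lborel[OF f1(1) g1(1)])
    have ae: "AE x in lebesgue. ?h x = indicator {a..b} x * (f x * integral {a..x} g)"
      using f1(2)
    proof eventually_elim
      case (elim x)
      show ?case
      proof (cases "x \<in> {a..b}")
        case True
        then have "{a..b} \<inter> {..x} = {a..x}" by auto
        from borel_representative_integral[OF g g1 _ this] show ?thesis using elim True by simp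
      next
        case False
        then show ?thesis using elim by simp
      qed
    qed
    have hl: "integrable lebesgue ?h" using h by (subst integrable_completion) auto
    have m: "(\<lambda>x. indicator {a..b} x * (f x * integral {a..x} g)) \<in> borel_measurable lebesgue"
      by (rule borel_measurable_AE[OF borel_measurable_integrable[OF hl] ae])
    have "integrable lebesgue (\<lambda>x. indicator {a..b} x * (f x * integral {a..x} g))"
      using hl m ae by (subst integrable_cong_AE[of _ _ ?h]) auto
    then have ai: "(\<lambda>x. f x * integral {a..x} g) absolutely_integrable_on {a..b}"
      by (simp add: set_integrable_def)
    have "integral {a..b} (\<lambda>x. f x * integral {a..x} g) = (LINT x|lebesgue. indicator {a..b} x * (f x * integral {a..x} g))"
      using set_lebesgue_integral_eq_integral(2)[OF ai] by (simp add: set_lebesgue_integral_def)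
    also have "\<dots> = (LINT x|lebesgue. ?h x)"
      using hl m ae by (intro integral_cong_AE) auto
    also have "\<dots> = (LINT x|lborel. ?h x)"
      by (rule integral_completion) (use h in auto)
    finally show ?thesis using ai by simp
  qed
  obtain f1 where f1: "integrable lborel f1" "AE x in lebesgue. indicator {a..b} x * f x = f1 x"
    using borel_representative[OF f] by auto
  obtain g1 where g1: "integrable lborel g1" "AE x in lebesgue. indicator {a..b} x * g x = g1 x"
    using borel_representative[OF g] by auto
  show "(\<lambda>x. f x * integral {a..x} g) absolutely_integrable_on {a..b}"
    using step[OF f f1 g g1] by simp
  show "integral {a..b} (\<lambda>x. f x * integral {a..x} g) + integral {a..b} (\<lambda>x. g x * integral {a..x} f)
       = integral {a..b} f * integral {a..b} g"
    using step[OF f f1 g g1] step[OF g g1 f f1] integral_by_parts_lborel(2)[OF f1(1) g1(1)]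
      borel_representative_integral[OF f f1, of UNIV b] borel_representative_integral[OF g g1, of UNIV b] by simp
qed

text \<open>\<open>w\<close> is locally absolutely continuous on the half-line with derivative \<open>g\<close>. It is stated through integrals
because \<open>g\<close> matters only up to null sets.\<close>

definition primitive :: "(real \<Rightarrow> real) \<Rightarrow> (real \<Rightarrow> real) \<Rightarrow> bool"
  where "primitive w g \<longleftrightarrow> (\<forall>a c. 0 < a \<longrightarrow> a \<le> c \<longrightarrow>
           g absolutely_integrable_on {a..c} \<and> integral {a..c} g = w c - w a)"

lemma primitive_D:
  assumes "primitive w g" "0 < a" "a \<le> c"
  shows "g absolutely_integrable_on {a..c}" "integral {a..c} g = w c - w a" "(g has_integral (w c - w a)) {a..c}"
  using assms by (auto simp: primitive_def has_integral_iff dest: set_lebesgue_integral_eq_integral(1))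

lemma primitive_continuous:
  assumes "primitive w g" shows "continuous_on {0<..} w"
proof -
  have "continuous (at x) w" if "x > 0" for x
  proof -
    have "continuous_on {x/2..2*x} (\<lambda>y. integral {x/2..y} g)"
      using primitive_D(3)[OF assms, of "x/2" "2*x"] that
      by (intro indefinite_integral_continuous_1) (auto simp: has_integral_iff)
    then have "continuous_on {x/2..2*x} (\<lambda>y. integral {x/2..y} g + w (x/2))"
      by (intro continuous_intros)
    moreover have "integral {x/2..y} g + w (x/2) = w y" if "y \<in> {x/2..2*x}" for y
      using primitive_D(2)[OF assms, of "x/2" y] that \<open>x > 0\<close> by simp
    ultimately have "continuous_on {x/2..2*x} w"
      by (rule continuous_on_eq)
    then show ?thesis
      by (rule continuous_on_interior) (use that in simp)
  qed
  then show ?thesis by (auto intro: continuous_at_imp_continuous_on)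
qed

lemma primitive_C1:
  assumes "\<And>x. x > 0 \<Longrightarrow> (w has_real_derivative g x) (at x)" and "continuous_on {0<..} g"
  shows "primitive w g"
  unfolding primitive_def
proof (intro allI impI conjI)
  fix a c :: real assume ac: "0 < a" "a \<le> c"
  show "g absolutely_integrable_on {a..c}"
    by (rule absolutely_integrable_continuous_real[OF continuous_on_subset[OF assms(2)]]) (use ac in auto)
  have "(g has_integral w c - w a) {a..c}"
    by (rule fundamental_theorem_of_calculus)
       (use ac assms(1) in \<open>auto intro: has_field_derivative_at_within simp flip: has_real_derivative_iff_has_vector_derivative\<close>)
  then show "integral {a..c} g = w c - w a" by (rule integral_unique)
qed

lemma primitive_add:
  "primitive u f \<Longrightarrow> primitive v g \<Longrightarrow> primitive (\<lambda>x. u x + v x) (\<lambda>x. f x + g x)"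
  unfolding primitive_def by (auto simp: set_lebesgue_integral_eq_integral(1) Henstock_Kurzweil_Integration.integral_add)

lemma primitive_cmult:
  "primitive u f \<Longrightarrow> primitive (\<lambda>x. c * u x) (\<lambda>x. c * f x)"
  unfolding primitive_def by (simp add: right_diff_distrib)

lemma primitive_mult:
  assumes u: "primitive u f" and v: "primitive v g"
  shows "primitive (\<lambda>x. u x * v x) (\<lambda>x. f x * v x + u x * g x)"
  unfolding primitive_def
proof (intro allI impI)
  fix a c :: real assume ac: "0 < a" "a \<le> c"
  note uD = primitive_D[OF u \<open>0 < a\<close>] and vD = primitive_D[OF v \<open>0 < a\<close>]
  have f: "f absolutely_integrable_on {a..c}" and g: "g absolutely_integrable_on {a..c}"
    using uD(1) vD(1) ac by auto
  note p = integral_by_parts_Icc[OF f g] integral_by_parts_Icc(1)[OF g f]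
  let ?r = "\<lambda>x. (f x * integral {a..x} g + g x * integral {a..x} f) + (v a * f x + u a * g x)"
  have eq: "f x * v x + u x * g x = ?r x" if "x \<in> {a..c}" for x
  proof -
    have "u x = u a + integral {a..x} f" "v x = v a + integral {a..x} g"
      using uD(2)[of x] vD(2)[of x] that by auto
    then show ?thesis by (simp only:) (simp add: algebra_simps)
  qed
  have "?r absolutely_integrable_on {a..c}"
    using p f g by (intro set_integral_add set_integrable_mult_right) auto
  then have 1: "(\<lambda>x. f x * v x + u x * g x) absolutely_integrable_on {a..c}"
    by (subst set_integrable_cong[OF refl refl eq]) auto
  have "integral {a..c} (\<lambda>x. f x * v x + u x * g x) = integral {a..c} ?r"
    by (rule Henstock_Kurzweil_Integration.integral_cong) (rule eq)
  also have "\<dots> = (u c - u a) * (v c - v a) + (v a * (u c - u a) + u a * (v c - v a))"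
    using p f g ac uD(2)[of c] vD(2)[of c]
    by (simp add: Henstock_Kurzweil_Integration.integral_add integrable_add set_lebesgue_integral_eq_integral(1))
  also have "\<dots> = u c * v c - u a * v a" by (simp add: algebra_simps)
  finally show "(\<lambda>x. f x * v x + u x * g x) absolutely_integrable_on {a..c} \<and>
    integral {a..c} (\<lambda>x. f x * v x + u x * g x) = u c * v c - u a * v a" using 1 by simp
qed

section \<open>Weighted square-integrable functions\<close>

abbreviation ip :: "real \<Rightarrow> (real \<Rightarrow> real) \<Rightarrow> (real \<Rightarrow> real) \<Rightarrow> real"
  where "ip \<gamma> \<equiv> weighted_inner (wt \<gamma>)"

abbreviation L2 :: "real \<Rightarrow> (real \<Rightarrow> real) set"
  where "L2 \<gamma> \<equiv> weighted_L2 (wt \<gamma>)"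

lemma wt_nonneg [simp]: "0 \<le> wt \<gamma> x" by (simp add: wt_def)

lemma wt_measurable [measurable]: "wt \<gamma> \<in> borel_measurable borel"
  unfolding wt_def by measurable

lemma wt_measurable_half_line: "wt \<gamma> \<in> borel_measurable (lebesgue_on \<Lambda>)"
  by (intro measurable_restrict_space1 measurable_completion) simp

lemma half_line_sets [simp, intro]: "\<Lambda> \<in> sets lebesgue"
  by (simp add: half_line_def)

lemma L2_D:
  assumes "u \<in> weighted_L2 \<omega>"
  shows "u \<in> borel_measurable (lebesgue_on \<Lambda>)" "(\<lambda>x. (u x)\<^sup>2 * \<omega> x) absolutely_integrable_on \<Lambda>"
    "(\<lambda>x. (u x)\<^sup>2 * \<omega> x) integrable_on \<Lambda>"
  using assms by (auto simp: weighted_L2_def set_lebesgue_integral_eq_integral(1))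

lemma L2_mult_integrable:
  assumes u: "u \<in> L2 \<gamma>" and v: "v \<in> L2 \<gamma>"
  shows "(\<lambda>x. u x * v x * wt \<gamma> x) absolutely_integrable_on \<Lambda>"
proof (rule measurable_bounded_by_integrable_imp_absolutely_integrable)
  show "(\<lambda>x. u x * v x * wt \<gamma> x) \<in> borel_measurable (lebesgue_on \<Lambda>)"
    using u v wt_measurable_half_line by (intro borel_measurable_times) (auto dest: L2_D)
  show "(\<lambda>x. (u x)\<^sup>2 * wt \<gamma> x + (v x)\<^sup>2 * wt \<gamma> x) integrable_on \<Lambda>"
    using u v by (intro integrable_add) (auto dest: L2_D)
  show "norm (u x * v x * wt \<gamma> x) \<le> (u x)\<^sup>2 * wt \<gamma> x + (v x)\<^sup>2 * wt \<gamma> x" for x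
  proof -
    have "norm (u x * v x) \<le> 2 * \<bar>u x\<bar> * \<bar>v x\<bar>" by (simp add: abs_mult)
    also have "\<dots> \<le> (u x)\<^sup>2 + (v x)\<^sup>2"
      using sum_squares_bound[of "\<bar>u x\<bar>" "\<bar>v x\<bar>"] by simp
    finally have "norm (u x * v x) \<le> (u x)\<^sup>2 + (v x)\<^sup>2" .
    from mult_right_mono[OF this wt_nonneg[of \<gamma> x]] show ?thesis
      by (simp add: abs_mult algebra_simps)
  qed
qed auto

lemma L2_add:
  assumes u: "u \<in> L2 \<gamma>" and v: "v \<in> L2 \<gamma>"
  shows "(\<lambda>x. u x + v x) \<in> L2 \<gamma>"
proof -
  have "(\<lambda>x. (u x)\<^sup>2 * wt \<gamma> x + (v x)\<^sup>2 * wt \<gamma> x + 2 * (u x * v x * wt \<gamma> x)) absolutely_integrable_on \<Lambda>"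
    using u v by (intro set_integral_add set_integrable_mult_right L2_mult_integrable) (auto dest: L2_D)
  then have "(\<lambda>x. (u x + v x)\<^sup>2 * wt \<gamma> x) absolutely_integrable_on \<Lambda>"
    by (rule set_integrable_cong[THEN iffD1, OF refl refl, rotated]) (simp add: power2_eq_square algebra_simps)
  moreover have "(\<lambda>x. u x + v x) \<in> borel_measurable (lebesgue_on \<Lambda>)"
    using u v by (intro borel_measurable_add) (auto dest: L2_D)
  ultimately show ?thesis by (simp add: weighted_L2_def)
qed

lemma L2_cmult:
  assumes u: "u \<in> L2 \<gamma>"
  shows "(\<lambda>x. c * u x) \<in> L2 \<gamma>"
proof -
  have "(\<lambda>x. c\<^sup>2 * ((u x)\<^sup>2 * wt \<gamma> x)) absolutely_integrable_on \<Lambda>"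
    using u by (intro set_integrable_mult_right) (auto dest: L2_D)
  then show ?thesis
    using u borel_measurable_times[OF borel_measurable_const[of c] L2_D(1)[OF u]]
    by (simp add: weighted_L2_def power_mult_distrib mult.assoc)
qed

lemma ip_commute: "weighted_inner \<omega> u v = weighted_inner \<omega> v u"
  by (simp add: weighted_inner_def mult.commute)

lemma ip_add_left:
  assumes "u \<in> L2 \<gamma>" "u' \<in> L2 \<gamma>" "v \<in> L2 \<gamma>"
  shows "ip \<gamma> (\<lambda>x. u x + u' x) v = ip \<gamma> u v + ip \<gamma> u' v"
  using assms unfolding weighted_inner_def
  by (subst set_integral_add(2)[symmetric]) (auto intro: L2_mult_integrable simp: distrib_right)

lemma ip_cmult_left:
  "weighted_inner \<omega> (\<lambda>x. c * u x) v = c * weighted_inner \<omega> u v"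
proof -
  have "(\<lambda>x. c * u x * v x * \<omega> x) = (\<lambda>x. c * (u x * v x * \<omega> x))" by (simp add: mult.assoc)
  then show ?thesis unfolding weighted_inner_def by (simp only: set_integral_mult_right)
qed

lemma ip_add_right:
  assumes "u \<in> L2 \<gamma>" "u' \<in> L2 \<gamma>" "v \<in> L2 \<gamma>"
  shows "ip \<gamma> v (\<lambda>x. u x + u' x) = ip \<gamma> v u + ip \<gamma> v u'"
  using ip_add_left[OF assms] by (simp add: ip_commute)

lemma ip_cmult_right:
  "weighted_inner \<omega> v (\<lambda>x. c * u x) = c * weighted_inner \<omega> v u"
  using ip_cmult_left[of \<omega> c u v] by (simp add: ip_commute)

lemma ip_nonneg: "0 \<le> ip \<gamma> u u"
  unfolding weighted_inner_def set_lebesgue_integral_def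
  by (rule Bochner_Integration.integral_nonneg) (auto simp: indicator_def)

lemma primitive_measurable:
  assumes "primitive w g" shows "w \<in> borel_measurable (lebesgue_on \<Lambda>)"
  by (rule continuous_imp_measurable_on_sets_lebesgue)
     (use primitive_continuous[OF assms] in \<open>auto simp: half_line_def\<close>)

section \<open>Integration by parts on the half-line\<close>

text \<open>Boundary values are avoided by a cutoff in the variable \<open>ln x\<close>: for \<open>\<kappa>(x) = 1 - (ln x / n)\<^sup>2\<close> the product
\<open>G \<kappa>\<close> vanishes at both ends of the interval from \<open>exp (- n)\<close> to \<open>exp n\<close>, and \<open>x \<kappa>'(x)\<close> is at most \<open>2 / n\<close>
there. Integrability of \<open>G(x) / x\<close> therefore makes the contribution of \<open>\<kappa>'\<close> disappear in the limit.\<close>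

lemma primitive_half_line_integral_eq_0:
  assumes G: "primitive G G'" and G': "G' absolutely_integrable_on \<Lambda>"
    and Gx: "(\<lambda>x. G x / x) absolutely_integrable_on \<Lambda>"
  shows "(LINT x:\<Lambda>|lebesgue. G' x) = 0"
proof -
  define \<kappa> where "\<kappa> n x = 1 - (ln x / real (Suc n))\<^sup>2" for n x
  define \<kappa>' where "\<kappa>' n x = - (2 * ln x / (real (Suc n))\<^sup>2 / x)" for n x
  define I where "I n = {exp (- real (Suc n))..exp (real (Suc n))}" for n
  define F where "F n x = (if x \<in> I n then G' x * \<kappa> n x + G x * \<kappa>' n x else 0)" for n x
  have prim: "primitive (\<kappa> n) (\<kappa>' n)" for n
  proof (rule primitive_C1)
    fix x :: real assume x: "x > 0"
    have "((\<lambda>x. 1 - (ln x / m)\<^sup>2) has_real_derivative - (2 * ln x / m\<^sup>2 / x)) (at x)" if "m > 0" for m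
      using x that by (auto intro!: derivative_eq_intros simp: power2_eq_square)
    from this[of "real (Suc n)"] show "(\<kappa> n has_real_derivative \<kappa>' n x) (at x)"
      unfolding \<kappa>_def \<kappa>'_def by simp
  next
    show "continuous_on {0<..} (\<kappa>' n)"
      unfolding \<kappa>'_def by (intro continuous_intros) (auto simp del: of_nat_Suc)
  qed
  have F: "(F n has_integral 0) \<Lambda>" for n
  proof -
    have "((\<lambda>x. G' x * \<kappa> n x + G x * \<kappa>' n x) has_integral
        (G (exp (real (Suc n))) * \<kappa> n (exp (real (Suc n))) - G (exp (- real (Suc n))) * \<kappa> n (exp (- real (Suc n))))) (I n)"
      unfolding I_def by (rule primitive_D(3)[OF primitive_mult[OF G prim]]) auto
    moreover have "\<kappa> n (exp (real (Suc n))) = 0" "\<kappa> n (exp (- real (Suc n))) = 0"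
      by (simp_all only: \<kappa>_def ln_exp) (simp_all del: of_nat_Suc)
    ultimately have "((\<lambda>x. G' x * \<kappa> n x + G x * \<kappa>' n x) has_integral 0) (I n)" by simp
    moreover have "I n \<subseteq> \<Lambda>" by (auto simp: I_def half_line_def intro: less_le_trans[OF exp_gt_zero])
    ultimately show ?thesis unfolding F_def by (simp add: has_integral_restrict)
  qed
  let ?h = "\<lambda>x. \<bar>G' x\<bar> + 2 * \<bar>G x / x\<bar>"
  have h: "?h integrable_on \<Lambda>"
    
  proof -
    have "(\<lambda>x. \<bar>G' x\<bar>) integrable_on \<Lambda>" "(\<lambda>x. \<bar>G x / x\<bar>) integrable_on \<Lambda>"
      using G' Gx by (simp_all only: absolutely_integrable_on_def real_norm_def)
    from integrable_add[OF this(1) integrable_on_cmult_left[OF this(2), of 2]] show ?thesis by simp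
  qed
  have le: "norm (F n x) \<le> ?h x" if "x \<in> \<Lambda>" for n x
  proof (cases "x \<in> I n")
    case True
    have x: "x > 0" using that by (simp add: half_line_def)
    have "- real (Suc n) \<le> ln x" "ln x \<le> real (Suc n)"
      using True x exp_le_cancel_iff[of "- real (Suc n)" "ln x"] exp_le_cancel_iff[of "ln x" "real (Suc n)"]
      by (auto simp: I_def)
    then have ln: "\<bar>ln x\<bar> \<le> real (Suc n)" by simp
    then have "\<bar>ln x / real (Suc n)\<bar> \<le> 1" by (simp add: field_simps del: of_nat_Suc)
    then have "(ln x / real (Suc n))\<^sup>2 \<le> 1" by (simp add: abs_square_le_1)
    then have c: "\<bar>\<kappa> n x\<bar> \<le> 1" by (auto simp: \<kappa>_def)
    have "2 * \<bar>ln x\<bar> / (real (Suc n))\<^sup>2 \<le> 2 * real (Suc n) / (real (Suc n))\<^sup>2"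
      using ln by (intro divide_right_mono) auto
    also have "\<dots> = 2 / real (Suc n)" by (simp add: power2_eq_square del: of_nat_Suc)
    also have "\<dots> \<le> 2 / 1" by (intro divide_left_mono) auto
    finally have "2 * \<bar>ln x\<bar> / (real (Suc n))\<^sup>2 \<le> 2" by simp
    from divide_right_mono[OF this, of x] have "\<bar>\<kappa>' n x\<bar> \<le> 2 / x"
      using x by (simp add: \<kappa>'_def abs_mult divide_right_mono)
    then have "\<bar>G x * \<kappa>' n x\<bar> \<le> \<bar>G x\<bar> * (2 / x)"
      unfolding abs_mult by (rule mult_left_mono) simp
    moreover have "\<bar>G' x * \<kappa> n x\<bar> \<le> \<bar>G' x\<bar>" using mult_left_mono[OF c, of "\<bar>G' x\<bar>"] by (simp add: abs_mult)
    moreover have "norm (F n x) \<le> \<bar>G' x * \<kappa> n x\<bar> + \<bar>G x * \<kappa>' n x\<bar>"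
      using True by (simp add: F_def abs_triangle_ineq)
    moreover have "\<bar>G x\<bar> * (2 / x) = 2 * \<bar>G x / x\<bar>" using x by simp
    ultimately show ?thesis by linarith
  qed (simp add: F_def)
  have conv: "(\<lambda>n. F n x) \<longlonglongrightarrow> G' x" if "x \<in> \<Lambda>" for x
  proof -
    have x: "x > 0" using that by (simp add: half_line_def)
    have "(\<lambda>n. G' x * \<kappa> n x + G x * \<kappa>' n x) \<longlonglongrightarrow> G' x * (1 - 0\<^sup>2) + G x * (- (0 / x))"
    proof -
      have "(\<lambda>n. ln x / real (Suc n)) \<longlonglongrightarrow> 0"
        using tendsto_mult[OF tendsto_const[of "ln x"] LIMSEQ_inverse_real_of_nat] by (simp add: field_simps)
      moreover have "(\<lambda>n. 2 * ln x / (real (Suc n))\<^sup>2) \<longlonglongrightarrow> 0"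
        using tendsto_mult[OF tendsto_const[of "2 * ln x"] tendsto_power[OF LIMSEQ_inverse_real_of_nat, of 2]]
        by (simp add: field_simps)
      ultimately show ?thesis unfolding \<kappa>_def \<kappa>'_def
        by (intro tendsto_intros) (use x in auto)
    qed
    moreover have "eventually (\<lambda>n. F n x = G' x * \<kappa> n x + G x * \<kappa>' n x) sequentially"
    proof -
      obtain N where N: "\<bar>ln x\<bar> \<le> real N" using real_arch_simple by blast
      show ?thesis
      proof (rule eventually_sequentiallyI[of N])
        fix n assume "N \<le> n"
        then have "\<bar>ln x\<bar> \<le> real (Suc n)" using N by simp
        then have "exp (- real (Suc n)) \<le> exp (ln x)" "exp (ln x) \<le> exp (real (Suc n))"
          unfolding exp_le_cancel_iff by linarith+
        then have "x \<in> I n" using x by (simp add: I_def)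
        then show "F n x = G' x * \<kappa> n x + G x * \<kappa>' n x" by (simp add: F_def)
      qed
    qed
    ultimately show ?thesis by (simp add: tendsto_cong)
  qed
  have "(\<lambda>n. integral \<Lambda> (F n)) \<longlonglongrightarrow> integral \<Lambda> G'"
    by (rule dominated_convergence(2)[OF _ h le conv]) (use F in auto)
  moreover have "integral \<Lambda> (F n) = 0" for n using F by (rule integral_unique)
  ultimately have "integral \<Lambda> G' = 0" by (simp add: LIMSEQ_const_iff)
  then show ?thesis using set_lebesgue_integral_eq_integral(2)[OF G'] by simp
qed

lemma integrable_on_restrict:
  fixes f :: "real \<Rightarrow> real"
  assumes "S \<subseteq> T" "f integrable_on S"
  shows "(\<lambda>x. if x \<in> S then f x else 0) integrable_on T"
  using assms by (simp only: integrable_on_def has_integral_restrict)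

text \<open>A Hardy inequality. Integrating the derivative of \<open>w\<^sup>2\<close> times \<open>x\<close> to the power \<open>\<gamma> + 1\<close> over \<open>[a, 1]\<close> bounds the
integral of \<open>w\<^sup>2\<close> with exponent \<open>\<gamma>\<close> over that interval independently of \<open>a\<close>, because the boundary term at
\<open>a\<close> has the right sign and \<open>\<gamma> + 1 > 0\<close>. Beyond \<open>1\<close> the smaller exponent gives the smaller weight.\<close>

lemma L2_hardy:
  assumes w: "primitive w w'" and wL: "w \<in> L2 (\<gamma> + 1)" and w'L: "w' \<in> L2 (\<gamma> + 1)"
    and \<gamma>: "\<gamma> > -1"
  shows "w \<in> L2 \<gamma>"
proof -
  let ?W = "\<lambda>x. (w x)\<^sup>2 * wt \<gamma> x"
  have wp: "x powr (\<gamma> + 1) = x * wt \<gamma> x" if "x > 0" for x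
    using that by (simp add: wt_def powr_add)
  have prim: "primitive (\<lambda>x. w x * w x * x powr (\<gamma> + 1))
      (\<lambda>x. (w' x * w x + w x * w' x) * x powr (\<gamma> + 1) + w x * w x * ((\<gamma> + 1) * x powr \<gamma>))"
  proof (rule primitive_mult[OF primitive_mult[OF w w]], rule primitive_C1)
    show "((\<lambda>x. x powr (\<gamma> + 1)) has_real_derivative (\<gamma> + 1) * x powr \<gamma>) (at x)" if "x > 0" for x
      using that by (auto intro!: derivative_eq_intros)
  qed (auto intro!: continuous_intros)
  define C where "C = (w 1)\<^sup>2 + integral \<Lambda> (\<lambda>x. (w x)\<^sup>2 * wt (\<gamma> + 1) x) + integral \<Lambda> (\<lambda>x. (w' x)\<^sup>2 * wt (\<gamma> + 1) x)"
  let ?f = "\<lambda>n x. if x \<in> {1 / real (Suc n)..1} then ?W x else 0"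
  have Wint: "?W integrable_on {a..1}" if "0 < a" for a
    unfolding wt_def using primitive_continuous[OF w] that
    by (intro integrable_continuous_real) (auto intro!: continuous_intros elim: continuous_on_subset)
  have bd: "(\<gamma> + 1) * integral {a..1} ?W \<le> C" if a: "0 < a" "a \<le> 1" for a
  proof -
    let ?A = "\<lambda>x. ((w' x)\<^sup>2 * wt (\<gamma> + 1) x + (w x)\<^sup>2 * wt (\<gamma> + 1) x)"
    let ?P = "(\<lambda>x. (w' x * w x + w x * w' x) * x powr (\<gamma> + 1) + w x * w x * ((\<gamma> + 1) * x powr \<gamma>))"
    have sub: "{a..1} \<subseteq> \<Lambda>" using a by (auto simp: half_line_def)
    have A\<Lambda>: "?A integrable_on \<Lambda>" using L2_D(3)[OF wL] L2_D(3)[OF w'L] by (rule integrable_add[rotated])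
    then have A: "?A integrable_on {a..1}" using sub integrable_on_subinterval by blast
    have P: "(?P has_integral (w 1 * w 1 * 1 powr (\<gamma> + 1) - w a * w a * a powr (\<gamma> + 1))) {a..1}"
      by (rule primitive_D(3)[OF prim a])
    have "integral {a..1} (\<lambda>x. (\<gamma> + 1) * ?W x) \<le> integral {a..1} (\<lambda>x. ?P x + ?A x)"
    proof (rule integral_le)
      show "(\<lambda>x. (\<gamma> + 1) * ?W x) integrable_on {a..1}" using integrable_on_cmult_left[OF Wint[OF a(1)], of "\<gamma> + 1"] by simp
      show "(\<lambda>x. ?P x + ?A x) integrable_on {a..1}"
        by (rule integrable_add[OF has_integral_integrable[OF P] A])
      fix x assume "x \<in> {a..1}"
      have "0 \<le> (w' x + w x)\<^sup>2 * wt (\<gamma> + 1) x" by simp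
      then show "(\<gamma> + 1) * ?W x \<le> ?P x + ?A x"
        by (simp add: power2_eq_square wt_def algebra_simps)
    qed
    also have "\<dots> = (w 1 * w 1 * 1 powr (\<gamma> + 1) - w a * w a * a powr (\<gamma> + 1)) + integral {a..1} ?A"
      unfolding Henstock_Kurzweil_Integration.integral_add[OF has_integral_integrable[OF P] A] integral_unique[OF P] ..
    also have "\<dots> \<le> (w 1)\<^sup>2 + integral \<Lambda> ?A"
    proof -
      have "0 \<le> w a * w a * a powr (\<gamma> + 1)" by simp
      moreover have "integral {a..1} ?A \<le> integral \<Lambda> ?A"
        by (rule integral_subset_le[OF sub A A\<Lambda>]) simp
      moreover have "w 1 * w 1 * 1 powr (\<gamma> + 1) = (w 1)\<^sup>2" by (simp add: power2_eq_square)
      ultimately show ?thesis by linarith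
    qed
    also have "\<dots> = C" unfolding C_def
      using L2_D(3)[OF wL] L2_D(3)[OF w'L]
      by (simp add: Henstock_Kurzweil_Integration.integral_add)
    finally show ?thesis using Wint[OF a(1)] by simp
  qed
  have "?W integrable_on {0<..1} \<and> (\<lambda>n. integral {0<..1} (?f n)) \<longlonglongrightarrow> integral {0<..1} ?W"
  proof (rule monotone_convergence_increasing)
    have sub: "{1 / real (Suc n)..1} \<subseteq> {0<..1}" for n
      
    proof
      fix x :: real assume x: "x \<in> {1 / real (Suc n)..1}"
      have "0 < 1 / real (Suc n)" by simp
      also have "\<dots> \<le> x" using x by simp
      finally show "x \<in> {0<..1}" using x by simp
    qed
    show "?f n integrable_on {0<..1}" for n
      by (rule integrable_on_restrict[OF sub Wint]) simp
    have fI: "integral {0<..1} (?f n) = integral {1 / real (Suc n)..1} ?W" for n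
      
      by (rule integral_unique) (simp only: has_integral_restrict[OF sub] integrable_integral[OF Wint] divide_pos_pos zero_less_one of_nat_0_less_iff zero_less_Suc)
    show "?f n x \<le> ?f (Suc n) x" if "x \<in> {0<..1}" for n x
    proof -
      have "1 / real (Suc (Suc n)) \<le> 1 / real (Suc n)" by (intro divide_left_mono) auto
      then show ?thesis by auto
    qed
    show "(\<lambda>n. ?f n x) \<longlonglongrightarrow> ?W x" if "x \<in> {0<..1}" for x
    proof -
      have "0 < x" using that by simp
      from reals_Archimedean[OF this] obtain N where N: "inverse (real (Suc N)) < x" by blast
      have "eventually (\<lambda>n. ?f n x = ?W x) sequentially"
      proof (rule eventually_sequentiallyI[of N])
        fix n assume "N \<le> n"
        then have "1 / real (Suc n) \<le> 1 / real (Suc N)" by (intro divide_left_mono) auto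
        then show "?f n x = ?W x" using N that by (auto simp: inverse_eq_divide)
      qed
      then show ?thesis by (rule tendsto_eventually)
    qed
    show "bounded (range (\<lambda>n. integral {0<..1} (?f n)))"
      unfolding bounded_iff fI
    proof (intro exI[of _ "C / (\<gamma> + 1)"] ballI, clarify)
      fix n
      have "0 \<le> integral {1 / real (Suc n)..1} ?W"
        by (rule Henstock_Kurzweil_Integration.integral_nonneg[OF Wint]) auto
      then show "norm (integral {1 / real (Suc n)..1} ?W) \<le> C / (\<gamma> + 1)"
        using bd[of "1 / real (Suc n)"] \<gamma> by (simp add: field_simps)
    qed
  qed
  then have W1: "?W integrable_on {0<..1}" by simp
  let ?B = "\<lambda>x. (if x \<in> {0<..1} then ?W x else 0) + (w x)\<^sup>2 * wt (\<gamma> + 1) x"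
  have "?W absolutely_integrable_on \<Lambda>"
  proof (rule measurable_bounded_by_integrable_imp_absolutely_integrable)
    show "?W \<in> borel_measurable (lebesgue_on \<Lambda>)"
      using L2_D(1)[OF wL] wt_measurable_half_line
      by (intro borel_measurable_times borel_measurable_power)
    show "?B integrable_on \<Lambda>"
    proof (rule integrable_add)
      show "(\<lambda>x. if x \<in> {0<..1} then ?W x else 0) integrable_on \<Lambda>"
        by (rule integrable_on_restrict[OF _ W1]) (auto simp: half_line_def)
    qed (rule L2_D(3)[OF wL])
    fix x assume "x \<in> \<Lambda>"
    then have x: "x > 0" by (simp add: half_line_def)
    show "norm (?W x) \<le> ?B x"
    proof (cases "x \<le> 1")
      case False
      then have "wt \<gamma> x \<le> wt (\<gamma> + 1) x" using wp[OF x] mult_right_mono[of 1 x "wt \<gamma> x"]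
        by (simp add: wt_def)
      then show ?thesis using False by (simp add: mult_left_mono)
    qed (use x in simp)
  qed auto
  then show ?thesis using L2_D(1)[OF wL] by (simp add: weighted_L2_def)
qed

section \<open>Laguerre functions\<close>

definition expoly :: "real \<Rightarrow> real poly \<Rightarrow> real \<Rightarrow> real"
  where "expoly b p x = exp (- b * x) * poly p x"

text \<open>Differentiation of \<open>expoly b p\<close>, expressed on the polynomial.\<close>

definition dpoly :: "real \<Rightarrow> real poly \<Rightarrow> real poly"
  where "dpoly b p = pderiv p - smult b p"

text \<open>Degree less than \<open>n\<close>. Unlike a bound on \<open>degree\<close>, this also describes the zero space, for \<open>n = 0\<close>.\<close>

definition polys :: "nat \<Rightarrow> real poly set"
  where "polys n = {p. \<forall>i\<ge>n. coeff p i = 0}"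

lemma polys_Suc: "p \<in> polys (Suc n) \<longleftrightarrow> degree p \<le> n"
  unfolding polys_def
  by (auto simp: coeff_eq_0 Suc_le_eq intro: degree_le le_antisym)

lemma polys_0: "p \<in> polys 0 \<longleftrightarrow> p = 0"
  by (auto simp: polys_def poly_eq_iff)

lemma polys_mono: "p \<in> polys m \<Longrightarrow> m \<le> n \<Longrightarrow> p \<in> polys n"
  by (auto simp: polys_def)

lemma polys_add: "p \<in> polys n \<Longrightarrow> q \<in> polys n \<Longrightarrow> p + q \<in> polys n"
  and polys_diff: "p \<in> polys n \<Longrightarrow> q \<in> polys n \<Longrightarrow> p - q \<in> polys n"
  and polys_smult: "p \<in> polys n \<Longrightarrow> smult c p \<in> polys n"
  and polys_pderiv: "p \<in> polys n \<Longrightarrow> pderiv p \<in> polys (n - 1)"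
  and polys_zero: "0 \<in> polys n"
  by (auto simp: polys_def coeff_pderiv)

lemma polys_degree: "p \<in> polys (Suc (degree p))"
  by (simp add: polys_Suc)

lemma expoly_add: "expoly b (p + q) = (\<lambda>x. expoly b p x + expoly b q x)"
  and expoly_smult: "expoly b (smult c p) = (\<lambda>x. c * expoly b p x)"
  and expoly_diff: "expoly b (p - q) = (\<lambda>x. expoly b p x - expoly b q x)"
  and expoly_0 [simp]: "expoly b 0 = (\<lambda>x. 0)"
  by (auto simp: expoly_def algebra_simps)

lemma expoly_has_derivative: "(expoly b p has_real_derivative expoly b (dpoly b p) x) (at x)"
  unfolding expoly_def[abs_def] dpoly_def
  by (auto intro!: derivative_eq_intros poly_DERIV simp: algebra_simps)

lemma continuous_on_expoly [continuous_intros]: "continuous_on S (expoly b p)"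
  unfolding expoly_def[abs_def] by (intro continuous_intros)

lemma primitive_expoly: "primitive (expoly b p) (expoly b (dpoly b p))"
  by (rule primitive_C1[OF expoly_has_derivative]) (intro continuous_intros)

lemma powr_exp_integrable:
  assumes "\<gamma> > -1" "c > 0"
  shows "(\<lambda>x. exp (- c * x) * wt \<gamma> x) absolutely_integrable_on \<Lambda>"
proof -
  have "(\<lambda>t. complex_of_real t powr (complex_of_real (\<gamma> + 1) - 1) / of_real (exp (c * t))) absolutely_integrable_on {0<..}"
    by (rule absolutely_integrable_Gamma_integral) (use assms in auto)
  then have "(\<lambda>t. norm (complex_of_real t powr (complex_of_real (\<gamma> + 1) - 1) / of_real (exp (c * t)))) absolutely_integrable_on {0<..}"
    by (rule absolutely_integrable_norm[unfolded o_def])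
  then show ?thesis
    unfolding half_line_def
    by (rule set_integrable_cong[THEN iffD1, OF refl refl, rotated])
       (auto simp: wt_def norm_divide norm_powr_real_powr exp_minus field_simps)
qed

lemma expoly_weight_integrable:
  assumes "c > 0"
  shows "\<gamma> > -1 \<Longrightarrow> (\<lambda>x. expoly c p x * wt \<gamma> x) absolutely_integrable_on \<Lambda>"
proof (induction p arbitrary: \<gamma> rule: pCons_induct)
  case (pCons a p)
  have "(\<lambda>x. a * (exp (- c * x) * wt \<gamma> x) + expoly c p x * wt (\<gamma> + 1) x) absolutely_integrable_on \<Lambda>"
    using pCons.prems assms by (intro set_integral_add set_integrable_mult_right powr_exp_integrable pCons.IH) auto
  then show ?case
    by (rule set_integrable_cong[THEN iffD1, OF refl refl, rotated])
       (auto simp: wt_def expoly_def half_line_def powr_add algebra_simps)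
qed simp

lemma expoly_weighted_L2:
  assumes "\<gamma> > -1" "b > 0"
  shows "expoly b p \<in> L2 \<gamma>"
proof -
  have "(\<lambda>x. expoly (2 * b) (p * p) x * wt \<gamma> x) absolutely_integrable_on \<Lambda>"
    by (rule expoly_weight_integrable) (use assms in auto)
  moreover have "expoly (2 * b) (p * p) x = (expoly b p x)\<^sup>2" for x
  proof -
    have "exp (- (2 * b) * x) = (exp (- b * x))\<^sup>2"
      using exp_double[of "- b * x"] by (simp add: mult.assoc)
    then show ?thesis by (simp add: expoly_def power_mult_distrib power2_eq_square)
  qed
  ultimately show ?thesis
    using primitive_measurable[OF primitive_expoly] by (simp add: weighted_L2_def)
qed

lemma expoly_eq_0_on_half_line:
  assumes "\<And>x. x > 0 \<Longrightarrow> expoly b p x = 0" shows "p = 0"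
proof (rule ccontr)
  assume "p \<noteq> 0"
  then have "finite {x. poly p x = 0}" by (rule poly_roots_finite)
  moreover have "{0<..} \<subseteq> {x. poly p x = 0}" using assms by (auto simp: expoly_def)
  ultimately have "finite {0::real<..}" by (rule finite_subset[rotated])
  then show False using infinite_Ioi by blast
qed

lemma expoly_norm_eq_0:
  assumes \<gamma>: "\<gamma> > -1" and b: "b > 0" and 0: "ip \<gamma> (expoly b p) (expoly b p) = 0"
  shows "p = 0"
proof (rule expoly_eq_0_on_half_line)
  fix x :: real assume x: "x > 0"
  let ?f = "\<lambda>x. expoly b p x * expoly b p x * wt \<gamma> x"
  note L = expoly_weighted_L2[OF \<gamma> b, of p]
  have ai: "?f absolutely_integrable_on \<Lambda>" by (rule L2_mult_integrable[OF L L])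
  have "integral \<Lambda> ?f = 0"
    using 0 set_lebesgue_integral_eq_integral(2)[OF ai] by (simp add: weighted_inner_def)
  have sub: "{x/2..2*x} \<subseteq> \<Lambda>" using x by (auto simp: half_line_def)
  have c: "continuous_on {x/2..2*x} ?f"
    unfolding wt_def using x by (auto intro!: continuous_intros)
  have "integral {x/2..2*x} ?f \<le> integral \<Lambda> ?f"
    by (rule integral_subset_le[OF sub])
       (use c set_lebesgue_integral_eq_integral(1)[OF ai] in \<open>auto intro: integrable_continuous_real\<close>)
  moreover have "0 \<le> integral {x/2..2*x} ?f"
    by (rule Henstock_Kurzweil_Integration.integral_nonneg) (use c in \<open>auto intro: integrable_continuous_real\<close>)
  ultimately have "integral {x/2..2*x} ?f = 0" using \<open>integral \<Lambda> ?f = 0\<close> by simp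
  then have "?f x = 0"
    using integral_eq_0_iff[OF c] x by auto
  then show "expoly b p x = 0" using x by (auto simp: wt_def)
qed

section \<open>Adjoints of the first-order operators\<close>

text \<open>The adjoint of \<open>D + c\<close>, seen as a map from weight exponent \<open>\<gamma>\<close> to weight exponent \<open>\<gamma> + 1\<close>, on the function
\<open>expoly b q\<close>: minus the derivative of \<open>expoly b q\<close> times \<open>x\<close> to the power \<open>\<gamma> + 1\<close>, plus \<open>c\<close> times that product,
with \<open>exp (- b x)\<close> and \<open>x\<close> to the power \<open>\<gamma>\<close> divided out.\<close>

definition adj_poly :: "real \<Rightarrow> real \<Rightarrow> real \<Rightarrow> real poly \<Rightarrow> real poly"
  where "adj_poly c b \<gamma> q = smult (c + b) (pCons 0 q) - pCons 0 (pderiv q) - smult (\<gamma> + 1) q"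

lemma coeff_adj_poly:
  "coeff (adj_poly c b \<gamma> q) n = (c + b) * (case n of 0 \<Rightarrow> 0 | Suc m \<Rightarrow> coeff q m) - (real n + \<gamma> + 1) * coeff q n"
  by (simp add: adj_poly_def coeff_pCons coeff_pderiv algebra_simps split: nat.split)

lemma polys_adj_poly: "q \<in> polys n \<Longrightarrow> adj_poly c b \<gamma> q \<in> polys (Suc n)"
  by (auto simp: polys_def coeff_adj_poly split: nat.split)

text \<open>For \<open>c = - b\<close> the adjoint sends \<open>x\<^sup>n\<close> to \<open>- (n + \<gamma> + 1) x\<^sup>n\<close>, so it is inverted coefficient by coefficient.\<close>

lemma adj_poly_neg_surj:
  assumes \<gamma>: "\<gamma> > -1" and q: "q \<in> polys n"
  obtains q' where "q' \<in> polys n" "adj_poly (- b) b \<gamma> q' = q" "\<And>i. coeff q' i = - coeff q i / (real i + \<gamma> + 1)"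
proof -
  define q' where "q' = (\<Sum>i<n. monom (- coeff q i / (real i + \<gamma> + 1)) i)"
  have c: "coeff q' i = - coeff q i / (real i + \<gamma> + 1)" for i
    using q unfolding q'_def coeff_sum coeff_monom
    by (cases "i < n") (auto simp: polys_def sum.delta)
  moreover have "q' \<in> polys n" using q by (auto simp: polys_def c)
  moreover have "adj_poly (- b) b \<gamma> q' = q"
  proof (rule poly_eqI)
    fix i
    have "real i + \<gamma> + 1 \<noteq> 0" using \<gamma> by linarith
    then show "coeff (adj_poly (- b) b \<gamma> q') i = coeff q i"
      by (simp add: coeff_adj_poly c)
  qed
  ultimately show ?thesis using that by blast
qed

lemma ip_raise:
  "ip (\<gamma> + 1) u (expoly b q) = ip \<gamma> u (expoly b (pCons 0 q))"
  unfolding weighted_inner_def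
  by (rule set_lebesgue_integral_cong) (auto simp: half_line_def wt_def powr_add expoly_def)

lemma primitive_cong:
  assumes "primitive w f" and "\<And>x. x > 0 \<Longrightarrow> f x = g x"
  shows "primitive w g"
  unfolding primitive_def
proof (intro allI impI)
  fix a c :: real assume ac: "0 < a" "a \<le> c"
  have eq: "f x = g x" if "x \<in> {a..c}" for x using assms(2) that ac by auto
  show "g absolutely_integrable_on {a..c} \<and> integral {a..c} g = w c - w a"
    using primitive_D[OF assms(1) ac] set_integrable_cong[OF refl refl eq, of "{a..c}"]
      Henstock_Kurzweil_Integration.integral_cong[OF eq, of "{a..c}"] by auto
qed

text \<open>The total derivative that is integrated here belongs to \<open>w\<close> times \<open>expoly b q\<close> times \<open>x\<close> to the power
\<open>\<gamma> + 1\<close>. Divided by \<open>x\<close>, this product is integrable by the Hardy inequality.\<close>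

lemma inner_deriv_expoly:
  assumes w: "primitive w w'" and wL: "w \<in> L2 (\<gamma> + 1)" and w'L: "w' \<in> L2 (\<gamma> + 1)"
    and \<gamma>: "\<gamma> > -1" and b: "b > 0"
  shows "ip (\<gamma> + 1) w' (expoly b q) = ip \<gamma> w (expoly b (adj_poly 0 b \<gamma> q))"
proof -
  note w0 = L2_hardy[OF w wL w'L \<gamma>]
  note E = expoly_weighted_L2[OF \<gamma> b]
  have E1: "expoly b q \<in> L2 (\<gamma> + 1)" for q using \<gamma> b by (intro expoly_weighted_L2) auto
  let ?G = "\<lambda>x. w x * (expoly b q x * x powr (\<gamma> + 1))"
  let ?G' = "\<lambda>x. w' x * expoly b q x * wt (\<gamma> + 1) x - w x * expoly b (adj_poly 0 b \<gamma> q) x * wt \<gamma> x"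
  have "primitive ?G (\<lambda>x. w' x * (expoly b q x * x powr (\<gamma> + 1)) +
      w x * (expoly b (dpoly b q) x * x powr (\<gamma> + 1) + expoly b q x * ((\<gamma> + 1) * x powr \<gamma>)))"
    by (intro primitive_mult primitive_expoly w primitive_C1)
       (auto intro!: derivative_eq_intros continuous_intros)
  then have P: "primitive ?G ?G'"
    by (rule primitive_cong) (simp add: wt_def powr_add expoly_def adj_poly_def dpoly_def algebra_simps)
  have i1: "(\<lambda>x. w' x * expoly b q x * wt (\<gamma> + 1) x) absolutely_integrable_on \<Lambda>"
    by (rule L2_mult_integrable[OF w'L E1])
  have i2: "(\<lambda>x. w x * expoly b (adj_poly 0 b \<gamma> q) x * wt \<gamma> x) absolutely_integrable_on \<Lambda>"
    by (rule L2_mult_integrable[OF w0 E])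
  have "(LINT x:\<Lambda>|lebesgue. ?G' x) = 0"
  proof (rule primitive_half_line_integral_eq_0[OF P])
    show "?G' absolutely_integrable_on \<Lambda>" by (rule set_integral_diff(1)[OF i1 i2])
    have "(\<lambda>x. w x * expoly b q x * wt \<gamma> x) absolutely_integrable_on \<Lambda>"
      by (rule L2_mult_integrable[OF w0 E])
    then show "(\<lambda>x. ?G x / x) absolutely_integrable_on \<Lambda>"
      by (rule set_integrable_cong[THEN iffD1, OF refl refl, rotated]) (simp add: half_line_def wt_def powr_add)
  qed
  then show ?thesis
    unfolding weighted_inner_def using i1 i2 by (simp add: set_integral_diff(2))
qed

section \<open>Jets\<close>

text \<open>A function together with its first \<open>m\<close> derivatives, as far as they enter the forms; entries beyond \<open>m\<close> are
arbitrary.\<close>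

definition jet :: "nat \<Rightarrow> real \<Rightarrow> (nat \<Rightarrow> real \<Rightarrow> real) \<Rightarrow> bool"
  where "jet m \<gamma> g \<longleftrightarrow> (\<forall>k\<le>m. g k \<in> L2 \<gamma>) \<and> (\<forall>k<m. primitive (g k) (g (Suc k)))"

text \<open>The operator \<open>D + c\<close> on jets; \<open>shift b\<close> and \<open>shift (- b)\<close> are the operators \<open>A\<close> and \<open>B\<close>.\<close>

definition shift :: "real \<Rightarrow> (nat \<Rightarrow> real \<Rightarrow> real) \<Rightarrow> nat \<Rightarrow> real \<Rightarrow> real"
  where "shift c g k x = g (Suc k) x + c * g k x"

definition poly_jet :: "real \<Rightarrow> real poly \<Rightarrow> nat \<Rightarrow> real \<Rightarrow> real"
  where "poly_jet b p k = expoly b ((dpoly b ^^ k) p)"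

lemma jet_poly_jet: "\<gamma> > -1 \<Longrightarrow> b > 0 \<Longrightarrow> jet m \<gamma> (poly_jet b p)"
  by (auto simp: jet_def poly_jet_def expoly_weighted_L2 primitive_expoly)

lemma dpoly_add: "dpoly b (p + q) = dpoly b p + dpoly b q"
  and dpoly_smult: "dpoly b (smult c p) = smult c (dpoly b p)"
  and dpoly_diff: "dpoly b (p - q) = dpoly b p - dpoly b q"
  by (rule poly_eqI; simp add: dpoly_def pderiv_add pderiv_smult pderiv_diff right_diff_distrib distrib_left)+

lemma funpow_dpoly: 
  "(dpoly b ^^ k) (p + q) = (dpoly b ^^ k) p + (dpoly b ^^ k) q"
  "(dpoly b ^^ k) (smult c p) = smult c ((dpoly b ^^ k) p)"
  "(dpoly b ^^ k) (p - q) = (dpoly b ^^ k) p - (dpoly b ^^ k) q"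
  by (induction k) (simp_all add: dpoly_add dpoly_smult dpoly_diff)

lemma poly_jet_add: "poly_jet b (p + q) = (\<lambda>k x. poly_jet b p k x + poly_jet b q k x)"
  and poly_jet_smult: "poly_jet b (smult c p) = (\<lambda>k x. c * poly_jet b p k x)"
  and poly_jet_diff: "poly_jet b (p - q) = (\<lambda>k x. poly_jet b p k x - poly_jet b q k x)"
  by (auto simp: poly_jet_def funpow_dpoly expoly_add expoly_smult expoly_diff fun_eq_iff)

lemma poly_jet_0 [simp]: "poly_jet b p 0 = expoly b p"
  by (simp add: poly_jet_def)

lemma shift_poly_jet: "shift c (poly_jet b p) = poly_jet b (dpoly b p + smult c p)"
  by (simp add: shift_def poly_jet_def fun_eq_iff funpow_dpoly expoly_add expoly_smult funpow_swap1)

lemma shift_poly_jet_neg: "shift (- b) (poly_jet b p) = poly_jet b (pderiv p - smult (2 * b) p)"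
proof -
  have "smult (2 * b) p = smult b p + smult b p" by (simp only: mult_2 smult_add_left)
  then have "dpoly b p + smult (- b) p = pderiv p - smult (2 * b) p"
    by (simp only: dpoly_def smult_minus_left diff_diff_eq add_uminus_conv_diff)
  then show ?thesis by (simp only: shift_poly_jet)
qed

lemma shift_poly_jet_pos: "shift b (poly_jet b p) = poly_jet b (pderiv p)"
  unfolding shift_poly_jet by (simp add: dpoly_def)

lemma jet_add:
  assumes "jet m \<gamma> g" "jet m \<gamma> h" shows "jet m \<gamma> (\<lambda>k x. g k x + h k x)"
  using assms unfolding jet_def by (auto intro: L2_add primitive_add)

lemma jet_cmult:
  assumes "jet m \<gamma> g" shows "jet m \<gamma> (\<lambda>k x. c * g k x)"
  using assms unfolding jet_def by (auto intro: L2_cmult primitive_cmult)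

lemma jet_shift:
  assumes "jet (Suc m) \<gamma> g" shows "jet m \<gamma> (shift c g)"
  using assms unfolding jet_def shift_def[abs_def]
  by (auto intro!: L2_add primitive_add L2_cmult primitive_cmult)

lemma jet_funpow_shift: "jet (m + n) \<gamma> g \<Longrightarrow> jet m \<gamma> ((shift c ^^ n) g)"
proof (induction n arbitrary: m)
  case (Suc n)
  then have "jet (Suc m) \<gamma> ((shift c ^^ n) g)" by simp
  then show ?case by (simp add: jet_shift)
qed simp

lemma jet_lower:
  assumes "jet (Suc m) (\<gamma> + 1) g" "\<gamma> > -1" shows "jet m \<gamma> g"
  unfolding jet_def
proof (intro conjI allI impI)
  show "g k \<in> L2 \<gamma>" if "k \<le> m" for k
    by (rule L2_hardy[of "g k" "g (Suc k)"]) (use assms that in \<open>auto simp: jet_def\<close>)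
  show "primitive (g k) (g (Suc k))" if "k < m" for k
    using assms that by (simp add: jet_def)
qed

lemma shift_commute: "shift c (shift d g) = shift d (shift c g)"
  by (simp add: shift_def fun_eq_iff algebra_simps)

lemma funpow_shift_commute: "(shift c ^^ n) (shift d g) = shift d ((shift c ^^ n) g)"
  by (induction n) (auto simp: shift_commute[of c d])

lemma inner_shift_expoly:
  assumes g: "jet 1 (\<gamma> + 1) g" and \<gamma>: "\<gamma> > -1" and b: "b > 0"
  shows "ip (\<gamma> + 1) (shift c g 0) (expoly b q) = ip \<gamma> (g 0) (expoly b (adj_poly c b \<gamma> q))"
proof -
  have gL: "g 0 \<in> L2 (\<gamma> + 1)" "g 1 \<in> L2 (\<gamma> + 1)" and P: "primitive (g 0) (g 1)"
    using g by (auto simp: jet_def)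
  have E: "expoly b q \<in> L2 (\<gamma> + 1)" using \<gamma> b by (intro expoly_weighted_L2) auto
  have L: "g 0 \<in> L2 \<gamma>" by (rule L2_hardy[OF P gL \<gamma>])
  have "ip (\<gamma> + 1) (shift c g 0) (expoly b q) =
      ip (\<gamma> + 1) (g 1) (expoly b q) + c * ip (\<gamma> + 1) (g 0) (expoly b q)"
    unfolding shift_def[abs_def]
    using gL E by (simp add: ip_add_left L2_cmult ip_cmult_left)
  also have "\<dots> = ip \<gamma> (g 0) (expoly b (adj_poly 0 b \<gamma> q)) + c * ip \<gamma> (g 0) (expoly b (pCons 0 q))"
    by (simp only: inner_deriv_expoly[OF P gL \<gamma> b] ip_raise[of \<gamma> "g 0"])
  also have "\<dots> = ip \<gamma> (g 0) (expoly b (adj_poly 0 b \<gamma> q + smult c (pCons 0 q)))"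
    by (simp only: expoly_add expoly_smult ip_cmult_right ip_add_right[OF expoly_weighted_L2[OF \<gamma> b] L2_cmult[OF expoly_weighted_L2[OF \<gamma> b]] L])
  also have "adj_poly 0 b \<gamma> q + smult c (pCons 0 q) = adj_poly c b \<gamma> q"
    by (simp add: adj_poly_def algebra_simps smult_add_left)
  finally show ?thesis .
qed

section \<open>The form in terms of first-order operators\<close>

text \<open>The form of order \<open>r\<close> on jets; its weight exponent \<open>\<gamma>\<close> stands for \<open>\<alpha> + r\<close>, and \<open>b\<close> for \<open>\<beta>/2\<close>.\<close>

definition jet_form :: "nat \<Rightarrow> real \<Rightarrow> real \<Rightarrow> (nat \<Rightarrow> real \<Rightarrow> real) \<Rightarrow> (nat \<Rightarrow> real \<Rightarrow> real) \<Rightarrow> real"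
  where "jet_form r \<gamma> b g h = (\<Sum>k\<le>r. real (r choose k) * b ^ (2 * (r - k)) * ip \<gamma> (g k) (h k))"

lemma binomial_sum_Suc:
  fixes X :: "nat \<Rightarrow> real"
  shows "(\<Sum>k\<le>Suc r. real (Suc r choose k) * b ^ (2 * (Suc r - k)) * X k) =
         (\<Sum>k\<le>r. real (r choose k) * b ^ (2 * (r - k)) * (X (Suc k) + b\<^sup>2 * X k))"
proof -
  have "(\<Sum>k\<le>r. real (r choose k) * b ^ (2 * (r - k)) * (b\<^sup>2 * X k)) =
      (\<Sum>k\<le>Suc r. real (r choose k) * b ^ (2 * (Suc r - k)) * X k)"
  proof -
    have "real (r choose k) * b ^ (2 * (r - k)) * (b\<^sup>2 * X k) = real (r choose k) * b ^ (2 * (Suc r - k)) * X k"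
      if "k \<le> r" for k
    proof -
      have "b ^ (2 * (Suc r - k)) = b ^ (2 * (r - k)) * b\<^sup>2"
        using that by (simp add: Suc_diff_le flip: power_add)
      then show ?thesis by simp
    qed
    then have "(\<Sum>k\<le>r. real (r choose k) * b ^ (2 * (r - k)) * (b\<^sup>2 * X k)) =
      (\<Sum>k\<le>r. real (r choose k) * b ^ (2 * (Suc r - k)) * X k)" by (intro sum.cong) auto
    then show ?thesis by (simp add: binomial_eq_0)
  qed
  also have "\<dots> = b ^ (2 * Suc r) * X 0 + (\<Sum>k\<le>r. real (r choose Suc k) * b ^ (2 * (r - k)) * X (Suc k))"
    by (subst sum.atMost_Suc_shift) simp
  finally show ?thesis
    by (subst sum.atMost_Suc_shift) (simp add: distrib_left distrib_right sum.distrib)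
qed

text \<open>The polarised identity \<open>(Au)\<^sup>2 + (Bu)\<^sup>2 = 2 ((Du)\<^sup>2 + b\<^sup>2 u\<^sup>2)\<close>, summed with the help of Pascal's rule. The
weight exponent is the same on both sides, so that all later inductions on the order run at a fixed exponent.\<close>

lemma jet_form_Suc:
  assumes g: "jet (Suc r) \<gamma> g" and h: "jet (Suc r) \<gamma> h"
  shows "jet_form (Suc r) \<gamma> b g h =
     (jet_form r \<gamma> b (shift b g) (shift b h) + jet_form r \<gamma> b (shift (- b) g) (shift (- b) h)) / 2"
proof -
  have ex: "ip \<gamma> (shift c g k) (shift c h k) =
      ip \<gamma> (g (Suc k)) (h (Suc k)) + c * ip \<gamma> (g (Suc k)) (h k)
      + c * ip \<gamma> (g k) (h (Suc k)) + c\<^sup>2 * ip \<gamma> (g k) (h k)" if "k \<le> r" for c k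
  proof -
    have L: "g k \<in> L2 \<gamma>" "g (Suc k) \<in> L2 \<gamma>"
      "h k \<in> L2 \<gamma>" "h (Suc k) \<in> L2 \<gamma>"
      using g h that by (auto simp: jet_def)
    show ?thesis unfolding shift_def[abs_def]
      using L by (simp add: ip_add_left ip_add_right L2_add L2_cmult
          ip_cmult_left ip_cmult_right power2_eq_square algebra_simps)
  qed
  have "jet_form r \<gamma> b (shift b g) (shift b h) + jet_form r \<gamma> b (shift (- b) g) (shift (- b) h) =
    (\<Sum>k\<le>r. 2 * (real (r choose k) * b ^ (2 * (r - k)) *
       (ip \<gamma> (g (Suc k)) (h (Suc k)) + b\<^sup>2 * ip \<gamma> (g k) (h k))))"
    unfolding jet_form_def sum.distrib[symmetric]
    by (rule sum.cong) (simp_all add: ex algebra_simps)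
  then show ?thesis
    unfolding jet_form_def binomial_sum_Suc by (simp add: sum_distrib_left[symmetric])
qed

lemma jet_form_0: "jet_form 0 \<gamma> b g h = ip \<gamma> (g 0) (h 0)"
  by (simp add: jet_form_def)

lemma jet_form_add_left:
  assumes "jet r \<gamma> g" "jet r \<gamma> g'" "jet r \<gamma> h"
  shows "jet_form r \<gamma> b (\<lambda>k x. g k x + g' k x) h = jet_form r \<gamma> b g h + jet_form r \<gamma> b g' h"
  using assms unfolding jet_form_def jet_def sum.distrib[symmetric]
  by (intro sum.cong) (auto simp: ip_add_left algebra_simps)

lemma jet_form_cmult_left:
  "jet_form r \<gamma> b (\<lambda>k x. c * g k x) h = c * jet_form r \<gamma> b g h"
  unfolding jet_form_def sum_distrib_left
  by (intro sum.cong) (auto simp: ip_cmult_left)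

lemma jet_form_commute: "jet_form r \<gamma> b g h = jet_form r \<gamma> b h g"
  by (simp add: jet_form_def ip_commute)

lemma jet_form_nonneg: "0 \<le> b \<Longrightarrow> 0 \<le> jet_form r \<gamma> b g g"
  unfolding jet_form_def by (intro sum_nonneg mult_nonneg_nonneg ip_nonneg) auto

lemma jet_form_poly_jet_eq_0:
  assumes "\<gamma> > -1" "b > 0" "jet_form r \<gamma> b (poly_jet b p) (poly_jet b p) = 0" shows "p = 0"
proof -
  have "\<forall>k\<in>{..r}. real (r choose k) * b ^ (2 * (r - k)) * ip \<gamma> (poly_jet b p k) (poly_jet b p k) = 0"
    using assms(3) unfolding jet_form_def
    by (rule sum_nonneg_eq_0_iff[THEN iffD1, rotated 2])
       (use assms in \<open>auto intro!: mult_nonneg_nonneg ip_nonneg\<close>)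
  from bspec[OF this, of 0] show ?thesis using expoly_norm_eq_0[OF assms(1,2)] assms(2) by simp
qed

section \<open>Orthogonality of the error\<close>

text \<open>The orthogonality of all words of length \<open>s\<close> in \<open>A\<close> and \<open>B\<close>, where every letter \<open>A\<close> lowers the degree bound by
one. The recursion peels off letters in the same way as \<open>jet_form_Suc\<close>.\<close>

fun orth :: "real \<Rightarrow> real \<Rightarrow> nat \<Rightarrow> nat \<Rightarrow> (nat \<Rightarrow> real \<Rightarrow> real) \<Rightarrow> bool"
  where "orth \<gamma> b 0 M g \<longleftrightarrow> (\<forall>q\<in>polys M. ip \<gamma> (g 0) (expoly b q) = 0)"
  | "orth \<gamma> b (Suc s) M g \<longleftrightarrow> orth \<gamma> b s (M - 1) (shift b g) \<and> orth \<gamma> b s M (shift (- b) g)"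

text \<open>Each word of length \<open>s\<close> is the tail of a word of length \<open>s + 1\<close> that begins with \<open>B\<close>; the inner product of
\<open>Bz\<close> with \<open>q\<close> is the inner product of \<open>z\<close> with the image of \<open>q\<close> under the adjoint of \<open>B\<close>, and every
polynomial is such an image of a polynomial of the same degree.\<close>

lemma orth_lower:
  assumes \<gamma>: "\<gamma> > -1" and b: "b > 0"
  shows "jet (Suc s) (\<gamma> + 1) g \<Longrightarrow> orth (\<gamma> + 1) b (Suc s) M g \<Longrightarrow> orth \<gamma> b s M g"
proof (induction s arbitrary: M g)
  case 0
  show ?case
  proof (simp, intro ballI)
    fix q assume "q \<in> polys M"
    then obtain q' where "q' \<in> polys M" "adj_poly (- b) b \<gamma> q' = q" using adj_poly_neg_surj[OF \<gamma>] by blast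
    then show "ip \<gamma> (g 0) (expoly b q) = 0"
      using 0 inner_shift_expoly[of \<gamma> g b "-b" q'] \<gamma> b by simp
  qed
next
  case (Suc s)
  then show ?case by (simp add: jet_shift)
qed

text \<open>A letter \<open>A\<close> can be traded for a letter \<open>B\<close>: both pass to the other side by their adjoints, and the adjoint
of \<open>B\<close> is invertible. The price is one degree. The coefficient formula determines the leading coefficient,
on which \<open>jet_form_pure_branch\<close> depends.\<close>

lemma exchange_shift:
  assumes \<gamma>: "\<gamma> > -1" and b: "b > 0" and q: "q \<in> polys n"
  obtains q' where "q' \<in> polys (Suc n)" "\<And>i. coeff q' (Suc i) = - (2 * b * coeff q i - (real i + \<gamma> + 2) * coeff q (Suc i)) / (real i + \<gamma> + 2)"
    "\<And>g. jet 1 (\<gamma> + 1) g \<Longrightarrow> ip (\<gamma> + 1) (shift b g 0) (expoly b q) =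
       ip (\<gamma> + 1) (shift (- b) g 0) (expoly b q')"
proof -
  obtain q' where q': "q' \<in> polys (Suc n)" "adj_poly (- b) b \<gamma> q' = adj_poly b b \<gamma> q" 
    "\<And>i. coeff q' i = - coeff (adj_poly b b \<gamma> q) i / (real i + \<gamma> + 1)"
    using adj_poly_neg_surj[OF \<gamma> polys_adj_poly[OF q]] by metis
  show ?thesis
  proof (rule that[OF q'(1)])
    show "coeff q' (Suc i) = - (2 * b * coeff q i - (real i + \<gamma> + 2) * coeff q (Suc i)) / (real i + \<gamma> + 2)" for i
      unfolding q'(3) coeff_adj_poly by (simp add: algebra_simps)
    show "ip (\<gamma> + 1) (shift b g 0) (expoly b q) =
       ip (\<gamma> + 1) (shift (- b) g 0) (expoly b q')" if "jet 1 (\<gamma> + 1) g" for g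
      by (simp add: inner_shift_expoly[OF that \<gamma> b] q'(2))
  qed
qed

text \<open>The word consisting of letters \<open>B\<close> alone controls all others, by exchanging letters one at a time.\<close>

lemma orth_of_pure_branch:
  assumes \<gamma>: "\<gamma> > -1" and b: "b > 0"
  shows "jet r (\<gamma> + 1) g \<Longrightarrow> (\<And>q. q \<in> polys M \<Longrightarrow> ip (\<gamma> + 1) ((shift (- b) ^^ r) g 0) (expoly b q) = 0)
     \<Longrightarrow> orth (\<gamma> + 1) b r M g"
proof (induction r arbitrary: g M)
  case (Suc r)
  have "orth (\<gamma> + 1) b r (M - 1) (shift b g)"
  proof (rule Suc.IH)
    show "jet r (\<gamma> + 1) (shift b g)" using Suc.prems(1) by (rule jet_shift)
    fix q assume q: "q \<in> polys (M - 1)"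
    show "ip (\<gamma> + 1) ((shift (- b) ^^ r) (shift b g) 0) (expoly b q) = 0"
    proof (cases M)
      case 0
      then have "q = 0" using q by (simp add: polys_0)
      then show ?thesis by (simp add: weighted_inner_def)
    next
      case (Suc n)
      obtain q' where q': "q' \<in> polys (Suc (M - 1))"
        "\<And>g. jet 1 (\<gamma> + 1) g \<Longrightarrow> ip (\<gamma> + 1) (shift b g 0) (expoly b q) =
       ip (\<gamma> + 1) (shift (- b) g 0) (expoly b q')"
        using exchange_shift[OF \<gamma> b q] by metis
      have "jet 1 (\<gamma> + 1) ((shift (- b) ^^ r) g)" using Suc.prems(1) by (intro jet_funpow_shift) simp
      from q'(2)[OF this] show ?thesis
        using Suc.prems(2)[of q'] q'(1) Suc by (simp add: funpow_shift_commute)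
    qed
  qed
  moreover have "orth (\<gamma> + 1) b r M (shift (- b) g)"
    using Suc.prems by (intro Suc.IH) (auto simp: jet_shift funpow_swap1)
  ultimately show ?case by simp
qed simp

text \<open>Exchanging letters in all words turns the form, with \<open>expoly b p\<close> as one argument, into a single inner
product with the pure word in \<open>B\<close>. The resulting map \<open>p \<mapsto> q\<close> is triangular with respect to the
degree. Its diagonal entries \<open>\<kappa> n\<close> cannot vanish, as the pure word contributes to them and all words that
contribute do so with the same sign \<open>(-1)\<^sup>r\<close>.\<close>

lemma jet_form_pure_branch:
  assumes \<gamma>: "\<gamma> > -1" and b: "b > 0"
  shows "\<exists>\<kappa>::nat \<Rightarrow> real. \<forall>n. (-1) ^ r * \<kappa> n > 0 \<and> (\<forall>p\<in>polys (Suc n). \<exists>q\<in>polys (Suc n).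
      coeff q n = \<kappa> n * coeff p n \<and>
      (\<forall>g. jet r (\<gamma> + 1) g \<longrightarrow> jet_form r (\<gamma> + 1) b g (poly_jet b p) =
          ip (\<gamma> + 1) ((shift (- b) ^^ r) g 0) (expoly b q)))"
proof (induction r)
  case 0
  show ?case by (intro exI[of _ "\<lambda>_. 1"]) (auto simp: jet_form_0)
next
  case (Suc r)
  then obtain \<kappa> :: "nat \<Rightarrow> real" where \<kappa>: "\<And>n. (-1) ^ r * \<kappa> n > 0" 
    "\<And>n p. p \<in> polys (Suc n) \<Longrightarrow> \<exists>q\<in>polys (Suc n). coeff q n = \<kappa> n * coeff p n \<and>
      (\<forall>g. jet r (\<gamma> + 1) g \<longrightarrow> jet_form r (\<gamma> + 1) b g (poly_jet b p) =
          ip (\<gamma> + 1) ((shift (- b) ^^ r) g 0) (expoly b q))" by metis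
  \<comment> \<open>the first summand comes from the words beginning with \<open>A\<close> (differentiation yields \<open>n\<close>, the exchange yields \<open>- 2 b / (n + \<gamma> + 1)\<close>, the average halves it), the second from those beginning with \<open>B\<close>\<close>
  let ?k = "\<lambda>n. - b * (real n * \<kappa> (n - 1) / (real n + \<gamma> + 1) + \<kappa> n)"
  have \<gamma>1: "\<gamma> + 1 > -1" using \<gamma> by simp
  show ?case
  proof (intro exI[of _ ?k] allI conjI ballI)
    fix n
    have "0 \<le> real n * ((-1) ^ r * \<kappa> (n - 1)) / (real n + \<gamma> + 1)" 
      using \<gamma> by (intro divide_nonneg_nonneg mult_nonneg_nonneg[OF of_nat_0_le_iff less_imp_le[OF \<kappa>(1)]]) auto
    then have "0 < b * (real n * ((-1) ^ r * \<kappa> (n - 1)) / (real n + \<gamma> + 1) + (-1) ^ r * \<kappa> n)"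
      using \<kappa>(1)[of n] b by (intro mult_pos_pos) auto
    then show "(-1) ^ Suc r * ?k n > 0" by (simp add: algebra_simps)
  next
    fix n p assume p: "p \<in> polys (Suc n)"
    have "\<exists>q\<in>polys (Suc n). coeff q n = - 2 * b * real n * \<kappa> (n - 1) / (real n + \<gamma> + 1) * coeff p n \<and>
      (\<forall>g. jet (Suc r) (\<gamma> + 1) g \<longrightarrow> jet_form r (\<gamma> + 1) b (shift b g) (poly_jet b (pderiv p)) =
          ip (\<gamma> + 1) ((shift (- b) ^^ Suc r) g 0) (expoly b q))"
    proof (cases n)
      case 0
      then have "pderiv p = 0" using p by (simp add: polys_Suc pderiv_eq_0_iff)
      moreover have "poly_jet b 0 = (\<lambda>k x. 0)" using poly_jet_smult[of b 0 0] by simp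
      ultimately show ?thesis using 0
        by (intro bexI[of _ 0]) (auto simp: jet_form_def weighted_inner_def polys_zero)
    next
      case (Suc m)
      have "pderiv p \<in> polys (Suc m)" using polys_pderiv[OF p] Suc by simp
      from \<kappa>(2)[OF this] obtain q where q: "q \<in> polys (Suc m)" "coeff q m = \<kappa> m * coeff (pderiv p) m"
        "\<And>g. jet r (\<gamma> + 1) g \<Longrightarrow> jet_form r (\<gamma> + 1) b g (poly_jet b (pderiv p)) =
          ip (\<gamma> + 1) ((shift (- b) ^^ r) g 0) (expoly b q)" by blast
      from exchange_shift[OF \<gamma> b q(1)] obtain q' where q': "q' \<in> polys (Suc (Suc m))"
        "\<And>i. coeff q' (Suc i) = - (2 * b * coeff q i - (real i + \<gamma> + 2) * coeff q (Suc i)) / (real i + \<gamma> + 2)"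
        "\<And>g. jet 1 (\<gamma> + 1) g \<Longrightarrow> ip (\<gamma> + 1) (shift b g 0) (expoly b q) =
         ip (\<gamma> + 1) (shift (- b) g 0) (expoly b q')" by metis
      have c0: "coeff q (Suc m) = 0" using q(1) by (simp add: polys_def)
      show ?thesis
      proof (intro bexI[of _ q'] conjI allI impI)
        show "coeff q' n = - 2 * b * real n * \<kappa> (n - 1) / (real n + \<gamma> + 1) * coeff p n"
          using Suc by (simp add: q'(2) q(2) c0 coeff_pderiv add_ac)
        show "q' \<in> polys (Suc n)" using q'(1) Suc by simp
        fix g assume g: "jet (Suc r) (\<gamma> + 1) g"
        have "jet 1 (\<gamma> + 1) ((shift (- b) ^^ r) g)" using g by (intro jet_funpow_shift) simp
        then show "jet_form r (\<gamma> + 1) b (shift b g) (poly_jet b (pderiv p)) =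
          ip (\<gamma> + 1) ((shift (- b) ^^ Suc r) g 0) (expoly b q')"
          using q(3)[OF jet_shift[OF g]] q'(3) by (simp add: funpow_shift_commute)
      qed
    qed
    then obtain q1 where q1: "q1 \<in> polys (Suc n)" "coeff q1 n = - 2 * b * real n * \<kappa> (n - 1) / (real n + \<gamma> + 1) * coeff p n"
      "\<And>g. jet (Suc r) (\<gamma> + 1) g \<Longrightarrow> jet_form r (\<gamma> + 1) b (shift b g) (poly_jet b (pderiv p)) =
          ip (\<gamma> + 1) ((shift (- b) ^^ Suc r) g 0) (expoly b q1)" by blast
    let ?p2 = "pderiv p - smult (2 * b) p"
    have p2: "?p2 \<in> polys (Suc n)"
      using p polys_mono[OF polys_pderiv[OF p], of "Suc n"] by (auto intro: polys_diff polys_smult)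
    from \<kappa>(2)[OF p2] obtain q2 where q2: "q2 \<in> polys (Suc n)" "coeff q2 n = \<kappa> n * coeff ?p2 n"
        "\<And>g. jet r (\<gamma> + 1) g \<Longrightarrow> jet_form r (\<gamma> + 1) b g (poly_jet b ?p2) =
          ip (\<gamma> + 1) ((shift (- b) ^^ r) g 0) (expoly b q2)" by blast
    have c2: "coeff ?p2 n = - 2 * b * coeff p n" using p by (simp add: coeff_pderiv polys_def)
    let ?q = "smult (1/2) (q1 + q2)"
    show "\<exists>q\<in>polys (Suc n). coeff q n = ?k n * coeff p n \<and>
      (\<forall>g. jet (Suc r) (\<gamma> + 1) g \<longrightarrow> jet_form (Suc r) (\<gamma> + 1) b g (poly_jet b p) =
          ip (\<gamma> + 1) ((shift (- b) ^^ Suc r) g 0) (expoly b q))"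
    proof (intro bexI[of _ ?q] conjI allI impI)
      show "?q \<in> polys (Suc n)" using q1 q2 by (intro polys_smult polys_add)
      show "coeff ?q n = ?k n * coeff p n" by (simp add: q1(2) q2(2)[unfolded c2]) (simp add: algebra_simps)
      fix g assume g: "jet (Suc r) (\<gamma> + 1) g"
      have top: "(shift (- b) ^^ Suc r) g 0 \<in> L2 (\<gamma> + 1)"
        using jet_funpow_shift[of 0 "Suc r" "\<gamma> + 1" g "-b"] g by (simp add: jet_def)
      have "jet_form (Suc r) (\<gamma> + 1) b g (poly_jet b p) =
        (ip (\<gamma> + 1) ((shift (- b) ^^ Suc r) g 0) (expoly b q1) +
         ip (\<gamma> + 1) ((shift (- b) ^^ Suc r) g 0) (expoly b q2)) / 2"
        unfolding jet_form_Suc[OF g jet_poly_jet[OF \<gamma>1 b]] shift_poly_jet_pos shift_poly_jet_neg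
        using q1(3)[OF g] q2(3)[OF jet_shift[OF g]] by (simp add: funpow_swap1)
      also have "\<dots> = ip (\<gamma> + 1) ((shift (- b) ^^ Suc r) g 0) (expoly b ?q)"
        unfolding expoly_smult expoly_add ip_cmult_right
          ip_add_right[OF expoly_weighted_L2[OF \<gamma>1 b] expoly_weighted_L2[OF \<gamma>1 b] top] by simp
      finally show "jet_form (Suc r) (\<gamma> + 1) b g (poly_jet b p) =
          ip (\<gamma> + 1) ((shift (- b) ^^ Suc r) g 0) (expoly b ?q)" .
    qed
  qed
qed

text \<open>The triangular map of \<open>jet_form_pure_branch\<close> is onto, hence orthogonality with respect to the form implies
orthogonality of the pure word.\<close>

lemma pure_branch_orthogonal:
  assumes \<gamma>: "\<gamma> > -1" and b: "b > 0" and g: "jet r (\<gamma> + 1) g"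
    and o: "\<And>p. p \<in> polys M \<Longrightarrow> jet_form r (\<gamma> + 1) b g (poly_jet b p) = 0"
    and q: "q \<in> polys M"
  shows "ip (\<gamma> + 1) ((shift (- b) ^^ r) g 0) (expoly b q) = 0"
proof -
  obtain \<kappa> :: "nat \<Rightarrow> real" where \<kappa>: "\<And>n. (-1) ^ r * \<kappa> n > 0" 
    "\<And>n p. p \<in> polys (Suc n) \<Longrightarrow> \<exists>q\<in>polys (Suc n). coeff q n = \<kappa> n * coeff p n \<and>
      (\<forall>g. jet r (\<gamma> + 1) g \<longrightarrow> jet_form r (\<gamma> + 1) b g (poly_jet b p) =
          ip (\<gamma> + 1) ((shift (- b) ^^ r) g 0) (expoly b q))"
    using jet_form_pure_branch[OF \<gamma> b, of r] by metis
  have \<gamma>1: "\<gamma> + 1 > -1" using \<gamma> by simp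
  have top: "(shift (- b) ^^ r) g 0 \<in> L2 (\<gamma> + 1)"
    using jet_funpow_shift[of 0 r "\<gamma> + 1" g "-b"] g by (simp add: jet_def)
  have "n \<le> M \<Longrightarrow> q \<in> polys n \<Longrightarrow> ip (\<gamma> + 1) ((shift (- b) ^^ r) g 0) (expoly b q) = 0" for n
  proof (induction n arbitrary: q)
    case 0
    then show ?case by (simp add: polys_0 weighted_inner_def)
  next
    case (Suc n)
    have k0: "\<kappa> n \<noteq> 0" using \<kappa>(1)[of n] by auto
    let ?p = "monom (coeff q n / \<kappa> n) n"
    have p: "?p \<in> polys (Suc n)" by (simp add: polys_Suc degree_monom_le)
    from \<kappa>(2)[OF p] obtain q0 where q0: "q0 \<in> polys (Suc n)" "coeff q0 n = coeff q n" 
      "jet_form r (\<gamma> + 1) b g (poly_jet b ?p) = ip (\<gamma> + 1) ((shift (- b) ^^ r) g 0) (expoly b q0)"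
      using g k0 by auto
    have "q - q0 \<in> polys n"
      using Suc.prems(2) q0 by (auto simp: polys_def) (metis Suc_leI le_neq_implies_less)
    then have "ip (\<gamma> + 1) ((shift (- b) ^^ r) g 0) (expoly b (q - q0)) = 0"
      using Suc by simp
    moreover have "jet_form r (\<gamma> + 1) b g (poly_jet b ?p) = 0"
      by (rule o[OF polys_mono[OF p Suc.prems(1)]])
    moreover have "expoly b q = (\<lambda>x. expoly b (q - q0) x + expoly b q0 x)"
      by (simp flip: expoly_add)
    ultimately show ?case using q0(3)
      by (simp add: ip_add_right[OF expoly_weighted_L2[OF \<gamma>1 b] expoly_weighted_L2[OF \<gamma>1 b] top])
  qed
  from this[OF le_refl q] show ?thesis .
qed

section \<open>Orthogonal projection onto polynomials\<close>

lemma polys_split: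
  assumes "q \<in> polys (Suc n)" "e \<in> polys (Suc n)" "coeff e n = 1"
  shows "q - smult (coeff q n) e \<in> polys n"
  unfolding polys_def
proof (clarify)
  fix i assume "n \<le> i"
  then show "coeff (q - smult (coeff q n) e) i = 0"
    using assms by (cases "i = n") (auto simp: polys_def)
qed

text \<open>The Riesz representation on polynomials of bounded degree. The induction on the degree is the
Gram-Schmidt process: \<open>e\<close> is the monic polynomial of degree \<open>n\<close> orthogonal to all lower degrees.\<close>

lemma polys_representation:
  fixes B :: "real poly \<Rightarrow> real poly \<Rightarrow> real"
  assumes add: "\<And>p p' q. B (p + p') q = B p q + B p' q" and smult: "\<And>c p q. B (smult c p) q = c * B p q"
    and sym: "\<And>p q. B p q = B q p" and pos: "\<And>p. B p p = 0 \<Longrightarrow> p = 0"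
  shows "(\<And>p q. \<phi> (p + q) = \<phi> p + \<phi> q) \<Longrightarrow> (\<And>c p. \<phi> (smult c p) = c * \<phi> p) \<Longrightarrow>
    \<exists>p\<in>polys n. \<forall>q\<in>polys n. B p q = (\<phi> q :: real)"
proof (induction n arbitrary: \<phi>)
  case 0
  have "\<phi> 0 = 0" using 0(2)[of 0 0] by simp
  moreover have "B 0 q = 0" for q using smult[of 0 0 q] by simp
  ultimately show ?case by (auto simp: polys_0)
next
  case (Suc n)
  have "\<exists>p\<in>polys n. \<forall>q\<in>polys n. B p q = B (monom 1 n) q"
    by (rule Suc.IH) (simp_all add: sym[of "monom 1 n"] add smult)
  then obtain r where r: "r \<in> polys n" "\<And>q. q \<in> polys n \<Longrightarrow> B r q = B (monom 1 n) q" by blast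
  define e where "e = monom 1 n + smult (- 1) r"
  have e: "e \<in> polys (Suc n)" "coeff e n = 1"
    using r(1) by (auto simp: e_def polys_def)
  have eo: "B e q = 0" if "q \<in> polys n" for q
    using r(2)[OF that] unfolding e_def add smult by simp
  have "e \<noteq> 0" using e(2) by auto
  then have ee: "B e e \<noteq> 0" using pos by blast
  obtain p0 where p0: "p0 \<in> polys n" "\<And>q. q \<in> polys n \<Longrightarrow> B p0 q = \<phi> q"
    using Suc.IH[of \<phi>] Suc.prems by blast
  define p where "p = p0 + smult (\<phi> e / B e e) e"
  have "p \<in> polys (Suc n)" unfolding p_def
    using e(1) polys_mono[OF p0(1)] by (intro polys_add polys_smult) auto
  moreover have "B p q = \<phi> q" if q: "q \<in> polys (Suc n)" for q
  proof -
    define q' where "q' = q - smult (coeff q n) e"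
    have q': "q' \<in> polys n" unfolding q'_def by (rule polys_split[OF q e])
    have qe: "q = q' + smult (coeff q n) e" by (simp add: q'_def)
    have "B p q' = \<phi> q'" unfolding p_def add smult using p0(2)[OF q'] eo[OF q'] by simp
    moreover have "B p e = \<phi> e" unfolding p_def add smult using eo[OF p0(1)] ee by (simp add: sym[of p0 e])
    moreover have "B p q = B p q' + coeff q n * B p e"
      by (subst qe) (simp only: sym[of p] add smult)
    moreover have "\<phi> q = \<phi> q' + coeff q n * \<phi> e"
      by (subst qe) (simp only: Suc.prems)
    ultimately show ?thesis by simp
  qed
  ultimately show ?case by blast
qed

section \<open>Density of the Laguerre functions\<close>

definition sq_norm :: "real \<Rightarrow> (real \<Rightarrow> real) \<Rightarrow> real"
  where "sq_norm \<gamma> f = ip \<gamma> f f"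

lemma sq_norm_nonneg: "0 \<le> sq_norm \<gamma> f"
  by (simp add: sq_norm_def ip_nonneg)

lemma L2_diff:
  assumes u: "u \<in> L2 \<gamma>" and v: "v \<in> L2 \<gamma>"
  shows "(\<lambda>x. u x - v x) \<in> L2 \<gamma>"
  using L2_add[OF u L2_cmult[OF v, of "-1"]] by simp

lemma sq_norm_add:
  assumes u: "u \<in> L2 \<gamma>" and v: "v \<in> L2 \<gamma>"
  shows "sq_norm \<gamma> (\<lambda>x. u x + v x) = sq_norm \<gamma> u + 2 * ip \<gamma> u v + sq_norm \<gamma> v"
  unfolding sq_norm_def using u v
  by (simp add: ip_add_left ip_add_right L2_add ip_commute[of _ v u])

lemma sq_norm_cmult: "sq_norm \<gamma> (\<lambda>x. c * u x) = c\<^sup>2 * sq_norm \<gamma> u"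
  by (simp add: sq_norm_def ip_cmult_left ip_cmult_right power2_eq_square)

lemma sq_norm_add_le:
  assumes u: "u \<in> L2 \<gamma>" and v: "v \<in> L2 \<gamma>"
  shows "sq_norm \<gamma> (\<lambda>x. u x + v x) \<le> 2 * sq_norm \<gamma> u + 2 * sq_norm \<gamma> v"
proof -
  have "0 \<le> sq_norm \<gamma> (\<lambda>x. u x + (- 1) * v x)" by (rule sq_norm_nonneg)
  also have "\<dots> = sq_norm \<gamma> u - 2 * ip \<gamma> u v + sq_norm \<gamma> v"
    by (subst sq_norm_add[OF u L2_cmult[OF v]]) (simp only: sq_norm_cmult ip_cmult_right, simp)
  finally show ?thesis using sq_norm_add[OF u v] by simp
qed

lemma L2_dominated:
  assumes h: "h \<in> L2 \<gamma>" and f: "f \<in> borel_measurable (lebesgue_on \<Lambda>)"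
    and le: "\<And>x. x > 0 \<Longrightarrow> \<bar>f x\<bar> \<le> \<bar>h x\<bar>"
  shows "f \<in> L2 \<gamma>"
proof -
  have "(\<lambda>x. (f x)\<^sup>2 * wt \<gamma> x) absolutely_integrable_on \<Lambda>"
  proof (rule measurable_bounded_by_integrable_imp_absolutely_integrable)
    show "(\<lambda>x. (f x)\<^sup>2 * wt \<gamma> x) \<in> borel_measurable (lebesgue_on \<Lambda>)"
      using f wt_measurable_half_line by (intro borel_measurable_times borel_measurable_power)
    show "norm ((f x)\<^sup>2 * wt \<gamma> x) \<le> (h x)\<^sup>2 * wt \<gamma> x" if "x \<in> \<Lambda>" for x
      using le[of x] that by (auto simp: half_line_def abs_le_square_iff intro: mult_right_mono)
  qed (use L2_D(3)[OF h] in auto)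
  then show ?thesis using f by (simp add: weighted_L2_def)
qed

lemma sq_norm_dominated_tendsto:
  assumes h: "h \<in> L2 \<gamma>" and f: "\<And>n. f n \<in> borel_measurable (lebesgue_on \<Lambda>)"
    and le: "\<And>n x. x > 0 \<Longrightarrow> \<bar>f n x\<bar> \<le> \<bar>h x\<bar>"
    and g: "g \<in> borel_measurable (lebesgue_on \<Lambda>)" and lim: "\<And>x. x > 0 \<Longrightarrow> (\<lambda>n. f n x) \<longlonglongrightarrow> g x"
  shows "g \<in> L2 \<gamma>" and "(\<lambda>n. sq_norm \<gamma> (\<lambda>x. g x - f n x)) \<longlonglongrightarrow> 0"
proof -
  have gle: "\<bar>g x\<bar> \<le> \<bar>h x\<bar>" if "x > 0" for x
    by (rule LIMSEQ_le_const2[OF tendsto_rabs[OF lim[OF that]]]) (use le[OF that] in auto)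
  show gL: "g \<in> L2 \<gamma>" by (rule L2_dominated[OF h g gle])
  have fL: "f n \<in> L2 \<gamma>" for n by (rule L2_dominated[OF h f le])
  note dL = L2_diff[OF gL fL]
  let ?d = "\<lambda>n x. (g x - f n x) * (g x - f n x) * wt \<gamma> x"
  have ai: "?d n absolutely_integrable_on \<Lambda>" for n by (rule L2_mult_integrable[OF dL dL])
  have "(\<lambda>n. integral \<Lambda> (?d n)) \<longlonglongrightarrow> integral \<Lambda> (\<lambda>x. 0)"
  proof (rule dominated_convergence(2))
    show "?d n integrable_on \<Lambda>" for n using ai by (rule set_lebesgue_integral_eq_integral(1))
    show "(\<lambda>x. 4 * ((h x)\<^sup>2 * wt \<gamma> x)) integrable_on \<Lambda>"
      using integrable_on_cmult_left[OF L2_D(3)[OF h], of 4] by simp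
    show "norm (?d n x) \<le> 4 * ((h x)\<^sup>2 * wt \<gamma> x)" if "x \<in> \<Lambda>" for n x
    proof -
      have "\<bar>g x - f n x\<bar> \<le> \<bar>2 * h x\<bar>" using gle[of x] le[of x n] that by (auto simp: half_line_def)
      then have "(g x - f n x)\<^sup>2 \<le> (2 * h x)\<^sup>2" by (simp only: abs_le_square_iff)
      from mult_right_mono[OF this wt_nonneg[of \<gamma> x]] show ?thesis
        by (simp add: power2_eq_square abs_mult)
    qed
    show "(\<lambda>n. ?d n x) \<longlonglongrightarrow> 0" if "x \<in> \<Lambda>" for x
    proof -
      have "(\<lambda>n. ?d n x) \<longlonglongrightarrow> (g x - g x) * (g x - g x) * wt \<gamma> x"
        using lim[of x] that by (intro tendsto_intros) (auto simp: half_line_def)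
      then show ?thesis by simp
    qed
  qed
  then show "(\<lambda>n. sq_norm \<gamma> (\<lambda>x. g x - f n x)) \<longlonglongrightarrow> 0"
    using set_lebesgue_integral_eq_integral(2)[OF ai] by (simp add: sq_norm_def weighted_inner_def)
qed

definition approximable :: "real \<Rightarrow> real \<Rightarrow> (real \<Rightarrow> real) \<Rightarrow> bool"
  where "approximable \<gamma> b f \<longleftrightarrow> f \<in> L2 \<gamma> \<and> (\<forall>\<epsilon>>0. \<exists>p. sq_norm \<gamma> (\<lambda>x. f x - expoly b p x) < \<epsilon>)"

context
  fixes \<gamma> b :: real
  assumes \<gamma>: "\<gamma> > -1" and b: "b > 0"
begin

lemma approximable_expoly: "approximable \<gamma> b (expoly b p)"
  unfolding approximable_def
  using expoly_weighted_L2[OF \<gamma> b, of p] by (auto intro!: exI[of _ p] simp: sq_norm_def weighted_inner_def)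

lemma approximable_closed:
  assumes f: "f \<in> L2 \<gamma>" and ex: "\<And>\<epsilon>. \<epsilon> > 0 \<Longrightarrow> \<exists>g. approximable \<gamma> b g \<and> sq_norm \<gamma> (\<lambda>x. f x - g x) < \<epsilon>"
  shows "approximable \<gamma> b f"
  unfolding approximable_def
proof (intro conjI allI impI)
  fix \<epsilon> :: real assume "\<epsilon> > 0"
  then obtain g where g: "approximable \<gamma> b g" "sq_norm \<gamma> (\<lambda>x. f x - g x) < \<epsilon> / 4" using ex[of "\<epsilon> / 4"] by auto
  then obtain p where p: "sq_norm \<gamma> (\<lambda>x. g x - expoly b p x) < \<epsilon> / 4"
    using \<open>\<epsilon> > 0\<close> unfolding approximable_def by (meson divide_pos_pos zero_less_numeral)
  have gL: "g \<in> L2 \<gamma>" using g by (simp add: approximable_def)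
  have "sq_norm \<gamma> (\<lambda>x. f x - expoly b p x) = sq_norm \<gamma> (\<lambda>x. (f x - g x) + (g x - expoly b p x))" by simp
  also have "\<dots> \<le> 2 * sq_norm \<gamma> (\<lambda>x. f x - g x) + 2 * sq_norm \<gamma> (\<lambda>x. g x - expoly b p x)"
    by (intro sq_norm_add_le L2_diff f gL expoly_weighted_L2[OF \<gamma> b])
  also have "\<dots> < \<epsilon>" using g(2) p by simp
  finally show "\<exists>p. sq_norm \<gamma> (\<lambda>x. f x - expoly b p x) < \<epsilon>" by blast
qed (rule f)

lemma approximable_limit:
  assumes h: "h \<in> L2 \<gamma>" and f: "\<And>n. approximable \<gamma> b (f n)"
    and le: "\<And>n x. x > 0 \<Longrightarrow> \<bar>f n x\<bar> \<le> \<bar>h x\<bar>"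
    and g: "g \<in> borel_measurable (lebesgue_on \<Lambda>)" and lim: "\<And>x. x > 0 \<Longrightarrow> (\<lambda>n. f n x) \<longlonglongrightarrow> g x"
  shows "approximable \<gamma> b g"
proof -
  have m: "f n \<in> borel_measurable (lebesgue_on \<Lambda>)" for n
    using f[of n] by (simp add: approximable_def weighted_L2_def)
  note t = sq_norm_dominated_tendsto[OF h m le g lim]
  show ?thesis
  proof (rule approximable_closed[OF t(1)])
    fix \<epsilon> :: real assume "\<epsilon> > 0"
    from order_tendstoD(2)[OF t(2) this] obtain n where "sq_norm \<gamma> (\<lambda>x. g x - f n x) < \<epsilon>"
      by (auto simp: eventually_sequentially)
    then show "\<exists>h. approximable \<gamma> b h \<and> sq_norm \<gamma> (\<lambda>x. g x - h x) < \<epsilon>" using f by blast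
  qed
qed

lemma approximable_add:
  assumes f: "approximable \<gamma> b f" and g: "approximable \<gamma> b g" shows "approximable \<gamma> b (\<lambda>x. f x + g x)"
  unfolding approximable_def
proof (intro conjI allI impI)
  have L: "f \<in> L2 \<gamma>" "g \<in> L2 \<gamma>" using f g by (auto simp: approximable_def)
  then show "(\<lambda>x. f x + g x) \<in> L2 \<gamma>" by (rule L2_add)
  fix \<epsilon> :: real assume "\<epsilon> > 0"
  then obtain p q where p: "sq_norm \<gamma> (\<lambda>x. f x - expoly b p x) < \<epsilon> / 4" and q: "sq_norm \<gamma> (\<lambda>x. g x - expoly b q x) < \<epsilon> / 4"
    using f g unfolding approximable_def by (meson divide_pos_pos zero_less_numeral)
  have "sq_norm \<gamma> (\<lambda>x. (f x + g x) - expoly b (p + q) x) = sq_norm \<gamma> (\<lambda>x. (f x - expoly b p x) + (g x - expoly b q x))"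
    by (simp add: expoly_add algebra_simps)
  also have "\<dots> \<le> 2 * sq_norm \<gamma> (\<lambda>x. f x - expoly b p x) + 2 * sq_norm \<gamma> (\<lambda>x. g x - expoly b q x)"
    by (intro sq_norm_add_le L2_diff L expoly_weighted_L2[OF \<gamma> b])
  also have "\<dots> < \<epsilon>" using p q by simp
  finally show "\<exists>p. sq_norm \<gamma> (\<lambda>x. f x + g x - expoly b p x) < \<epsilon>" by blast
qed

lemma exp_taylor_bound:
  fixes x :: real
  shows "\<bar>\<Sum>k<n. (- x) ^ k / fact k\<bar> \<le> exp \<bar>x\<bar>"
proof -
  have "\<bar>\<Sum>k<n. (- x) ^ k / fact k\<bar> \<le> (\<Sum>k<n. \<bar>x\<bar> ^ k / fact k)"
    by (rule order_trans[OF sum_abs]) (simp add: power_abs)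
  also have "\<dots> \<le> (\<Sum>k. \<bar>x\<bar> ^ k / fact k)"
    by (rule sum_le_suminf) (use summable_exp[of "\<bar>x\<bar>"] in \<open>auto simp: field_simps\<close>)
  also have "\<dots> = exp \<bar>x\<bar>" by (simp add: exp_def field_simps)
  finally show ?thesis .
qed

text \<open>The exponential \<open>exp (- (b + j b/2) x)\<close> is reached from \<open>exp (- b x)\<close> in \<open>j\<close> steps of size \<open>b/2\<close>. In each step the
factor \<open>exp (- b x / 2)\<close> is replaced by its Taylor polynomials; their modulus is at most
\<open>exp (b x / 2)\<close>, so a step is short enough for the majorant to retain the decay \<open>exp (- b x / 2)\<close>.\<close>

lemma approximable_faster_exp: "approximable \<gamma> b (expoly (b + real j * (b / 2)) q)"
proof (induction j arbitrary: q)
  case 0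
  then show ?case by (simp add: approximable_expoly)
next
  case (Suc j)
  define \<tau> where "\<tau> = b / 2"
  define c where "c = b + real j * \<tau>"
  have c: "c - \<tau> > 0" using b by (simp add: c_def \<tau>_def add_pos_nonneg)
  define T where "T n = (\<Sum>k<n. monom ((- \<tau>) ^ k / fact k) k)" for n
  have T: "poly (T n) x = (\<Sum>k<n. (- (\<tau> * x)) ^ k / fact k)" for n and x :: real
  proof -
    have "poly (monom ((- \<tau>) ^ k / fact k) k) x = (- (\<tau> * x)) ^ k / fact k" for k
      by (simp only: poly_monom mult_minus_left[symmetric] power_mult_distrib times_divide_eq_left)
    then show ?thesis by (simp only: T_def poly_sum)
  qed
  have "approximable \<gamma> b (expoly (c + \<tau>) q)"
  proof (rule approximable_limit)
    show "approximable \<gamma> b (expoly c (T n * q))" for n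
      using Suc.IH[of "T n * q"] by (simp add: c_def \<tau>_def)
    show "expoly (c - \<tau>) q \<in> L2 \<gamma>" by (rule expoly_weighted_L2[OF \<gamma> c])
    show "expoly (c + \<tau>) q \<in> borel_measurable (lebesgue_on \<Lambda>)"
      by (rule primitive_measurable[OF primitive_expoly])
    fix x :: real assume x: "x > 0"
    show "\<bar>expoly c (T n * q) x\<bar> \<le> \<bar>expoly (c - \<tau>) q x\<bar>" for n
    proof -
      have "\<bar>poly (T n) x\<bar> \<le> exp (\<tau> * x)"
        using exp_taylor_bound[of "\<tau> * x" n] x b by (simp add: T \<tau>_def)
      then have "exp (- c * x) * \<bar>poly (T n) x\<bar> * \<bar>poly q x\<bar> \<le> exp (- c * x) * exp (\<tau> * x) * \<bar>poly q x\<bar>"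
        by (intro mult_right_mono mult_left_mono) auto
      also have "exp (- c * x) * exp (\<tau> * x) = exp (- (c - \<tau>) * x)"
        by (simp only: mult_exp_exp) (simp add: algebra_simps)
      finally show ?thesis by (simp add: expoly_def abs_mult mult.assoc)
    qed
    have "(\<lambda>n. \<Sum>k<n. (- (\<tau> * x)) ^ k / fact k) \<longlonglongrightarrow> exp (- (\<tau> * x))"
      using summable_LIMSEQ[OF summable_exp[of "- (\<tau> * x)"]] by (simp add: exp_def field_simps)
    then have "(\<lambda>n. exp (- c * x) * poly (T n) x * poly q x) \<longlonglongrightarrow> exp (- c * x) * exp (- (\<tau> * x)) * poly q x"
      unfolding T by (intro tendsto_intros)
    moreover have "exp (- c * x) * exp (- (\<tau> * x)) = exp (- (c + \<tau>) * x)"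
      by (simp only: mult_exp_exp) (simp add: algebra_simps)
    ultimately show "(\<lambda>n. expoly c (T n * q) x) \<longlonglongrightarrow> expoly (c + \<tau>) q x"
      by (simp only: expoly_def poly_mult mult.assoc)
  qed
  then show ?case by (simp add: c_def \<tau>_def algebra_simps add_divide_distrib)
qed

text \<open>In the variable \<open>y = exp (- b x / 2)\<close> the half-line is the open unit interval, and the Weierstrass theorem
applies: powers of \<open>y\<close> are the exponentials treated before.\<close>

lemma approximable_exp_continuous:
  assumes h: "continuous_on {0..1} h"
  shows "approximable \<gamma> b (\<lambda>x. exp (- b * x) * h (exp (- (b / 2) * x)))"
proof (rule approximable_closed)
  let ?y = "\<lambda>x. exp (- (b / 2) * x)"
  have y: "?y x \<in> {0..1}" if "x > 0" for x using that b by simp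
  obtain C where C: "\<And>y. y \<in> {0..1} \<Longrightarrow> \<bar>h y\<bar> \<le> C"
    using compact_imp_bounded[OF compact_continuous_image[OF h compact_Icc]]
    unfolding bounded_iff by (metis imageI real_norm_def)
  have hm: "(\<lambda>x. exp (- b * x) * h (?y x)) \<in> borel_measurable (lebesgue_on \<Lambda>)"
  proof (rule continuous_imp_measurable_on_sets_lebesgue)
    show "continuous_on \<Lambda> (\<lambda>x. exp (- b * x) * h (?y x))"
      by (intro continuous_intros continuous_on_compose2[OF h]) (use y in \<open>auto simp: half_line_def\<close>)
  qed auto
  note E = expoly_weighted_L2[OF \<gamma> b, of "1"]
  have dom: "(\<lambda>x. exp (- b * x) * g x) \<in> L2 \<gamma> \<and> sq_norm \<gamma> (\<lambda>x. exp (- b * x) * g x) \<le> C\<^sup>2 * sq_norm \<gamma> (expoly b 1)"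
    if m: "(\<lambda>x. exp (- b * x) * g x) \<in> borel_measurable (lebesgue_on \<Lambda>)" and le: "\<And>x. x > 0 \<Longrightarrow> \<bar>g x\<bar> \<le> C" for g C
  proof
    have C: "0 \<le> C" using le[of 1] by simp
    show L: "(\<lambda>x. exp (- b * x) * g x) \<in> L2 \<gamma>"
      by (rule L2_dominated[OF L2_cmult[OF E, of C] m])
         (use le C in \<open>auto simp: expoly_def abs_mult mult.commute intro: mult_left_mono\<close>)
    show "sq_norm \<gamma> (\<lambda>x. exp (- b * x) * g x) \<le> C\<^sup>2 * sq_norm \<gamma> (expoly b 1)"
      unfolding sq_norm_cmult[symmetric] unfolding sq_norm_def weighted_inner_def
    proof (rule set_integral_mono)
      fix x assume "x \<in> \<Lambda>"
      then have "\<bar>exp (- b * x) * g x\<bar> \<le> \<bar>C * expoly b 1 x\<bar>"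
        using le[of x] C by (auto simp: half_line_def expoly_def abs_mult mult.commute intro: mult_left_mono)
      then have "(exp (- b * x) * g x)\<^sup>2 \<le> (C * expoly b 1 x)\<^sup>2" by (simp only: abs_le_square_iff)
      from mult_right_mono[OF this wt_nonneg[of \<gamma> x]]
      show "exp (- b * x) * g x * (exp (- b * x) * g x) * wt \<gamma> x \<le> C * expoly b 1 x * (C * expoly b 1 x) * wt \<gamma> x"
        by (simp add: power2_eq_square)
    qed (intro L2_mult_integrable L L2_cmult[OF E])+
  qed
  show "(\<lambda>x. exp (- b * x) * h (?y x)) \<in> L2 \<gamma>"
    using dom[OF hm, of C] C[OF y] by blast
  fix \<epsilon> :: real assume "\<epsilon> > 0"
  \<comment> \<open>the added 1 keeps \<open>K\<close> positive without computing the norm\<close>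
  define K where "K = sq_norm \<gamma> (expoly b 1) + 1"
  have K: "K > 0" using sq_norm_nonneg[of \<gamma> "expoly b 1"] by (simp add: K_def)
  define d where "d = sqrt (\<epsilon> / K)"
  have d: "d > 0" "d\<^sup>2 * K = \<epsilon>" using \<open>\<epsilon> > 0\<close> K by (auto simp: d_def)
  obtain g where g: "real_polynomial_function g" "\<And>y. y \<in> {0..1} \<Longrightarrow> \<bar>h y - g y\<bar> < d"
    using Stone_Weierstrass_real_polynomial_function[OF compact_Icc h d(1)] by metis
  obtain a N where a: "g = (\<lambda>y. \<Sum>i\<le>N. a i * y ^ i)"
    using g(1) by (auto simp: real_polynomial_function_iff_sum)
  have gx: "exp (- b * x) * g (?y x) = (\<Sum>i\<le>N. expoly (b + real i * (b / 2)) [:a i:] x)" for x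
  proof -
    have "exp (- b * x) * (a i * ?y x ^ i) = expoly (b + real i * (b / 2)) [:a i:] x" for i
    proof -
      have "?y x ^ i = exp (real i * (- (b / 2) * x))" by (rule exp_of_nat_mult[symmetric])
      then have "exp (- b * x) * ?y x ^ i = exp (- b * x + real i * (- (b / 2) * x))" by (simp only: exp_add)
      also have "- b * x + real i * (- (b / 2) * x) = - (b + real i * (b / 2)) * x" by (simp add: algebra_simps)
      finally show ?thesis by (simp add: expoly_def mult.left_commute mult.commute)
    qed
    then show ?thesis unfolding a sum_distrib_left by (intro sum.cong) auto
  qed
  have "approximable \<gamma> b (\<lambda>x. \<Sum>i\<le>N. expoly (b + real i * (b / 2)) [:a i:] x)"
  proof (induction N)
    case 0
    then show ?case using approximable_faster_exp[of 0] by simp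
  next
    case (Suc N)
    then show ?case using approximable_faster_exp[of "Suc N" "[:a (Suc N):]"] approximable_add by (simp only: sum.atMost_Suc)
  qed
  then have ag: "approximable \<gamma> b (\<lambda>x. exp (- b * x) * g (?y x))" by (simp only: gx)
  have gm: "(\<lambda>x. exp (- b * x) * g (?y x)) \<in> borel_measurable (lebesgue_on \<Lambda>)"
    using ag by (simp add: approximable_def weighted_L2_def)
  have "sq_norm \<gamma> (\<lambda>x. exp (- b * x) * h (?y x) - exp (- b * x) * g (?y x)) =
     sq_norm \<gamma> (\<lambda>x. exp (- b * x) * (h (?y x) - g (?y x)))" by (simp add: right_diff_distrib)
  also have "\<dots> \<le> d\<^sup>2 * sq_norm \<gamma> (expoly b 1)"
  proof (rule dom[THEN conjunct2])
    show "(\<lambda>x. exp (- b * x) * (h (?y x) - g (?y x))) \<in> borel_measurable (lebesgue_on \<Lambda>)"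
      using borel_measurable_diff[OF hm gm] by (simp add: right_diff_distrib)
    show "\<bar>h (?y x) - g (?y x)\<bar> \<le> d" if "x > 0" for x using g(2)[OF y[OF that]] by simp
  qed
  also have "\<dots> < d\<^sup>2 * K" using d(1) by (simp add: K_def)
  finally show "\<exists>g. approximable \<gamma> b g \<and> sq_norm \<gamma> (\<lambda>x. exp (- b * x) * h (?y x) - g x) < \<epsilon>"
    using ag d(2) by auto
qed

text \<open>A cutoff \<open>\<kappa> n\<close> in the variable \<open>y\<close>, vanishing near \<open>y = 0\<close> and \<open>y = 1\<close>, makes \<open>w\<close> a function to which
the preceding lemma applies.\<close>

lemma approximable_continuous:
  assumes w: "w \<in> L2 \<gamma>" and c: "continuous_on {0<..} w"
  shows "approximable \<gamma> b w"
proof (rule approximable_limit[OF w])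
  let ?y = "\<lambda>x. exp (- (b / 2) * x)"
  define W where "W y = w (- ln y / (b / 2)) * exp (b * (- ln y / (b / 2)))" for y
  define \<kappa> where "\<kappa> n y = max 0 (min 1 (real n * min y (1 - y) - 1))" for n :: nat and y
  have Wy: "exp (- b * x) * W (?y x) = w x" for x
  proof -
    have "- ln (?y x) / (b / 2) = x" using b by simp
    then show ?thesis by (simp add: W_def mult_exp_exp)
  qed
  have cont: "continuous_on {0..1} (\<lambda>y. \<kappa> n y * W y)" for n
  proof -
    let ?V = "{y. real n * min y (1 - y) < 1}"
    have "continuous_on ({0<..<1} \<union> ?V) (\<lambda>y. \<kappa> n y * W y)"
    proof (rule continuous_on_open_Un)
      show "open ?V" by (intro open_Collect_less continuous_intros)
      show "continuous_on {0<..<1} (\<lambda>y. \<kappa> n y * W y)"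
        unfolding \<kappa>_def W_def
        by (intro continuous_intros continuous_on_compose2[OF c]) (use b in \<open>auto simp: divide_neg_pos\<close>)
      have "\<kappa> n y * W y = 0" if "y \<in> ?V" for y using that by (simp add: \<kappa>_def)
      then show "continuous_on ?V (\<lambda>y. \<kappa> n y * W y)"
        by (subst continuous_on_cong[OF refl, of _ _ "\<lambda>_. 0"]) auto
    qed auto
    moreover have "{0..1} \<subseteq> {0<..<1} \<union> ?V" by force
    ultimately show ?thesis by (rule continuous_on_subset)
  qed
  show "approximable \<gamma> b (\<lambda>x. \<kappa> n (?y x) * w x)" for n
  proof -
    have "exp (- b * x) * (\<kappa> n (?y x) * W (?y x)) = \<kappa> n (?y x) * w x" for x
      by (simp only: mult.left_commute[of "exp (- b * x)"] Wy)
    then show ?thesis using approximable_exp_continuous[OF cont[of n]] by (simp only:)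
  qed
  show "w \<in> borel_measurable (lebesgue_on \<Lambda>)" using w by (rule L2_D)
  fix x :: real assume x: "x > 0"
  show "\<bar>\<kappa> n (?y x) * w x\<bar> \<le> \<bar>w x\<bar>" for n
    unfolding abs_mult by (rule mult_left_le_one_le) (auto simp: \<kappa>_def)
  have "eventually (\<lambda>n. \<kappa> n (?y x) * w x = w x) sequentially"
  proof -
    have m: "min (?y x) (1 - ?y x) > 0" using x b by simp
    obtain N where N: "2 / min (?y x) (1 - ?y x) \<le> real N" using real_arch_simple by blast
    show ?thesis
    proof (rule eventually_sequentiallyI[of N])
      fix n assume "N \<le> n"
      then have "2 / min (?y x) (1 - ?y x) \<le> real n" using N by simp
      then have "2 \<le> real n * min (?y x) (1 - ?y x)" using m by (simp only: pos_divide_le_eq)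
      then show "\<kappa> n (?y x) * w x = w x" by (simp add: \<kappa>_def)
    qed
  qed
  then show "(\<lambda>n. \<kappa> n (?y x) * w x) \<longlonglongrightarrow> w x" by (rule tendsto_eventually)
qed

section \<open>Spectral gap\<close>

text \<open>The mean of \<open>A\<close> followed by its adjoint and \<open>B\<close> followed by its adjoint, on polynomials:
\<open>- x p'' + 2 b x p' - (\<gamma> + 1) p' + (\<gamma> + 1) b p\<close>.\<close>

definition laguerre_op :: "real poly \<Rightarrow> real poly"
  where "laguerre_op p = smult (1/2) (adj_poly b b \<gamma> (pderiv p) + adj_poly (- b) b \<gamma> (pderiv p - smult (2 * b) p))"

lemma coeff_laguerre_op:
  assumes "p \<in> polys (Suc n)" shows "coeff (laguerre_op p) n = b * (2 * real n + \<gamma> + 1) * coeff p n"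
proof -
  have "coeff (pderiv p) n = 0" using assms by (simp add: coeff_pderiv polys_def)
  then show ?thesis
    by (cases n) (simp_all add: laguerre_op_def coeff_adj_poly coeff_pderiv algebra_simps)
qed

lemma polys_laguerre_op:
  assumes p: "p \<in> polys n" shows "laguerre_op p \<in> polys n"
proof (cases n)
  case 0
  then show ?thesis using p by (simp add: polys_0 laguerre_op_def adj_poly_def)
next
  case (Suc m)
  have "coeff (laguerre_op p) i = 0" if "i \<ge> n" for i
  proof -
    have "p \<in> polys (Suc i)" using p that by (auto intro: polys_mono)
    moreover have "coeff p i = 0" using p that by (simp add: polys_def)
    ultimately show ?thesis by (simp add: coeff_laguerre_op)
  qed
  then show ?thesis by (simp add: polys_def)
qed

lemma jet_form_laguerre_op:
  assumes g: "jet 1 (\<gamma> + 1) g"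
  shows "jet_form 1 (\<gamma> + 1) b g (poly_jet b p) = ip \<gamma> (g 0) (expoly b (laguerre_op p))"
proof -
  have g': "jet (Suc 0) (\<gamma> + 1) g" using g by simp
  have L: "g 0 \<in> L2 \<gamma>" using jet_lower[OF g' \<gamma>] by (simp add: jet_def)
  note E = expoly_weighted_L2[OF \<gamma> b]
  have \<gamma>1: "\<gamma> + 1 > -1" using \<gamma> by simp
  have "jet_form (Suc 0) (\<gamma> + 1) b g (poly_jet b p) =
     (ip \<gamma> (g 0) (expoly b (adj_poly b b \<gamma> (pderiv p))) +
      ip \<gamma> (g 0) (expoly b (adj_poly (- b) b \<gamma> (pderiv p - smult (2 * b) p)))) / 2"
    unfolding jet_form_Suc[OF g' jet_poly_jet[OF \<gamma>1 b]] shift_poly_jet_pos shift_poly_jet_neg jet_form_0 poly_jet_0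
      inner_shift_expoly[OF g \<gamma> b] ..
  also have "\<dots> = ip \<gamma> (g 0) (expoly b (laguerre_op p))"
    unfolding laguerre_op_def expoly_smult expoly_add ip_cmult_right ip_add_right[OF E E L] by simp
  finally show ?thesis by simp
qed

text \<open>The operator preserves the degree and is symmetric. Splitting off the component along the polynomial \<open>e\<close> of
degree \<open>k\<close> that is orthogonal to lower degrees therefore leaves no mixed terms, and the component itself
contributes the diagonal entry \<open>b (2k + \<gamma> + 1)\<close>, with \<open>k \<ge> M\<close>.\<close>

lemma laguerre_op_gap:
  assumes M: "\<And>q. q \<in> polys M \<Longrightarrow> ip \<gamma> (expoly b S) (expoly b q) = 0"
    and S: "S \<in> polys n"
  shows "b * (2 * real M + \<gamma> + 1) * ip \<gamma> (expoly b S) (expoly b S) \<le> ip \<gamma> (expoly b S) (expoly b (laguerre_op S))"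
proof -
  define B where "B p q = ip \<gamma> (expoly b p) (expoly b q)" for p q
  note E = expoly_weighted_L2[OF \<gamma> b]
  have add: "B (p + p') q = B p q + B p' q" for p p' q
    unfolding B_def expoly_add by (rule ip_add_left[OF E E E])
  have sm: "B (smult c p) q = c * B p q" for c p q
    unfolding B_def expoly_smult by (rule ip_cmult_left)
  have sym: "B p q = B q p" for p q unfolding B_def by (rule ip_commute)
  have pos: "B p p = 0 \<Longrightarrow> p = 0" for p unfolding B_def by (rule expoly_norm_eq_0[OF \<gamma> b])
  have nn: "0 \<le> B p p" for p unfolding B_def by (rule ip_nonneg)
  have addr: "B p (q + q') = B p q + B p q'" and smr: "B p (smult c q) = c * B p q" for c p q q'
    by (simp_all only: sym[of p] add sm)
  have Lsym: "B p (laguerre_op q) = B (laguerre_op p) q" for p q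
  proof -
    have j: "jet 1 (\<gamma> + 1) (poly_jet b p)" for p using \<gamma> by (intro jet_poly_jet b) simp
    show ?thesis
      using jet_form_laguerre_op[OF j, of p q] jet_form_laguerre_op[OF j, of q p]
      by (simp add: B_def jet_form_commute[of _ _ _ "poly_jet b p"] ip_commute[of _ "expoly b q"])
  qed
  have Ladd: "laguerre_op (p + q) = laguerre_op p + laguerre_op q" and Lsm: "laguerre_op (smult c p) = smult c (laguerre_op p)" for c p q
    by (rule poly_eqI; simp add: laguerre_op_def coeff_adj_poly coeff_pderiv algebra_simps split: nat.split)+
  have "b * (2 * real M + \<gamma> + 1) * B S S \<le> B S (laguerre_op S)"
    if "\<And>q. q \<in> polys M \<Longrightarrow> B S q = 0" "S \<in> polys n" for S n
    using that
  proof (induction n arbitrary: S)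
    case 0
    then have "S = 0" by (simp add: polys_0)
    then show ?case using sm[of 0 0] by simp
  next
    case (Suc k)
    show ?case
    proof (cases "k < M")
      case True
      then have "B S S = 0" using Suc.prems polys_mono[OF Suc.prems(2), of M] by simp
      then have "S = 0" by (rule pos)
      then show ?thesis using sm[of 0 0] by simp
    next
      case False
      obtain r where r: "r \<in> polys k" "\<And>q. q \<in> polys k \<Longrightarrow> B r q = B (monom 1 k) q"
        using polys_representation[of B "\<lambda>q. B (monom 1 k) q" k, OF add sm sym pos addr smr] by blast
      define e where "e = monom 1 k + smult (- 1) r"
      have e: "e \<in> polys (Suc k)" "coeff e k = 1"
        using r(1) by (auto simp: e_def polys_def)
      have eo: "B e q = 0" if "q \<in> polys k" for q
        using r(2)[OF that] unfolding e_def add sm by simp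
      define c where "c = coeff S k"
      define S' where "S' = S - smult c e"
      have S': "S' \<in> polys k" unfolding S'_def c_def by (rule polys_split[OF Suc.prems(2) e])
      have SS: "S = S' + smult c e" by (simp add: S'_def)
      have "B S' q = 0" if q: "q \<in> polys M" for q
      proof -
        have "B S q = B S' q + c * B e q" by (subst SS) (simp only: add sm)
        moreover have "B e q = 0" by (rule eo[OF polys_mono[OF q]]) (use False in simp)
        ultimately show ?thesis using Suc.prems(1)[OF q] by simp
      qed
      then have IH: "b * (2 * real M + \<gamma> + 1) * B S' S' \<le> B S' (laguerre_op S')" using S' by (rule Suc.IH)
      have Le: "B e (laguerre_op e) = b * (2 * real k + \<gamma> + 1) * B e e"
      proof -
        have "laguerre_op e - smult (coeff (laguerre_op e) k) e \<in> polys k"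
          by (rule polys_split[OF polys_laguerre_op[OF e(1)] e])
        then have "B e (laguerre_op e - smult (coeff (laguerre_op e) k) e) = 0" by (rule eo)
        moreover have "B e ((laguerre_op e - smult (coeff (laguerre_op e) k) e) + smult (coeff (laguerre_op e) k) e) =
            B e (laguerre_op e - smult (coeff (laguerre_op e) k) e) + coeff (laguerre_op e) k * B e e"
          by (simp only: addr smr)
        ultimately show ?thesis by (simp add: coeff_laguerre_op[OF e(1)] e(2))
      qed
      have z1: "B e S' = 0" "B S' e = 0" using eo[OF S'] sym by auto
      have z2: "B e (laguerre_op S') = 0" using eo[OF polys_laguerre_op[OF S']] .
      have z3: "B S' (laguerre_op e) = 0" using z2 Lsym[of S' e] sym[of "laguerre_op S'" e] by simp
      have "B S S = B S' S' + c * c * B e e"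
        unfolding SS add sm addr smr z1 by simp
      moreover have "B S (laguerre_op S) = B S' (laguerre_op S') + c * c * B e (laguerre_op e)"
        unfolding SS Ladd Lsm add sm addr smr z2 z3 by simp
      moreover have "b * (2 * real M + \<gamma> + 1) * (c * c * B e e) \<le> c * c * B e (laguerre_op e)"
      proof -
        have "b * (2 * real M + \<gamma> + 1) * B e e \<le> b * (2 * real k + \<gamma> + 1) * B e e"
          using False b nn[of e] by (intro mult_right_mono mult_left_mono) auto
        from mult_left_mono[OF this, of "c * c"] show ?thesis by (simp add: Le mult_ac)
      qed
      ultimately show ?thesis using IH by (simp add: distrib_left)
    qed
  qed
  from this[of S n] show ?thesis using M S by (simp add: B_def)
qed

text \<open>Let \<open>S\<close> be the weighted least-squares projection of \<open>g 0\<close> onto polynomials of a large degree. Because the Laguerre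
operator preserves the degree, the remainder is orthogonal to \<open>S\<close> for the first-order form as
well, so the form of \<open>g\<close> dominates that of \<open>S\<close>, to which \<open>laguerre_op_gap\<close> applies. By density
the norm of \<open>S\<close> is arbitrarily close to that of \<open>g 0\<close>.\<close>

lemma spectral_gap:
  assumes g: "jet 1 (\<gamma> + 1) g"
    and M: "\<And>q. q \<in> polys M \<Longrightarrow> ip \<gamma> (g 0) (expoly b q) = 0"
  shows "b * (2 * real M + \<gamma> + 1) * sq_norm \<gamma> (g 0) \<le> jet_form 1 (\<gamma> + 1) b g g"
proof -
  let ?F = "jet_form 1 (\<gamma> + 1) b"
  define \<mu> where "\<mu> = b * (2 * real M + \<gamma> + 1)"
  have \<mu>: "\<mu> > 0" unfolding \<mu>_def using b \<gamma> by (intro mult_pos_pos) auto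
  have \<gamma>1: "\<gamma> + 1 > -1" using \<gamma> by simp
  have g': "jet (Suc 0) (\<gamma> + 1) g" using g by simp
  have L: "g 0 \<in> L2 \<gamma>" using jet_lower[OF g' \<gamma>] by (simp add: jet_def)
  have "primitive (g 0) (g 1)" using g by (simp add: jet_def)
  then have ap: "approximable \<gamma> b (g 0)" by (intro approximable_continuous L primitive_continuous)
  note E = expoly_weighted_L2[OF \<gamma> b]
  have main: "\<mu> * (sq_norm \<gamma> (g 0) - \<epsilon>) \<le> ?F g g" if e: "\<epsilon> > 0" for \<epsilon>
  proof -
    obtain q where q: "sq_norm \<gamma> (\<lambda>x. g 0 x - expoly b q x) < \<epsilon>" using ap e unfolding approximable_def by blast
    define n where "n = Suc (degree q)"
    have qn: "q \<in> polys n" unfolding n_def by (rule polys_degree)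
    have "\<exists>S\<in>polys n. \<forall>p\<in>polys n. ip \<gamma> (expoly b S) (expoly b p) = ip \<gamma> (g 0) (expoly b p)"
      by (rule polys_representation; (rule ip_commute | (rule expoly_norm_eq_0[OF \<gamma> b], assumption) |
            simp only: expoly_add expoly_smult ip_add_left[OF E E E] ip_add_right[OF E E L]
            ip_cmult_left ip_cmult_right))
    then obtain S where S: "S \<in> polys n" 
      "\<And>p. p \<in> polys n \<Longrightarrow> ip \<gamma> (expoly b S) (expoly b p) = ip \<gamma> (g 0) (expoly b p)" by blast
    \<comment> \<open>the remainder \<open>g - S\<close>, written so that the rules for sums and multiples of jets apply\<close>
    define e where "e = (\<lambda>k x. g k x + (- 1) * poly_jet b S k x)"
    have je: "jet 1 (\<gamma> + 1) e" unfolding e_def by (intro jet_add jet_cmult g jet_poly_jet \<gamma>1 b)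
    have e0: "ip \<gamma> (e 0) (expoly b p) = 0" if "p \<in> polys n" for p
    proof -
      have "e 0 = (\<lambda>x. g 0 x + (- 1) * expoly b S x)" by (simp add: e_def)
      then show ?thesis
        by (simp only: ip_add_left[OF L L2_cmult[OF E] E] ip_cmult_left S(2)[OF that])
    qed
    have eL: "e 0 \<in> L2 \<gamma>"
      unfolding e_def poly_jet_0 by (intro L2_add L L2_cmult E)
    have g0: "g 0 = (\<lambda>x. e 0 x + expoly b S x)" by (simp add: e_def)
    have gj: "g = (\<lambda>k x. e k x + poly_jet b S k x)" by (simp add: e_def fun_eq_iff)
    note jS = jet_poly_jet[OF \<gamma>1 b, of 1 S]
    have eS: "?F e (poly_jet b S) = 0"
      unfolding jet_form_laguerre_op[OF je] by (rule e0[OF polys_laguerre_op[OF S(1)]])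
    have "?F g g = ?F e g + ?F (poly_jet b S) g"
      by (subst (1) gj) (rule jet_form_add_left[OF je jS g])
    also have "\<dots> = ?F g e + ?F g (poly_jet b S)"
      by (simp only: jet_form_commute[of _ _ _ g])
    also have "\<dots> = ?F e e + ?F (poly_jet b S) (poly_jet b S)"
      unfolding gj jet_form_add_left[OF je jS je] jet_form_add_left[OF je jS jS]
      by (simp only: eS jet_form_commute[of _ _ _ "poly_jet b S" e] add_0_left add_0_right)
    finally have "?F (poly_jet b S) (poly_jet b S) \<le> ?F g g"
      using jet_form_nonneg[of b 1 "\<gamma> + 1" e] b by simp
    moreover have "\<mu> * ip \<gamma> (expoly b S) (expoly b S) \<le> ?F (poly_jet b S) (poly_jet b S)"
      unfolding jet_form_laguerre_op[OF jS] poly_jet_0 \<mu>_def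
    proof (rule laguerre_op_gap)
      fix p assume p: "p \<in> polys M"
      show "ip \<gamma> (expoly b S) (expoly b p) = 0"
      proof (cases "M \<le> n")
        case True
        then show ?thesis using S(2)[OF polys_mono[OF p]] M[OF p] by simp
      next
        case False
        then have "S \<in> polys M" using S(1) by (auto intro: polys_mono)
        then have "ip \<gamma> (g 0) (expoly b S) = 0" by (rule M)
        then have "ip \<gamma> (expoly b S) (expoly b S) = 0" using S by simp
        then have "S = 0" by (rule expoly_norm_eq_0[OF \<gamma> b])
        then show ?thesis by (simp add: weighted_inner_def)
      qed
    qed (rule S(1))
    moreover have "sq_norm \<gamma> (g 0) - \<epsilon> \<le> sq_norm \<gamma> (expoly b S)"
    proof -
      have "sq_norm \<gamma> (g 0) = sq_norm \<gamma> (e 0) + sq_norm \<gamma> (expoly b S)"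
        unfolding g0 by (subst sq_norm_add[OF eL E]) (simp add: e0[OF S(1)])
      moreover have "sq_norm \<gamma> (\<lambda>x. g 0 x - expoly b q x) = sq_norm \<gamma> (e 0) + sq_norm \<gamma> (expoly b (S - q))"
      proof -
        have "(\<lambda>x. g 0 x - expoly b q x) = (\<lambda>x. e 0 x + expoly b (S - q) x)" by (simp add: g0 expoly_diff add_diff_eq)
        then show ?thesis
          using e0[OF polys_diff[OF S(1) qn]] by (simp add: sq_norm_add[OF eL E])
      qed
      ultimately show ?thesis using q sq_norm_nonneg[of \<gamma> "expoly b (S - q)"] by simp
    qed
    then have "\<mu> * (sq_norm \<gamma> (g 0) - \<epsilon>) \<le> \<mu> * sq_norm \<gamma> (expoly b S)"
      using \<mu> by (intro mult_left_mono) auto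
    ultimately show ?thesis by (simp add: sq_norm_def)
  qed
  have "\<mu> * sq_norm \<gamma> (g 0) \<le> ?F g g"
  proof (rule field_le_epsilon)
    fix \<epsilon> :: real assume "\<epsilon> > 0"
    then have "\<mu> * (sq_norm \<gamma> (g 0) - \<epsilon> / \<mu>) \<le> ?F g g" using \<mu> by (intro main) simp
    moreover have "\<mu> * (sq_norm \<gamma> (g 0) - \<epsilon> / \<mu>) = \<mu> * sq_norm \<gamma> (g 0) - \<epsilon>"
      using \<mu> by (simp add: right_diff_distrib)
    ultimately show "\<mu> * sq_norm \<gamma> (g 0) \<le> ?F g g + \<epsilon>" by simp
  qed
  then show ?thesis by (simp only: \<mu>_def)
qed

end

text \<open>The spectral gap for each word of length \<open>s\<close>; the words with most letters \<open>A\<close> have the lowest degree bound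
\<open>M - s\<close> and determine the constant.\<close>

lemma form_gap:
  assumes \<gamma>: "\<gamma> > -1" and b: "b > 0"
  shows "jet (Suc s) (\<gamma> + 1) g \<Longrightarrow> orth \<gamma> b s M g \<Longrightarrow>
    b * (2 * real (M - s) + \<gamma> + 1) * jet_form s \<gamma> b g g \<le> jet_form (Suc s) (\<gamma> + 1) b g g"
proof (induction s arbitrary: g M)
  case 0
  then show ?case using spectral_gap[OF \<gamma> b, of g M] by (simp add: jet_form_0 sq_norm_def)
next
  case (Suc s)
  have j: "jet (Suc s) \<gamma> g" using Suc.prems(1) \<gamma> by (rule jet_lower)
  have le: "b * (2 * real (M - Suc s) + \<gamma> + 1) * jet_form s \<gamma> b g' g' \<le> b * (2 * real (M' - s) + \<gamma> + 1) * jet_form s \<gamma> b g' g'"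
    if "M - Suc s \<le> M' - s" for g' M'
    using that b jet_form_nonneg[of b s \<gamma> g'] by (intro mult_right_mono mult_left_mono) auto
  have 1: "b * (2 * real (M - Suc s) + \<gamma> + 1) * jet_form s \<gamma> b (shift b g) (shift b g) \<le> jet_form (Suc s) (\<gamma> + 1) b (shift b g) (shift b g)"
    by (rule order_trans[OF le Suc.IH]) (use Suc.prems in \<open>auto simp: jet_shift\<close>)
  have 2: "b * (2 * real (M - Suc s) + \<gamma> + 1) * jet_form s \<gamma> b (shift (- b) g) (shift (- b) g) \<le> jet_form (Suc s) (\<gamma> + 1) b (shift (- b) g) (shift (- b) g)"
    by (rule order_trans[OF le Suc.IH]) (use Suc.prems in \<open>auto simp: jet_shift\<close>)
  show ?case
    unfolding jet_form_Suc[OF Suc.prems(1) Suc.prems(1)] jet_form_Suc[OF j j]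
    using 1 2 by (simp add: distrib_left)
qed

section \<open>Test functions\<close>

text \<open>The functions \<open>poly p (1/x) exp (- 1/x)\<close>, extended by zero. This family is closed under differentiation,
which makes its members smooth.\<close>

definition flat :: "real poly \<Rightarrow> real \<Rightarrow> real"
  where "flat p x = (if x > 0 then poly p (1 / x) * exp (- (1 / x)) else 0)"

lemma poly_div_exp_tendsto_0: "((\<lambda>t. poly p t / exp t) \<longlongrightarrow> (0::real)) at_top"
proof -
  have "((\<lambda>t. \<Sum>i\<le>degree p. coeff p i * (t ^ i / exp t)) \<longlongrightarrow> (\<Sum>i\<le>degree p. coeff p i * 0)) at_top"
    by (intro tendsto_intros tendsto_power_div_exp_0)
  then show ?thesis by (simp add: poly_altdef sum_divide_distrib)
qed

lemma flat_has_derivative: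
  "(flat p has_real_derivative flat (monom 1 2 * (p - pderiv p)) x) (at x)"
proof -
  consider "x > 0" | "x < 0" | "x = 0" by linarith
  then show ?thesis
  proof cases
    case 1
    have "((\<lambda>x. poly p (1 / x) * exp (- (1 / x))) has_real_derivative flat (monom 1 2 * (p - pderiv p)) x) (at x)"
      using 1 by (auto intro!: derivative_eq_intros DERIV_chain2[OF poly_DERIV] simp: flat_def poly_monom power2_eq_square field_simps)
    moreover have "eventually (\<lambda>y. flat p y = poly p (1 / y) * exp (- (1 / y))) (nhds x)"
      using eventually_nhds_in_open[of "{0<..}" x] 1 by (auto simp: flat_def elim: eventually_mono)
    ultimately show ?thesis by (subst DERIV_cong_ev[OF refl _ refl])
  next
    case 2
    have "((\<lambda>x. 0) has_real_derivative flat (monom 1 2 * (p - pderiv p)) x) (at x)"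
      using 2 by (auto simp: flat_def)
    moreover have "eventually (\<lambda>y. flat p y = 0) (nhds x)"
      using eventually_nhds_in_open[of "{..<0}" x] 2 by (auto simp: flat_def elim: eventually_mono)
    ultimately show ?thesis by (subst DERIV_cong_ev[OF refl _ refl])
  next
    case 3
    have "((\<lambda>h. flat p h / h) \<longlongrightarrow> 0) (at 0)"
    proof (rule filterlim_split_at)
      show "((\<lambda>h. flat p h / h) \<longlongrightarrow> 0) (at_left 0)"
        by (rule tendsto_eventually) (auto simp: eventually_at_filter flat_def)
      have "((\<lambda>t. poly (pCons 0 p) t / exp t) \<longlongrightarrow> 0) at_top" by (rule poly_div_exp_tendsto_0)
      moreover have "eventually (\<lambda>t. poly (pCons 0 p) t / exp t = flat p (inverse t) / inverse t) at_top"
        using eventually_gt_at_top[of 0] by eventually_elim (simp add: flat_def exp_minus field_simps)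
      ultimately show "((\<lambda>h. flat p h / h) \<longlongrightarrow> 0) (at_right 0)"
        unfolding filterlim_at_right_to_top by (rule Lim_transform_eventually)
    qed
    then show ?thesis using 3 by (simp add: DERIV_def flat_def)
  qed
qed

text \<open>A class of functions that contains the cutoffs needed below and is closed under differentiation. Smoothness of
all its members thus follows from the sum and product rules for first derivatives.\<close>

inductive_set bump_algebra :: "(real \<Rightarrow> real) set"
  where flat: "(\<lambda>x. flat p (m * x + c)) \<in> bump_algebra"
  | const: "(\<lambda>x. c) \<in> bump_algebra"
  | add: "f \<in> bump_algebra \<Longrightarrow> g \<in> bump_algebra \<Longrightarrow> (\<lambda>x. f x + g x) \<in> bump_algebra"
  | mult: "f \<in> bump_algebra \<Longrightarrow> g \<in> bump_algebra \<Longrightarrow> (\<lambda>x. f x * g x) \<in> bump_algebra"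

lemma bump_algebra_derivative:
  "f \<in> bump_algebra \<Longrightarrow> \<exists>f'\<in>bump_algebra. \<forall>x. (f has_real_derivative f' x) (at x)"
proof (induction rule: bump_algebra.induct)
  case (flat p m c)
  let ?f' = "\<lambda>x. m * flat (monom 1 2 * (p - pderiv p)) (m * x + c)"
  have "((\<lambda>x. flat p (m * x + c)) has_real_derivative ?f' x) (at x)" for x
    by (rule DERIV_cong[OF DERIV_chain2[OF flat_has_derivative]]) (auto intro!: derivative_eq_intros)
  then show ?case by (intro bexI[of _ ?f']) (auto intro: bump_algebra.intros)
next
  case (const c)
  show ?case by (intro bexI[of _ "\<lambda>_. 0"]) (auto intro: bump_algebra.intros)
next
  case (add f g)
  then obtain f' g' where "f' \<in> bump_algebra" "g' \<in> bump_algebra"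
    "\<And>x. (f has_real_derivative f' x) (at x)" "\<And>x. (g has_real_derivative g' x) (at x)" by metis
  then show ?case by (intro bexI[of _ "\<lambda>x. f' x + g' x"]) (auto intro: bump_algebra.intros DERIV_add)
next
  case (mult f g)
  then obtain f' g' where "f' \<in> bump_algebra" "g' \<in> bump_algebra"
    "\<And>x. (f has_real_derivative f' x) (at x)" "\<And>x. (g has_real_derivative g' x) (at x)" by metis
  then show ?case using mult
    by (intro bexI[of _ "\<lambda>x. f' x * g x + g' x * f x"]) (auto intro: bump_algebra.intros DERIV_mult)
qed

lemma bump_algebra_deriv: "f \<in> bump_algebra \<Longrightarrow> deriv f \<in> bump_algebra"
  and bump_algebra_has_deriv: "f \<in> bump_algebra \<Longrightarrow> (f has_real_derivative deriv f x) (at x)"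
proof -
  assume "f \<in> bump_algebra"
  then obtain f' where f': "f' \<in> bump_algebra" "\<And>x. (f has_real_derivative f' x) (at x)"
    using bump_algebra_derivative by blast
  then have "deriv f = f'" by (auto intro: DERIV_imp_deriv)
  then show "deriv f \<in> bump_algebra" "(f has_real_derivative deriv f x) (at x)" using f' by auto
qed

lemma bump_algebra_smooth:
  assumes "f \<in> bump_algebra" shows "(deriv ^^ n) f differentiable (at x)"
proof -
  have "(deriv ^^ n) f \<in> bump_algebra" using assms by (induction n) (auto intro: bump_algebra_deriv)
  from bump_algebra_has_deriv[OF this] show ?thesis by (auto simp: real_differentiable_def)
qed

definition supported :: "(real \<Rightarrow> real) \<Rightarrow> real \<Rightarrow> real \<Rightarrow> bool"
  where "supported \<phi> a c \<longleftrightarrow> 0 < a \<and> a \<le> c \<and> (\<forall>x. x \<notin> {a..c} \<longrightarrow> \<phi> x = 0)"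

lemma test_functions_iff:
  "\<phi> \<in> test_functions \<longleftrightarrow> (\<forall>n x. (deriv ^^ n) \<phi> differentiable (at x)) \<and> (\<exists>a c. supported \<phi> a c)"
  by (simp add: test_functions_def supported_def)

lemma bump_test_function:
  assumes "f \<in> bump_algebra" "supported f a c" shows "f \<in> test_functions"
  using assms bump_algebra_smooth by (auto simp: test_functions_iff)

lemma test_function_has_deriv:
  assumes "\<phi> \<in> test_functions" shows "(\<phi> has_real_derivative deriv \<phi> x) (at x)"
proof -
  have "(deriv ^^ 0) \<phi> differentiable (at x)" using assms unfolding test_functions_iff by blast
  then show ?thesis by (simp add: DERIV_deriv_iff_real_differentiable)
qed

lemma supported_deriv:
  assumes "supported \<phi> a c" shows "supported (deriv \<phi>) a c"
proof -
  have "deriv \<phi> x = 0" if "x \<notin> {a..c}" for x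
  proof -
    have "eventually (\<lambda>y. y \<in> - {a..c}) (nhds x)"
      by (rule eventually_nhds_in_open) (use that in auto)
    then have "eventually (\<lambda>y. \<phi> y = 0) (nhds x)"
      by (rule eventually_mono) (use assms in \<open>auto simp: supported_def\<close>)
    then have "(\<phi> has_real_derivative 0) (at x)" by (subst DERIV_cong_ev[OF refl _ refl]) auto
    then show ?thesis by (rule DERIV_imp_deriv)
  qed
  then show ?thesis using assms by (auto simp: supported_def)
qed

lemma test_function_deriv:
  assumes "\<phi> \<in> test_functions" shows "deriv \<phi> \<in> test_functions"
proof -
  have "(deriv ^^ n) (deriv \<phi>) differentiable (at x)" for n x
  proof -
    have "(deriv ^^ Suc n) \<phi> differentiable (at x)" using assms unfolding test_functions_iff by blast
    then show ?thesis by (simp only: funpow_Suc_right o_def)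
  qed
  then show ?thesis using assms supported_deriv unfolding test_functions_iff by blast
qed

lemma test_function_continuous:
  assumes "\<phi> \<in> test_functions" shows "continuous_on S \<phi>"
  by (intro continuous_at_imp_continuous_on ballI DERIV_isCont[OF test_function_has_deriv[OF assms]])

text \<open>An antiderivative need not lie in \<open>bump_algebra\<close>, but it is smooth because all its derivatives do.\<close>

lemma test_function_antideriv:
  assumes "(\<And>x. (\<Phi> has_real_derivative \<eta> x) (at x))" "\<eta> \<in> bump_algebra" "supported \<Phi> a c"
  shows "\<Phi> \<in> test_functions" "deriv \<Phi> = \<eta>"
proof -
  show d: "deriv \<Phi> = \<eta>" using assms(1) by (auto intro: DERIV_imp_deriv)
  have "(deriv ^^ n) \<Phi> differentiable (at x)" for n x
  proof (cases n)
    case 0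
    then show ?thesis using assms(1) by (auto simp: real_differentiable_def)
  next
    case (Suc m)
    then show ?thesis using bump_algebra_smooth[OF assms(2), of m x]
      by (simp only: funpow_Suc_right o_def d)
  qed
  then show "\<Phi> \<in> test_functions" using assms(3) by (auto simp: test_functions_iff)
qed

abbreviation pairing :: "(real \<Rightarrow> real) \<Rightarrow> (real \<Rightarrow> real) \<Rightarrow> real"
  where "pairing f \<phi> \<equiv> (LINT x:\<Lambda>|lebesgue. f x * \<phi> x)"

lemma locally_integrable_mult:
  assumes g: "locally_integrable g" and \<phi>: "continuous_on UNIV \<phi>" "supported \<phi> a c" and d: "0 < a'" "a' \<le> a" "c \<le> c'"
  shows "(\<lambda>x. g x * \<phi> x) absolutely_integrable_on {a'..c'}"
    and "pairing g \<phi> = integral {a'..c'} (\<lambda>x. g x * \<phi> x)"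
proof -
  have "(\<lambda>x. \<phi> x * g x) absolutely_integrable_on {a'..c'}"
  proof (rule absolutely_integrable_bounded_measurable_product_real)
    have "continuous_on {a'..c'} \<phi>" using \<phi>(1) by (rule continuous_on_subset) simp
    then show "\<phi> \<in> borel_measurable (lebesgue_on {a'..c'})" "bounded (\<phi> ` {a'..c'})"
      by (auto intro: continuous_imp_measurable_on_sets_lebesgue compact_imp_bounded compact_continuous_image)
    show "g absolutely_integrable_on {a'..c'}" using g d by (auto simp: locally_integrable_def)
  qed auto
  then show ai: "(\<lambda>x. g x * \<phi> x) absolutely_integrable_on {a'..c'}" by (simp add: mult.commute)
  have "pairing g \<phi> = (LINT x:{a'..c'}|lebesgue. g x * \<phi> x)"
    unfolding set_lebesgue_integral_def
    by (rule Bochner_Integration.integral_cong)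
       (use \<phi>(2) d in \<open>auto simp: supported_def half_line_def indicator_def\<close>)
  then show "pairing g \<phi> = integral {a'..c'} (\<lambda>x. g x * \<phi> x)"
    using set_lebesgue_integral_eq_integral(2)[OF ai] by simp
qed

section \<open>The fundamental lemma and its consequences\<close>

text \<open>The sets over which \<open>f\<close> has integral zero form a Dynkin system containing the generator \<open>{..a}\<close> of the
Borel sets.\<close>

lemma AE_zero_of_atMost_integrals:
  fixes f :: "real \<Rightarrow> real"
  assumes f: "integrable lborel f" and 0: "\<And>a. (LINT x:{..a}|lborel. f x) = 0" "(LINT x|lborel. f x) = 0"
  shows "AE x in lborel. f x = 0"
proof (rule sigma_finite_measure.density_zero[OF lborel.sigma_finite_measure_axioms f])
  fix A :: "real set" assume "A \<in> sets lborel"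
  then have A: "A \<in> sigma_sets UNIV (range (\<lambda>a::real. {..a}))"
    by (simp add: borel_eq_atMost)
  have sets: "A \<in> sigma_sets UNIV (range (\<lambda>a::real. {..a})) \<Longrightarrow> A \<in> sets lborel" for A
    by (simp add: borel_eq_atMost)
  have si: "A \<in> sets lborel \<Longrightarrow> set_integrable lborel A f" for A
    unfolding set_integrable_def by (rule integrable_mult_indicator[OF _ f]) simp
  show "(LINT x:A|lborel. f x) = 0"
  proof (rule sigma_sets_induct_disjoint[OF _ _ A])
    show "Int_stable (range (\<lambda>a::real. {..a}))"
      by (auto simp: Int_stable_def)
    show "(LINT x:A|lborel. f x) = 0" if "A \<in> range (\<lambda>a::real. {..a})" for A
      using that 0(1) by auto
    show "(LINT x:UNIV - A|lborel. f x) = 0" if "A \<in> sigma_sets UNIV (range (\<lambda>a::real. {..a}))" "(LINT x:A|lborel. f x) = 0" for A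
    proof -
      have A: "A \<in> sets lborel" "UNIV - A \<in> sets lborel" using sets[OF that(1)] by auto
      have "(LINT x:A \<union> (UNIV - A)|lborel. f x) = (LINT x:A|lborel. f x) + (LINT x:UNIV - A|lborel. f x)"
        by (rule set_integral_Un) (use A in \<open>auto intro: si\<close>)
      moreover have "A \<union> (UNIV - A) = UNIV" by auto
      ultimately show ?thesis using that(2) 0(2) by (simp add: set_lebesgue_integral_def)
    qed
    show "(LINT x:(\<Union>i. A i)|lborel. f x) = 0"
      if "disjoint_family A" "range A \<subseteq> sigma_sets UNIV (range (\<lambda>a::real. {..a}))" "\<And>i. (LINT x:A i|lborel. f x) = 0"
      for A :: "nat \<Rightarrow> real set"
    proof -
      have A: "A i \<in> sets lborel" for i using that(2) sets by blast
      have "(LINT x:(\<Union>i. A i)|lborel. f x) = (\<Sum>i. (LINT x:A i|lborel. f x))"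
        using A that(1) by (intro lebesgue_integral_countable_add si) (auto simp: disjoint_family_on_def)
      then show ?thesis by (simp add: that(3))
    qed
  qed (auto simp: set_lebesgue_integral_def)
qed

lemma AE_zero_of_interval_integrals:
  fixes g :: "real \<Rightarrow> real"
  assumes g: "locally_integrable g" and 0: "\<And>c d. 0 < c \<Longrightarrow> c < d \<Longrightarrow> integral {c..d} g = 0"
  shows "AE x in lebesgue. x \<in> \<Lambda> \<longrightarrow> g x = 0"
proof -
  have "AE x in lebesgue. x \<in> {c..d} \<longrightarrow> g x = 0" if c: "0 < c" "c < d" for c d
  proof -
    have gcd: "g absolutely_integrable_on {c..d}" using g c by (simp add: locally_integrable_def)
    obtain f where f: "integrable lborel f" "AE x in lebesgue. indicator {c..d} x * g x = f x"
      using borel_representative[OF gcd] by blast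
    have zero: "(LINT x|lborel. indicator S x * f x) = 0" if S: "S \<in> sets borel" "{c..d} \<inter> S = {c..d'}" "d' \<le> d" for S d'
      unfolding borel_representative_integral[OF gcd f S]
    proof (cases "c < d'")
      case False
      then have "{c..d'} = {} \<or> {c..d'} = {c}" by auto
      then show "integral {c..d'} g = 0" by auto
    qed (rule 0[OF c(1)])
    have "AE x in lborel. f x = 0"
    proof (rule AE_zero_of_atMost_integrals[OF f(1)])
      show "(LINT x:{..a}|lborel. f x) = 0" for a
      proof -
        have "{c..d} \<inter> {..a} = {c..min a d}" by auto
        then show ?thesis using zero[of "{..a}" "min a d"] by (simp add: set_lebesgue_integral_def)
      qed
      show "(LINT x|lborel. f x) = 0"
        using zero[of UNIV d] by simp
    qed
    then have "AE x in lebesgue. f x = 0" by (rule AE_completion)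
    with f(2) show ?thesis by eventually_elim auto
  qed
  note Icc = this
  have "AE x in lebesgue. \<forall>n::nat. x \<in> {1 / real (Suc (Suc n))..real (Suc (Suc n))} \<longrightarrow> g x = 0"
    unfolding AE_all_countable
  proof
    fix n :: nat
    have "1 / real (Suc (Suc n)) \<le> 1 / 2" by (intro divide_left_mono) auto
    also have "1 / 2 < real (Suc (Suc n))" by simp
    finally show "AE x in lebesgue. x \<in> {1 / real (Suc (Suc n))..real (Suc (Suc n))} \<longrightarrow> g x = 0"
      by (intro Icc) simp_all
  qed
  then show ?thesis
  proof eventually_elim
    case (elim x)
    show ?case
    proof
      assume "x \<in> \<Lambda>"
      then have x: "x > 0" by (simp add: half_line_def)
      obtain n where n: "max x (1 / x) \<le> real n" using real_arch_simple by blast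
      have "1 / real (Suc (Suc n)) \<le> 1 / (1 / x)" using n x by (intro divide_left_mono) auto
      then have "x \<in> {1 / real (Suc (Suc n))..real (Suc (Suc n))}" using n by auto
      then show "g x = 0" using elim by blast
    qed
  qed
qed

text \<open>For \<open>n \<rightarrow> \<infinity>\<close> this tends to the indicator function of the open interval from \<open>c\<close> to \<open>d\<close>, because
\<open>exp (- 1 / (n y))\<close> tends to \<open>1\<close> for \<open>y > 0\<close>.\<close>

definition bump :: "nat \<Rightarrow> real \<Rightarrow> real \<Rightarrow> real \<Rightarrow> real"
  where "bump n c d x = flat 1 (real (Suc n) * x + (- real (Suc n) * c)) * flat 1 (- real (Suc n) * x + real (Suc n) * d)"

lemma bump_in_algebra: "bump n c d \<in> bump_algebra"
  unfolding bump_def[abs_def] by (intro bump_algebra.intros)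

lemma flat_1_bounds: "0 \<le> flat 1 x" "flat 1 x \<le> 1"
  by (auto simp: flat_def)

lemma bump_eq: "bump n c d x = flat 1 (real (Suc n) * (x - c)) * flat 1 (real (Suc n) * (d - x))"
proof -
  have "real (Suc n) * x + - real (Suc n) * c = real (Suc n) * (x - c)"
    "- real (Suc n) * x + real (Suc n) * d = real (Suc n) * (d - x)"
    by (simp_all only: right_diff_distrib mult_minus_left)
  then show ?thesis by (simp only: bump_def)
qed

lemma bump_supported:
  assumes "0 < c" "c \<le> d" shows "supported (bump n c d) c d"
proof -
  have "flat 1 (real (Suc n) * y) = 0" if "y < 0" for y
    using mult_pos_neg[of "real (Suc n)" y] that by (simp add: flat_def)
  then have "bump n c d x = 0" if "x \<notin> {c..d}" for x
    using that unfolding bump_eq by (cases "x < c") auto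
  then show ?thesis using assms by (simp add: supported_def)
qed

lemma bump_tendsto:
  assumes "x \<in> {c<..<d}" shows "(\<lambda>n. bump n c d x) \<longlonglongrightarrow> 1"
proof -
  have *: "(\<lambda>n. flat 1 (real (Suc n) * y)) \<longlonglongrightarrow> 1" if "y > 0" for y
  proof -
    have "(\<lambda>n. exp (- (inverse (real (Suc n)) * (1 / y)))) \<longlonglongrightarrow> exp (- (0 * (1 / y)))"
      by (intro tendsto_intros LIMSEQ_inverse_real_of_nat)
    moreover have "exp (- (inverse (real (Suc n)) * (1 / y))) = flat 1 (real (Suc n) * y)" for n
      using that by (simp add: flat_def inverse_eq_divide)
    ultimately show ?thesis by simp
  qed
  have "(\<lambda>n. flat 1 (real (Suc n) * (x - c)) * flat 1 (real (Suc n) * (d - x))) \<longlonglongrightarrow> 1 * 1"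
    by (intro tendsto_mult *) (use assms in auto)
  then show ?thesis by (simp add: bump_eq)
qed

lemma bump_continuous: "continuous_on S (bump n c d)"
  by (intro continuous_at_imp_continuous_on ballI DERIV_isCont[OF bump_algebra_has_deriv[OF bump_in_algebra]])

text \<open>The bumps converge boundedly to indicator functions of intervals, so the integral of \<open>g\<close> over every compact
interval vanishes.\<close>

lemma fundamental_lemma:
  assumes g: "locally_integrable g"
    and 0: "\<And>n c d. 0 < c \<Longrightarrow> c < d \<Longrightarrow> pairing g (bump n c d) = 0"
  shows "AE x in lebesgue. x \<in> \<Lambda> \<longrightarrow> g x = 0"
proof (rule AE_zero_of_interval_integrals[OF g])
  fix c d :: real assume c: "0 < c" "c < d"
  have gcd: "g absolutely_integrable_on {c..d}" using g c by (simp add: locally_integrable_def)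
  note m = locally_integrable_mult[OF g bump_continuous bump_supported, of c d c d]
  have "(\<lambda>n. integral {c<..<d} (\<lambda>x. g x * bump n c d x)) \<longlonglongrightarrow> integral {c<..<d} g"
  proof (rule dominated_convergence(2))
    show "(\<lambda>x. g x * bump n c d x) integrable_on {c<..<d}" for n
    proof -
      have "(\<lambda>x. g x * bump n c d x) absolutely_integrable_on {c..d}" using m(1)[of n] c by simp
      then show ?thesis
        unfolding absolutely_integrable_on_Icc_iff_Ioo by (rule set_lebesgue_integral_eq_integral(1))
    qed
    show "(\<lambda>x. \<bar>g x\<bar>) integrable_on {c<..<d}"
    proof -
      have "g absolutely_integrable_on {c<..<d}" using gcd by (simp only: absolutely_integrable_on_Icc_iff_Ioo)
      then show ?thesis by (simp add: absolutely_integrable_on_def)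
    qed
    show "norm (g x * bump n c d x) \<le> \<bar>g x\<bar>" for n x
      unfolding bump_def using flat_1_bounds by (simp add: abs_mult mult_left_le mult_le_one)
    show "(\<lambda>n. g x * bump n c d x) \<longlonglongrightarrow> g x" if "x \<in> {c<..<d}" for x
      using tendsto_mult[OF tendsto_const[of "g x"] bump_tendsto[OF that]] by simp
  qed
  moreover have "integral {c<..<d} (\<lambda>x. g x * bump n c d x) = 0" for n
    using m(2)[of n] 0[of c d n] c by (simp add: integral_open_interval_real)
  ultimately have "integral {c<..<d} g = 0" by (simp add: LIMSEQ_const_iff)
  then show "integral {c..d} g = 0" by (simp add: integral_open_interval_real)
qed

lemma primitive_locally_integrable:
  assumes "primitive w g" shows "locally_integrable w" "locally_integrable g"
proof -
  show "locally_integrable w" unfolding locally_integrable_def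
    using primitive_continuous[OF assms] by (auto intro!: absolutely_integrable_continuous_real elim: continuous_on_subset)
  show "locally_integrable g" unfolding locally_integrable_def
    using primitive_D(1)[OF assms] by (metis absolutely_integrable_on_null atLeastatMost_empty' cbox_interval content_empty not_le)
qed

lemma primitive_test_by_parts:
  assumes w: "primitive w g" and \<phi>: "\<phi> \<in> test_functions"
  shows "pairing w (deriv \<phi>) = - pairing g \<phi>"
proof -
  obtain a c where s: "supported \<phi> a c" using \<phi> by (auto simp: test_functions_iff)
  have d: "0 < a / 2" "a / 2 \<le> a" "c \<le> c + 1" "a / 2 \<le> c + 1" using s by (auto simp: supported_def)
  note l = primitive_locally_integrable[OF w]
  note m1 = locally_integrable_mult[OF l(1) test_function_continuous[OF test_function_deriv[OF \<phi>]] supported_deriv[OF s] d(1-3)]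
  note m2 = locally_integrable_mult[OF l(2) test_function_continuous[OF \<phi>] s d(1-3)]
  have "primitive \<phi> (deriv \<phi>)"
    by (rule primitive_C1[OF test_function_has_deriv[OF \<phi>] test_function_continuous[OF test_function_deriv[OF \<phi>]]])
  from primitive_D(2)[OF primitive_mult[OF w this] d(1,4)]
  have "integral {a / 2..c + 1} (\<lambda>x. g x * \<phi> x + w x * deriv \<phi> x) = w (c + 1) * \<phi> (c + 1) - w (a / 2) * \<phi> (a / 2)" .
  also have "\<dots> = 0" using s by (auto simp: supported_def)
  finally show ?thesis
    using m1 m2 by (simp add: Henstock_Kurzweil_Integration.integral_add set_lebesgue_integral_eq_integral(1))
qed

lemma locally_integrable_diff:
  "locally_integrable f \<Longrightarrow> locally_integrable g \<Longrightarrow> locally_integrable (\<lambda>x. f x - g x)"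
  unfolding locally_integrable_def by (auto intro: set_integral_diff)

lemma locally_integrable_const: "locally_integrable (\<lambda>x. c)"
  by (simp add: locally_integrable_def)

lemma test_integral_diff:
  assumes "locally_integrable f" "locally_integrable g" "\<phi> \<in> test_functions"
  shows "(LINT x:\<Lambda>|lebesgue. (f x - g x) * \<phi> x) = pairing f \<phi> - pairing g \<phi>"
proof -
  obtain a c where s: "supported \<phi> a c" using assms by (auto simp: test_functions_iff)
  have d: "0 < a" "a \<le> a" "c \<le> c" using s by (auto simp: supported_def)
  note c = test_function_continuous[OF assms(3)]
  note m = locally_integrable_mult[OF _ c s d]
  show ?thesis
    using m[OF assms(1)] m[OF assms(2)] m[OF locally_integrable_diff[OF assms(1,2)]]
    by (simp add: left_diff_distrib Henstock_Kurzweil_Integration.integral_diff set_lebesgue_integral_eq_integral(1))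
qed

text \<open>Vanishing of the integral is what makes the antiderivative compactly supported.\<close>

lemma test_antiderivative:
  assumes \<eta>: "\<eta> \<in> bump_algebra" "supported \<eta> a c" and 0: "integral {a..c} \<eta> = 0"
  shows "\<exists>\<Phi>\<in>test_functions. deriv \<Phi> = \<eta>"
proof -
  have a: "0 < a" "a \<le> c" and z: "\<And>x. x \<notin> {a..c} \<Longrightarrow> \<eta> x = 0" using \<eta>(2) by (auto simp: supported_def)
  have cont: "continuous_on S \<eta>" for S
    by (intro continuous_at_imp_continuous_on ballI DERIV_isCont[OF bump_algebra_has_deriv[OF \<eta>(1)]])
  define \<Phi> where "\<Phi> x = integral {0..x} \<eta>" for x
  have int: "\<eta> integrable_on {x..y}" for x y by (rule integrable_continuous_real[OF cont])
  have low: "\<Phi> x = 0" if "x < a" for x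
  proof -
    have "integral {0..x} \<eta> = integral {0..x} (\<lambda>_. 0)"
      by (rule Henstock_Kurzweil_Integration.integral_cong) (use z that in auto)
    then show ?thesis by (simp add: \<Phi>_def)
  qed
  have high: "\<Phi> x = 0" if "x > c" for x
  proof -
    have "integral {0..x} \<eta> = integral {a..c} \<eta>"
    proof (rule integral_spike_set)
      show "negligible {y \<in> {0..x} - {a..c}. \<eta> y \<noteq> 0}"
        by (rule negligible_subset[of "{}"]) (use z in auto)
      show "negligible {y \<in> {a..c} - {0..x}. \<eta> y \<noteq> 0}"
        by (rule negligible_subset[of "{}"]) (use a that in auto)
    qed
    then show ?thesis by (simp add: \<Phi>_def 0)
  qed
  have der: "(\<Phi> has_real_derivative \<eta> x) (at x)" for x
  proof (cases "x < a")
    case True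
    have "((\<lambda>_. 0) has_real_derivative \<eta> x) (at x)" using z[of x] True by simp
    moreover have "eventually (\<lambda>y. \<Phi> y = 0) (nhds x)"
      using eventually_nhds_in_open[of "{..<a}" x] True low by (auto elim!: eventually_mono)
    ultimately show ?thesis by (subst DERIV_cong_ev[OF refl _ refl])
  next
    case False
    have "(\<Phi> has_real_derivative \<eta> x) (at x within {0..x + 1})"
      unfolding \<Phi>_def by (rule integral_has_real_derivative[OF cont]) (use False a in auto)
    moreover have "at x within {0..x + 1} = at x" by (rule at_within_interior) (use False a in auto)
    ultimately show ?thesis by simp
  qed
  have "supported \<Phi> a c" using a low high by (auto simp: supported_def)
  from test_function_antideriv[OF der \<eta>(1) this] show ?thesis by blast
qed

text \<open>Let \<open>V\<close> be an antiderivative of \<open>g\<close>. Then \<open>w = v - V\<close> has weak derivative zero. A bump minus a suitable multiple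
of one fixed bump is the derivative of a test function; hence the integral of \<open>w\<close> against
a bump is a constant \<open>C\<close> times the integral of the bump, and \<open>w = C\<close> by the fundamental lemma.\<close>

lemma du_Bois_Reymond:
  assumes v: "locally_integrable v" and g: "locally_integrable g"
    and weak: "\<And>\<phi>. \<phi> \<in> test_functions \<Longrightarrow> pairing v (deriv \<phi>) = - pairing g \<phi>"
  shows "\<exists>w. primitive w g \<and> (AE x in lebesgue. x \<in> \<Lambda> \<longrightarrow> v x = w x)"
proof -
  define V where "V x = (if x \<ge> 1 then integral {1..x} g else - integral {x..1} g)" for x
  have gi: "g integrable_on {a..c}" if "0 < a" for a c
    using g that by (auto simp: locally_integrable_def intro: set_lebesgue_integral_eq_integral(1))
  have V: "primitive V g"
    unfolding primitive_def
  proof (intro allI impI conjI)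
    fix a c :: real assume ac: "0 < a" "a \<le> c"
    show "g absolutely_integrable_on {a..c}" using g ac by (simp add: locally_integrable_def)
    consider "1 \<le> a" | "a < 1" "1 \<le> c" | "c < 1" by linarith
    then show "integral {a..c} g = V c - V a"
    proof cases
      case 1
      then show ?thesis using Henstock_Kurzweil_Integration.integral_combine[OF 1 ac(2) gi] ac by (simp add: V_def)
    next
      case 2
      then show ?thesis using Henstock_Kurzweil_Integration.integral_combine[OF _ 2(2) gi, of a] ac by (simp add: V_def)
    next
      case 3
      then show ?thesis using Henstock_Kurzweil_Integration.integral_combine[OF ac(2) _ gi[OF ac(1)], of 1] ac by (auto simp: V_def)
    qed
  qed
  note Vl = primitive_locally_integrable(1)[OF V]
  define w where "w x = v x - V x" for x
  have w: "locally_integrable w" unfolding w_def by (rule locally_integrable_diff[OF v Vl])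
  have w0: "pairing w (deriv \<phi>) = 0" if "\<phi> \<in> test_functions" for \<phi>
    unfolding w_def test_integral_diff[OF v Vl test_function_deriv[OF that]]
    by (simp add: weak[OF that] primitive_test_by_parts[OF V that])
  have bt: "bump n c d \<in> test_functions" if "0 < c" "c < d" for n c d
    using bump_test_function[OF bump_in_algebra bump_supported] that by auto
  define I0 where "I0 = integral {1..2} (bump 0 1 2)"
  have I0: "I0 \<noteq> 0"
  proof
    assume "I0 = 0"
    then have "\<forall>x\<in>{1..2}. bump 0 1 2 x = 0"
      unfolding I0_def by (subst (asm) integral_eq_0_iff[OF bump_continuous]) (auto simp: bump_def flat_1_bounds)
    from bspec[OF this, of "3/2"] show False by (simp add: bump_def flat_def)
  qed
  define C where "C = pairing w (bump 0 1 2) / I0"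
  have "AE x in lebesgue. x \<in> \<Lambda> \<longrightarrow> w x - C = 0"
  proof (rule fundamental_lemma)
    show "locally_integrable (\<lambda>x. w x - C)" by (intro locally_integrable_diff w locally_integrable_const)
    fix n and c d :: real assume cd: "0 < c" "c < d"
    define J where "J = integral {c..d} (bump n c d)"
    \<comment> \<open>the multiple of the fixed bump is chosen to make the integral of \<open>\<eta>\<close> vanish\<close>
    define \<eta> where "\<eta> x = bump n c d x + (- J / I0) * bump 0 1 2 x" for x
    have \<eta>: "\<eta> \<in> bump_algebra" unfolding \<eta>_def by (intro bump_algebra.intros bump_in_algebra)
    let ?a = "min c 1" and ?b = "max d 2"
    have s: "supported \<eta> ?a ?b"
    proof -
      have "\<eta> x = 0" if "x \<notin> {?a..?b}" for x
      proof -
        have "x \<notin> {c..d}" "x \<notin> {1..2}" using that by auto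
        then have "bump n c d x = 0" "bump 0 1 2 x = 0"
          using bump_supported[of c d n] bump_supported[of 1 2 0] cd unfolding supported_def by auto
        then show ?thesis by (simp add: \<eta>_def)
      qed
      then show ?thesis using cd by (auto simp: supported_def)
    qed
    have bI: "integral {?a..?b} (bump m c' d') = integral {c'..d'} (bump m c' d')" if "?a \<le> c'" "d' \<le> ?b" "0 < c'" "c' \<le> d'" for m c' d'
    proof (rule integral_spike_set)
      show "negligible {y \<in> {?a..?b} - {c'..d'}. bump m c' d' y \<noteq> 0}"
        by (rule negligible_subset[of "{}"]) (use bump_supported[of c' d' m] that in \<open>auto simp: supported_def\<close>)
      show "negligible {y \<in> {c'..d'} - {?a..?b}. bump m c' d' y \<noteq> 0}"
        by (rule negligible_subset[of "{}"]) (use that in auto)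
    qed
    have bi: "bump m c' d' integrable_on {x..y}" for m c' d' x y
      by (rule integrable_continuous_real[OF bump_continuous])
    have "integral {?a..?b} \<eta> = J + (- J / I0) * I0"
    proof -
      have "integral {?a..?b} \<eta> = integral {?a..?b} (bump n c d) + (- J / I0) * integral {?a..?b} (bump 0 1 2)"
        unfolding \<eta>_def
        by (subst Henstock_Kurzweil_Integration.integral_add)
           (intro bi integrable_continuous_real continuous_intros bump_continuous | simp)+
      then show ?thesis using cd by (simp add: bI J_def I0_def)
    qed
    then have "integral {?a..?b} \<eta> = 0" using I0 by simp
    from test_antiderivative[OF \<eta> s this] obtain \<Phi> where \<Phi>: "\<Phi> \<in> test_functions" "deriv \<Phi> = \<eta>" by blast
    have eta0: "pairing w \<eta> = 0" using w0[OF \<Phi>(1)] \<Phi>(2) by simp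
    have d: "0 < ?a" using cd by auto
    have m: "(\<lambda>x. w x * bump m c' d' x) absolutely_integrable_on {?a..?b}"
       "(LINT x:\<Lambda>|lebesgue. w x * bump m c' d' x) = integral {?a..?b} (\<lambda>x. w x * bump m c' d' x)"
      if "?a \<le> c'" "d' \<le> ?b" "0 < c'" "c' \<le> d'" for m c' d'
      using locally_integrable_mult[OF w bump_continuous bump_supported[OF that(3,4)] d that(1,2)] by auto
    have me: "pairing w \<eta> = integral {?a..?b} (\<lambda>x. w x * \<eta> x)"
      by (rule locally_integrable_mult(2)[OF w test_function_continuous[OF bump_test_function[OF \<eta> s]] s d]) auto
    have "integral {?a..?b} (\<lambda>x. w x * \<eta> x) = integral {?a..?b} (\<lambda>x. w x * bump n c d x + (- J / I0) * (w x * bump 0 1 2 x))"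
      by (simp add: \<eta>_def algebra_simps)
    also have "\<dots> = integral {?a..?b} (\<lambda>x. w x * bump n c d x) + (- J / I0) * integral {?a..?b} (\<lambda>x. w x * bump 0 1 2 x)"
    proof -
      have "(\<lambda>x. w x * bump n c d x) integrable_on {?a..?b}" "(\<lambda>x. (- J / I0) * (w x * bump 0 1 2 x)) integrable_on {?a..?b}"
        by (rule set_lebesgue_integral_eq_integral(1)[OF m(1)]; use cd in simp)
           (rule set_lebesgue_integral_eq_integral(1)[OF set_integrable_mult_right[OF m(1)]]; use cd in simp)
      from Henstock_Kurzweil_Integration.integral_add[OF this] show ?thesis by simp
    qed
    finally have sum: "integral {?a..?b} (\<lambda>x. w x * \<eta> x) = integral {?a..?b} (\<lambda>x. w x * bump n c d x)
        + (- J / I0) * integral {?a..?b} (\<lambda>x. w x * bump 0 1 2 x)" .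
    have "pairing w (bump n c d) = integral {?a..?b} (\<lambda>x. w x * bump n c d x)"
      by (rule m(2)) (use cd in simp_all)
    also have "\<dots> = J / I0 * integral {?a..?b} (\<lambda>x. w x * bump 0 1 2 x)"
      using sum eta0 unfolding me by simp
    also have "integral {?a..?b} (\<lambda>x. w x * bump 0 1 2 x) = pairing w (bump 0 1 2)"
      by (rule m(2)[symmetric]) simp_all
    finally have "pairing w (bump n c d) = J * C" by (simp add: C_def)
    moreover have "(LINT x:\<Lambda>|lebesgue. C * bump n c d x) = C * J"
    proof -
      have "(LINT x:\<Lambda>|lebesgue. C * bump n c d x) = integral {c..d} (\<lambda>x. C * bump n c d x)"
        using locally_integrable_mult(2)[OF locally_integrable_const bump_continuous bump_supported, of c d c d] cd by auto
      then show ?thesis by (simp add: J_def)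
    qed
    ultimately show "(LINT x:\<Lambda>|lebesgue. (w x - C) * bump n c d x) = 0"
      by (simp only: test_integral_diff[OF w locally_integrable_const bt[OF cd]] mult.commute[of J C] diff_self)
  qed
  then have ae: "AE x in lebesgue. x \<in> \<Lambda> \<longrightarrow> v x = V x + C"
    by eventually_elim (auto simp: w_def)
  have "primitive (\<lambda>x. V x + C) g"
    using V by (simp add: primitive_def)
  with ae show ?thesis by blast
qed

section \<open>Weak derivatives and jets\<close>

lemma AE_half_line_absolutely_integrable:
  fixes f g :: "real \<Rightarrow> real"
  assumes ae: "AE x in lebesgue. x \<in> \<Lambda> \<longrightarrow> f x = g x" and S: "S \<subseteq> \<Lambda>" and f: "f absolutely_integrable_on S"
  shows "g absolutely_integrable_on S" and "integral S g = integral S f"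
proof -
  obtain T where T: "negligible T" "{x. \<not> (x \<in> \<Lambda> \<longrightarrow> f x = g x)} \<subseteq> T"
    using ae unfolding eventually_ae_filter_negligible by auto
  have eq: "g x = f x" if "x \<in> S - T" for x using that T S by auto
  show "g absolutely_integrable_on S" by (rule absolutely_integrable_spike[OF f T(1) eq])
  show "integral S g = integral S f" by (rule integral_spike[OF T(1)]) (use eq in auto)
qed

lemma AE_half_line_integral:
  fixes f g :: "real \<Rightarrow> real"
  assumes ae: "AE x in lebesgue. x \<in> \<Lambda> \<longrightarrow> f x = g x"
  shows "(LINT x:\<Lambda>|lebesgue. f x) = (LINT x:\<Lambda>|lebesgue. g x)"
proof (cases "f absolutely_integrable_on \<Lambda>")
  case True
  note g = AE_half_line_absolutely_integrable[OF ae order_refl True]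
  show ?thesis using set_lebesgue_integral_eq_integral(2)[OF True] set_lebesgue_integral_eq_integral(2)[OF g(1)] g(2) by simp
next
  case False
  have ae': "AE x in lebesgue. x \<in> \<Lambda> \<longrightarrow> g x = f x" using ae by eventually_elim auto
  have "\<not> g absolutely_integrable_on \<Lambda>"
    using AE_half_line_absolutely_integrable(1)[OF ae' order_refl] False by blast
  with False show ?thesis unfolding set_integrable_def set_lebesgue_integral_def
    by (simp add: not_integrable_integral_eq)
qed

lemma locally_integrable_AE:
  assumes ae: "AE x in lebesgue. x \<in> \<Lambda> \<longrightarrow> f x = g x" and f: "locally_integrable f"
  shows "locally_integrable g"
  unfolding locally_integrable_def
proof (intro allI impI)
  fix a c :: real assume a: "0 < a"
  show "g absolutely_integrable_on {a..c}"
    by (rule AE_half_line_absolutely_integrable(1)[OF ae]) (use f a in \<open>auto simp: half_line_def locally_integrable_def\<close>)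
qed

lemma primitive_AE:
  assumes ae: "AE x in lebesgue. x \<in> \<Lambda> \<longrightarrow> f x = g x" and w: "primitive w f"
  shows "primitive w g"
  unfolding primitive_def
proof (intro allI impI)
  fix a c :: real assume a: "0 < a" "a \<le> c"
  have "{a..c} \<subseteq> \<Lambda>" using a by (auto simp: half_line_def)
  from AE_half_line_absolutely_integrable[OF ae this primitive_D(1)[OF w a]] primitive_D(2)[OF w a]
  show "g absolutely_integrable_on {a..c} \<and> integral {a..c} g = w c - w a" by simp
qed

lemma L2_AE:
  assumes ae: "AE x in lebesgue. x \<in> \<Lambda> \<longrightarrow> f x = g x" and f: "f \<in> weighted_L2 \<omega>"
  shows "g \<in> weighted_L2 \<omega>"
proof -
  have "(\<lambda>x. indicator \<Lambda> x *\<^sub>R f x) \<in> borel_measurable lebesgue"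
    using L2_D(1)[OF f] by (subst (asm) borel_measurable_restrict_space_iff) auto
  moreover have "AE x in lebesgue. indicator \<Lambda> x *\<^sub>R f x = indicator \<Lambda> x *\<^sub>R g x"
    using ae by eventually_elim (auto simp: indicator_def)
  ultimately have "(\<lambda>x. indicator \<Lambda> x *\<^sub>R g x) \<in> borel_measurable lebesgue"
    by (rule borel_measurable_AE)
  then have m: "g \<in> borel_measurable (lebesgue_on \<Lambda>)"
    by (subst borel_measurable_restrict_space_iff) auto
  have "AE x in lebesgue. x \<in> \<Lambda> \<longrightarrow> (f x)\<^sup>2 * \<omega> x = (g x)\<^sup>2 * \<omega> x"
    using ae by eventually_elim auto
  from AE_half_line_absolutely_integrable(1)[OF this order_refl L2_D(2)[OF f]] m
  show ?thesis by (simp add: weighted_L2_def)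
qed

lemma weak_deriv_unique:
  assumes "has_weak_deriv k v g" "has_weak_deriv k v h"
  shows "AE x in lebesgue. x \<in> \<Lambda> \<longrightarrow> g x = h x"
proof -
  have l: "locally_integrable g" "locally_integrable h" using assms by (auto simp: has_weak_deriv_def)
  have "AE x in lebesgue. x \<in> \<Lambda> \<longrightarrow> g x - h x = 0"
  proof (rule fundamental_lemma)
    show "locally_integrable (\<lambda>x. g x - h x)" by (rule locally_integrable_diff[OF l])
    fix n and c d :: real assume cd: "0 < c" "c < d"
    have t: "bump n c d \<in> test_functions"
      using bump_test_function[OF bump_in_algebra bump_supported] cd by auto
    have "pairing v ((deriv ^^ k) (bump n c d)) = (-1) ^ k * pairing g (bump n c d)"
      "pairing v ((deriv ^^ k) (bump n c d)) = (-1) ^ k * pairing h (bump n c d)"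
      using assms t unfolding has_weak_deriv_def by blast+
    then show "(LINT x:\<Lambda>|lebesgue. (g x - h x) * bump n c d x) = 0"
      unfolding test_integral_diff[OF l t] by simp
  qed
  then show ?thesis by eventually_elim auto
qed

lemma weak_deriv_AE:
  assumes "has_weak_deriv k v g"
  shows "AE x in lebesgue. x \<in> \<Lambda> \<longrightarrow> weak_deriv k v x = g x"
proof -
  have "has_weak_deriv k v (weak_deriv k v)" unfolding weak_deriv_def by (rule someI[of "has_weak_deriv k v", OF assms])
  from weak_deriv_unique[OF this assms] show ?thesis .
qed

text \<open>The unweighted part of the passage from weak derivatives to jets; integrability with weights is expressed by
\<open>jet\<close>.\<close>

definition sobolev_jet :: "nat \<Rightarrow> (real \<Rightarrow> real) \<Rightarrow> (nat \<Rightarrow> real \<Rightarrow> real) \<Rightarrow> bool"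
  where "sobolev_jet r u g \<longleftrightarrow> (\<forall>k\<le>r. locally_integrable (g k)) \<and> (\<forall>k<r. primitive (g k) (g (Suc k))) \<and>
           (AE x in lebesgue. x \<in> \<Lambda> \<longrightarrow> u x = g 0 x)"

lemma sobolev_jet_weak_deriv:
  assumes j: "sobolev_jet r u g" and k: "k \<le> r"
  shows "has_weak_deriv k u (g k)"
proof -
  have g: "\<And>k. k \<le> r \<Longrightarrow> locally_integrable (g k)" "\<And>k. k < r \<Longrightarrow> primitive (g k) (g (Suc k))"
    and ae: "AE x in lebesgue. x \<in> \<Lambda> \<longrightarrow> u x = g 0 x" using j by (auto simp: sobolev_jet_def)
  have ae': "AE x in lebesgue. x \<in> \<Lambda> \<longrightarrow> g 0 x = u x" using ae by eventually_elim auto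
  have "pairing (g 0) ((deriv ^^ k) \<phi>) = (-1) ^ k * pairing (g k) \<phi>"
    if "\<phi> \<in> test_functions" for \<phi>
    using k that
  proof (induction k arbitrary: \<phi>)
    case (Suc k)
    have "pairing (g 0) ((deriv ^^ Suc k) \<phi>) = pairing (g 0) ((deriv ^^ k) (deriv \<phi>))"
      by (simp only: funpow_Suc_right o_def)
    also have "\<dots> = (-1) ^ k * pairing (g k) (deriv \<phi>)"
      using Suc.prems by (intro Suc.IH test_function_deriv) auto
    also have "pairing (g k) (deriv \<phi>) = - pairing (g (Suc k)) \<phi>"
      using Suc.prems by (intro primitive_test_by_parts g) auto
    finally show ?case by simp
  qed simp
  moreover have "pairing u \<psi> = pairing (g 0) \<psi>" for \<psi>
    by (rule AE_half_line_integral) (use ae in \<open>eventually_elim, auto\<close>)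
  ultimately show ?thesis
    using locally_integrable_AE[OF ae' g(1)[of 0]] g(1)[OF k] by (simp add: has_weak_deriv_def)
qed

text \<open>Each weak derivative is replaced by an absolutely continuous representative, except the last one, which has none in
general.\<close>

lemma weighted_Sobolev_jet:
  assumes u: "u \<in> weighted_Sobolev r (wt \<gamma>)"
  shows "\<exists>g. sobolev_jet r u g \<and> jet r \<gamma> g"
proof -
  have "\<forall>k. \<exists>g. k \<le> r \<longrightarrow> g \<in> L2 \<gamma> \<and> has_weak_deriv k u g"
    using u by (auto simp: weighted_Sobolev_def)
  then obtain h where h: "\<And>k. k \<le> r \<Longrightarrow> h k \<in> L2 \<gamma>" "\<And>k. k \<le> r \<Longrightarrow> has_weak_deriv k u (h k)"
    by metis
  have hl: "locally_integrable (h k)" if "k \<le> r" for k using h(2)[OF that] by (simp add: has_weak_deriv_def)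
  have ul: "locally_integrable u" using h(2)[of 0] by (simp add: has_weak_deriv_def)
  have "\<exists>w. primitive w (h (Suc k)) \<and> (AE x in lebesgue. x \<in> \<Lambda> \<longrightarrow> h k x = w x)" if k: "k < r" for k
  proof (rule du_Bois_Reymond)
    show "locally_integrable (h k)" "locally_integrable (h (Suc k))" using hl k by auto
    fix \<phi> assume \<phi>: "\<phi> \<in> test_functions"
    have "pairing u ((deriv ^^ k) (deriv \<phi>)) = (-1) ^ k * pairing (h k) (deriv \<phi>)"
      using h(2)[of k] k test_function_deriv[OF \<phi>] by (simp add: has_weak_deriv_def)
    moreover have "pairing u ((deriv ^^ Suc k) \<phi>) = (-1) ^ Suc k * pairing (h (Suc k)) \<phi>"
      using h(2)[of "Suc k"] k \<phi> by (simp add: has_weak_deriv_def)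
    ultimately have "(-1) ^ k * pairing (h k) (deriv \<phi>) = (-1) ^ Suc k * pairing (h (Suc k)) \<phi>"
      by (simp only: funpow_Suc_right o_def)
    then have "(-1::real) ^ k * pairing (h k) (deriv \<phi>) = (-1) ^ k * - pairing (h (Suc k)) \<phi>"
      by simp
    then show "pairing (h k) (deriv \<phi>) = - pairing (h (Suc k)) \<phi>"
      by (rule mult_left_cancel[THEN iffD1, rotated]) simp
  qed
  then obtain w where w: "\<And>k. k < r \<Longrightarrow> primitive (w k) (h (Suc k))" "\<And>k. k < r \<Longrightarrow> AE x in lebesgue. x \<in> \<Lambda> \<longrightarrow> h k x = w k x"
    by metis
  define g where "g k = (if k < r then w k else h k)" for k
  have ae: "AE x in lebesgue. x \<in> \<Lambda> \<longrightarrow> h k x = g k x" if "k \<le> r" for k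
    using w(2)[of k] by (auto simp: g_def)
  have prim: "primitive (g k) (g (Suc k))" if "k < r" for k
    using primitive_AE[OF ae w(1)[OF that]] that by (simp add: g_def)
  have "has_weak_deriv 0 u u" using ul by (simp add: has_weak_deriv_def)
  from weak_deriv_unique[OF this h(2)[of 0]] have "AE x in lebesgue. x \<in> \<Lambda> \<longrightarrow> u x = h 0 x" by simp
  with ae[of 0] have "AE x in lebesgue. x \<in> \<Lambda> \<longrightarrow> u x = g 0 x" by (auto elim: eventually_elim2)
  then have "sobolev_jet r u g"
    using locally_integrable_AE[OF ae hl] prim by (simp add: sobolev_jet_def)
  moreover have "jet r \<gamma> g"
    using L2_AE[OF ae h(1)] prim by (simp add: jet_def)
  ultimately show ?thesis by blast
qed

lemma sobolev_jet_imp_weighted_Sobolev: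
  assumes j: "sobolev_jet r u g" and "s \<le> r" "jet s \<gamma> g"
  shows "u \<in> weighted_Sobolev s (wt \<gamma>)"
  unfolding weighted_Sobolev_def
proof (clarify)
  fix k assume k: "k \<le> s"
  have "has_weak_deriv k u (g k)" by (rule sobolev_jet_weak_deriv[OF j]) (use k assms in simp)
  moreover have "g k \<in> L2 \<gamma>" using assms k by (simp add: jet_def)
  ultimately show "\<exists>g\<in>L2 \<gamma>. has_weak_deriv k u g" by blast
qed

lemma a_form_jet_form:
  assumes u: "sobolev_jet r u g" and v: "sobolev_jet r v h" and s: "s \<le> r"
  shows "a_form s \<alpha> \<beta> u v = jet_form s (\<alpha> + real s) (\<beta> / 2) g h"
proof -
  have "weighted_inner \<omega> (weak_deriv k u) (weak_deriv k v) = weighted_inner \<omega> (g k) (h k)" if k: "k \<le> s" for \<omega> k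
    unfolding weighted_inner_def
  proof (rule AE_half_line_integral)
    have k': "k \<le> r" using k s by simp
    show "AE x in lebesgue. x \<in> \<Lambda> \<longrightarrow> weak_deriv k u x * weak_deriv k v x * \<omega> x = g k x * h k x * \<omega> x"
      using weak_deriv_AE[OF sobolev_jet_weak_deriv[OF u k']] weak_deriv_AE[OF sobolev_jet_weak_deriv[OF v k']]
      by eventually_elim auto
  qed
  then show ?thesis
    unfolding a_form_def jet_form_def
    by (intro sum.cong) (auto simp: power_divide right_diff_distrib')
qed

lemma sobolev_jet_poly: "sobolev_jet r (expoly b p) (poly_jet b p)"
  unfolding sobolev_jet_def
proof (intro conjI allI impI)
  show "locally_integrable (poly_jet b p k)" for k
    unfolding poly_jet_def by (rule primitive_locally_integrable(1)[OF primitive_expoly])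
qed (simp_all add: poly_jet_def primitive_expoly)

lemma sobolev_jet_diff:
  assumes "sobolev_jet r u g" "sobolev_jet r v h"
  shows "sobolev_jet r (\<lambda>x. u x - v x) (\<lambda>k x. g k x - h k x)"
proof -
  have "AE x in lebesgue. x \<in> \<Lambda> \<longrightarrow> u x = g 0 x" "AE x in lebesgue. x \<in> \<Lambda> \<longrightarrow> v x = h 0 x"
    using assms by (auto simp: sobolev_jet_def)
  then have "AE x in lebesgue. x \<in> \<Lambda> \<longrightarrow> u x - v x = g 0 x - h 0 x" by eventually_elim auto
  moreover have "primitive (\<lambda>x. g k x - h k x) (\<lambda>x. g (Suc k) x - h (Suc k) x)" if "k < r" for k
    using primitive_add[of "g k" "g (Suc k)", OF _ primitive_cmult[of "h k" "h (Suc k)" "-1"]] assms that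
    by (simp add: sobolev_jet_def)
  ultimately show ?thesis
    using assms by (simp add: sobolev_jet_def locally_integrable_diff)
qed

lemma jet_diff:
  assumes "jet m \<gamma> g" "jet m \<gamma> h" shows "jet m \<gamma> (\<lambda>k x. g k x - h k x)"
  using jet_add[OF assms(1) jet_cmult[OF assms(2), of "-1"]] by simp

lemma jet_form_diff_left:
  assumes "jet r \<gamma> g" "jet r \<gamma> g'" "jet r \<gamma> h"
  shows "jet_form r \<gamma> b (\<lambda>k x. g k x - g' k x) h = jet_form r \<gamma> b g h - jet_form r \<gamma> b g' h"
  using jet_form_add_left[OF assms(1) jet_cmult[OF assms(2), of "-1"] assms(3), of b]
    jet_form_cmult_left[of r \<gamma> b "-1" g' h] by simp

section \<open>The orthogonal projection\<close>

lemma laguerre_space_eq: "laguerre_space \<beta> N = expoly (\<beta> / 2) ` polys (Suc N)"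
proof -
  have "(\<lambda>x. exp (- (1 / 2) * \<beta> * x) * poly p x) = expoly (\<beta> / 2) p" for p
    by (simp add: expoly_def fun_eq_iff)
  then show ?thesis by (auto simp: laguerre_space_def polys_Suc)
qed

text \<open>The projection exists by the Riesz representation on polynomials, and is unique because the form is definite on
them; so the definite description in \<open>laguerre_proj\<close> denotes it.\<close>

lemma laguerre_proj_jet:
  assumes \<gamma>: "\<alpha> + real r > -1" and \<beta>: "\<beta> > 0" and u: "sobolev_jet r u g" and g: "jet r (\<alpha> + real r) g"
  obtains p where "p \<in> polys (Suc N)" "laguerre_proj r \<alpha> \<beta> N u = expoly (\<beta> / 2) p"
    "\<And>q. q \<in> polys (Suc N) \<Longrightarrow> jet_form r (\<alpha> + real r) (\<beta> / 2) (\<lambda>k x. g k x - poly_jet (\<beta> / 2) p k x) (poly_jet (\<beta> / 2) q) = 0"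
proof -
  let ?b = "\<beta> / 2" and ?\<gamma> = "\<alpha> + real r"
  let ?F = "jet_form r ?\<gamma> ?b"
  have b: "?b > 0" using \<beta> by simp
  define B where "B p q = ?F (poly_jet ?b p) (poly_jet ?b q)" for p q
  note J = jet_poly_jet[OF \<gamma> b]
  have addl: "?F (poly_jet ?b (p + q)) h = ?F (poly_jet ?b p) h + ?F (poly_jet ?b q) h"
    if "jet r ?\<gamma> h" for p q h
    unfolding poly_jet_add by (rule jet_form_add_left[OF J J that])
  have sml: "?F (poly_jet ?b (smult c p)) h = c * ?F (poly_jet ?b p) h" for c p h
    unfolding poly_jet_smult by (rule jet_form_cmult_left)
  have pos: "B p p = 0 \<Longrightarrow> p = 0" for p unfolding B_def by (rule jet_form_poly_jet_eq_0[OF \<gamma> b])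
  have "\<exists>p\<in>polys (Suc N). \<forall>q\<in>polys (Suc N). B p q = ?F (poly_jet ?b q) g"
  proof (rule polys_representation)
    show "B (p + p') q = B p q + B p' q" "B (smult c p) q = c * B p q" "B p q = B q p" for p p' q c
      unfolding B_def by (rule addl[OF J] sml jet_form_commute)+
  qed (rule pos addl[OF g] sml, assumption?)+
  then obtain p where p: "p \<in> polys (Suc N)"
    "\<And>q. q \<in> polys (Suc N) \<Longrightarrow> B p q = ?F (poly_jet ?b q) g" by blast
  have orth: "?F (\<lambda>k x. g k x - poly_jet ?b p k x) (poly_jet ?b q) = 0" if "q \<in> polys (Suc N)" for q
    unfolding jet_form_diff_left[OF g J J] using p(2)[OF that] jet_form_commute[of r ?\<gamma> ?b g "poly_jet ?b q"]
    by (simp add: B_def)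
  have form: "a_form r \<alpha> \<beta> (\<lambda>x. u x - expoly ?b p' x) (expoly ?b q) =
      ?F (\<lambda>k x. g k x - poly_jet ?b p' k x) (poly_jet ?b q)" for p' q
    by (rule a_form_jet_form[OF sobolev_jet_diff[OF u sobolev_jet_poly] sobolev_jet_poly order_refl])
  have "laguerre_proj r \<alpha> \<beta> N u = expoly ?b p"
    unfolding laguerre_proj_def
  proof (rule the_equality, intro conjI ballI)
    show "expoly ?b p \<in> laguerre_space \<beta> N" using p(1) by (simp add: laguerre_space_eq)
    show "a_form r \<alpha> \<beta> (\<lambda>x. u x - expoly ?b p x) v = 0" if "v \<in> laguerre_space \<beta> N" for v
      using that orth by (auto simp: laguerre_space_eq form)
  next
    fix f assume f: "f \<in> laguerre_space \<beta> N \<and> (\<forall>v\<in>laguerre_space \<beta> N. a_form r \<alpha> \<beta> (\<lambda>x. u x - f x) v = 0)"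
    then obtain p' where p': "p' \<in> polys (Suc N)" "f = expoly ?b p'" by (auto simp: laguerre_space_eq)
    have d: "p' - p \<in> polys (Suc N)" by (rule polys_diff[OF p'(1) p(1)])
    have "?F (\<lambda>k x. g k x - poly_jet ?b p' k x) (poly_jet ?b (p' - p)) = 0"
      using f d unfolding p'(2) laguerre_space_eq form[symmetric] by blast
    then have "B (p' - p) (p' - p) = 0"
      using orth[OF d] unfolding B_def poly_jet_diff[of _ p' p]
      by (simp add: jet_form_diff_left[OF g J jet_diff[OF J J]] jet_form_diff_left[OF J J jet_diff[OF J J]])
    then have "p' - p = 0" by (rule pos)
    then show "f = expoly ?b p" using p'(2) by simp
  qed
  then show ?thesis using that p(1) orth by blast
qed

section \<open>Descent from order r to order s\<close>

text \<open>For \<open>N > 2t\<close> the first summand on the right is at least \<open>N\<close>; for the other \<open>N\<close> the positive number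
\<open>\<alpha> + t + 1\<close> is at least a fixed multiple of \<open>N\<close>.\<close>

lemma gap_constant:
  "\<exists>\<kappa>>0. \<kappa> \<le> 1 \<and> (\<forall>t<r. \<alpha> + real t > -1 \<longrightarrow> (\<forall>N. \<kappa> * real N \<le> 2 * real (Suc N - t) + (\<alpha> + real t) + 1))"
proof (induction r)
  case 0
  show ?case by (rule exI[of _ 1]) simp
next
  case (Suc r)
  then obtain \<kappa> where \<kappa>: "\<kappa> > 0" "\<kappa> \<le> 1"
    "\<And>t N. t < r \<Longrightarrow> \<alpha> + real t > -1 \<Longrightarrow> \<kappa> * real N \<le> 2 * real (Suc N - t) + (\<alpha> + real t) + 1" by blast
  show ?case
  proof (cases "\<alpha> + real r > -1")
    case False
    then show ?thesis using \<kappa> by (intro exI[of _ \<kappa>]) (auto simp: less_Suc_eq)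
  next
    case True
    define \<delta> where "\<delta> = \<alpha> + real r + 1"
    have \<delta>: "\<delta> > 0" using True by (simp add: \<delta>_def)
    \<comment> \<open>\<open>2 r + 1\<close> instead of \<open>2 r\<close> because \<open>r\<close> may be zero\<close>
    let ?k = "min \<kappa> (\<delta> / (2 * real r + 1))"
    have k: "?k > 0" "?k \<le> 1" "?k \<le> \<kappa>" using \<kappa> \<delta> by auto
    have new: "?k * real N \<le> 2 * real (Suc N - r) + (\<alpha> + real r) + 1" for N
    proof (cases "N \<le> 2 * r")
      case True
      have "?k * real N \<le> \<delta> / (2 * real r + 1) * (2 * real r + 1)"
        using True \<delta> k(1) by (intro mult_mono) auto
      then show ?thesis by (simp add: \<delta>_def)
    next
      case False
      have "?k * real N \<le> 1 * real N" using k by (intro mult_right_mono) auto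
      also have "\<dots> \<le> 2 * real (Suc N - r)" using False by linarith
      finally show ?thesis using \<delta> by (simp add: \<delta>_def)
    qed
    have "?k * real N \<le> 2 * real (Suc N - t) + (\<alpha> + real t) + 1" if "t < r" "\<alpha> + real t > -1" for t N
      using \<kappa>(3)[OF that, of N] mult_right_mono[OF k(3), of "real N"] by simp
    then show ?thesis using k new by (intro exI[of _ ?k]) (auto simp: less_Suc_eq)
  qed
qed

lemma descent:
  assumes \<alpha>: "\<alpha> + real s > -1" and b: "b > 0" and "s \<le> t" "t \<le> r" and g: "jet r (\<alpha> + real r) g" and o: "orth (\<alpha> + real r) b r M g"
  shows "jet t (\<alpha> + real t) g \<and> orth (\<alpha> + real t) b t M g"
  using \<open>t \<le> r\<close> \<open>s \<le> t\<close>
proof (induction t rule: inc_induct)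
  case base
  show ?case using g o by simp
next
  case (step t)
  have \<gamma>: "\<alpha> + real t > -1" using \<alpha> step.prems by simp
  have "jet (Suc t) (\<alpha> + real t + 1) g" "orth (\<alpha> + real t + 1) b (Suc t) M g"
    using step.IH step.prems by (auto simp: algebra_simps simp del: orth.simps)
  then show ?case using jet_lower[OF _ \<gamma>] orth_lower[OF \<gamma> b] by blast
qed

lemma form_descent:
  assumes \<alpha>: "\<alpha> + real s > -1" and b: "b > 0" and s: "s \<le> r" and g: "jet r (\<alpha> + real r) g"
    and o: "orth (\<alpha> + real r) b r (Suc N) g" and "\<kappa> > 0"
    and \<kappa>: "\<And>t. t < r \<Longrightarrow> \<alpha> + real t > -1 \<Longrightarrow> \<kappa> * real N \<le> 2 * real (Suc N - t) + (\<alpha> + real t) + 1"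
  shows "jet_form s (\<alpha> + real s) b g g * (b * (\<kappa> * real N)) ^ (r - s) \<le> jet_form r (\<alpha> + real r) b g g"
proof -
  have "t \<ge> s \<Longrightarrow> jet_form t (\<alpha> + real t) b g g * (b * (\<kappa> * real N)) ^ (r - t) \<le> jet_form r (\<alpha> + real r) b g g"
    if "t \<le> r" for t
    using that
  proof (induction t rule: inc_induct)
    case base
    show ?case by simp
  next
    case (step t)
    have \<gamma>: "\<alpha> + real t > -1" using \<alpha> step.prems by simp
    have j: "jet (Suc t) (\<alpha> + real t + 1) g"
      using descent[OF \<alpha> b _ _ g o, of "Suc t"] step by (simp add: algebra_simps)
    have ot: "orth (\<alpha> + real t) b t (Suc N) g"
      using descent[OF \<alpha> b _ _ g o, of t] step by simp
    have nn: "0 \<le> jet_form t (\<alpha> + real t) b g g" using b by (intro jet_form_nonneg) simp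
    have "b * (\<kappa> * real N) * jet_form t (\<alpha> + real t) b g g
        \<le> b * (2 * real (Suc N - t) + (\<alpha> + real t) + 1) * jet_form t (\<alpha> + real t) b g g"
      using \<kappa>[OF step.hyps(2) \<gamma>] b nn by (intro mult_right_mono mult_left_mono) auto
    also have "\<dots> \<le> jet_form (Suc t) (\<alpha> + real t + 1) b g g" by (rule form_gap[OF \<gamma> b j ot])
    finally have le: "jet_form t (\<alpha> + real t) b g g * (b * (\<kappa> * real N)) \<le> jet_form (Suc t) (\<alpha> + real (Suc t)) b g g"
      by (simp add: algebra_simps)
    have "r - t = Suc (r - Suc t)" using step.hyps by simp
    then have "jet_form t (\<alpha> + real t) b g g * (b * (\<kappa> * real N)) ^ (r - t) =
       jet_form t (\<alpha> + real t) b g g * (b * (\<kappa> * real N)) * (b * (\<kappa> * real N)) ^ (r - Suc t)" by simp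
    also have "\<dots> \<le> jet_form (Suc t) (\<alpha> + real (Suc t)) b g g * (b * (\<kappa> * real N)) ^ (r - Suc t)"
      by (rule mult_right_mono[OF le]) (use b \<open>\<kappa> > 0\<close> in simp)
    also have "\<dots> \<le> jet_form r (\<alpha> + real r) b g g" using step by simp
    finally show ?case .
  qed
  from this[OF s order_refl] show ?thesis .
qed

text \<open>Extraction of the root from \<open>form_descent\<close>; the weaker constant \<open>(1/\<kappa>)\<^sup>r\<close> is the same for all \<open>d \<le> r\<close>.\<close>

lemma sqrt_rate_bound:
  fixes A B X \<kappa> :: real
  assumes le: "A * (X * \<kappa>) ^ d \<le> B" and "X > 0" "0 < \<kappa>" "\<kappa> \<le> 1" "d \<le> r" "0 \<le> A"
  shows "sqrt A \<le> (1 / \<kappa>) ^ r * X powr (- (real d / 2)) * sqrt B"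
proof -
  have "sqrt A * sqrt ((X * \<kappa>) ^ d) \<le> sqrt B"
    using le by (simp flip: real_sqrt_mult)
  moreover have "sqrt ((X * \<kappa>) ^ d) \<ge> X powr (real d / 2) * \<kappa> ^ r"
  proof -
    have "sqrt ((X * \<kappa>) ^ d) = sqrt (X ^ d) * sqrt (\<kappa> ^ d)"
      by (simp add: power_mult_distrib real_sqrt_mult)
    moreover have "sqrt (X ^ d) = X powr (real d / 2)"
      using \<open>X > 0\<close> by (simp add: powr_half_sqrt[symmetric] powr_powr flip: powr_realpow)
    moreover have "\<kappa> ^ r \<le> sqrt (\<kappa> ^ d)"
    proof (rule real_le_rsqrt)
      have "(\<kappa> ^ r)\<^sup>2 \<le> \<kappa> ^ r"
        unfolding power2_eq_square by (rule mult_left_le) (use assms in \<open>auto simp: power_le_one\<close>)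
      also have "\<dots> \<le> \<kappa> ^ d" by (rule power_decreasing) (use assms in auto)
      finally show "(\<kappa> ^ r)\<^sup>2 \<le> \<kappa> ^ d" .
    qed
    ultimately show ?thesis by (simp add: mult_left_mono)
  qed
  ultimately have main: "sqrt A * (X powr (real d / 2) * \<kappa> ^ r) \<le> sqrt B"
    using \<open>0 \<le> A\<close> by (meson mult_left_mono order_trans real_sqrt_ge_zero)
  have X: "X powr (real d / 2) > 0" using \<open>X > 0\<close> by simp
  have "sqrt A = (1 / \<kappa>) ^ r * X powr (- (real d / 2)) * (sqrt A * (X powr (real d / 2) * \<kappa> ^ r))"
    using X \<open>0 < \<kappa>\<close> by (simp add: powr_minus field_simps)
  also have "\<dots> \<le> (1 / \<kappa>) ^ r * X powr (- (real d / 2)) * sqrt B"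
    by (rule mult_left_mono[OF main]) (use \<open>0 < \<kappa>\<close> in simp)
  finally show ?thesis .
qed

theorem theorem1:
  fixes r :: nat and \<alpha> :: real
  assumes "\<alpha> > - real r - 1"
  shows "\<exists>c>0. \<forall>\<beta>>0. \<forall>N s :: nat. \<forall>u\<in>weighted_Sobolev r (wt (\<alpha> + real r)).
           real s > - \<alpha> - 1 \<and> s \<le> r \<and> \<not> (N = 0 \<and> s < r) \<longrightarrow>
           (let e = (\<lambda>x. u x - laguerre_proj r \<alpha> \<beta> N u x) in
              e \<in> weighted_Sobolev s (wt (\<alpha> + real s)) \<and>
              a_norm s \<alpha> \<beta> e \<le> c * rate \<beta> N s r * a_norm r \<alpha> \<beta> e \<and>
              c * rate \<beta> N s r * a_norm r \<alpha> \<beta> e \<le> c * rate \<beta> N s r * a_norm r \<alpha> \<beta> u)"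
proof -
  have \<gamma>: "\<alpha> + real r > -1" using assms by simp
  obtain \<kappa> where \<kappa>: "\<kappa> > 0" "\<kappa> \<le> 1"
    "\<And>t N. t < r \<Longrightarrow> \<alpha> + real t > -1 \<Longrightarrow> \<kappa> * real N \<le> 2 * real (Suc N - t) + (\<alpha> + real t) + 1"
    using gap_constant[of r \<alpha>] by blast
  define c where "c = (1 / (\<kappa> / 2)) ^ r"
  have c1: "c \<ge> 1" unfolding c_def by (rule one_le_power) (use \<kappa> in \<open>simp add: field_simps\<close>)
  show ?thesis
  proof (intro exI[of _ c] conjI allI impI ballI)
    show "c > 0" using c1 by simp
    fix \<beta> :: real and N s :: nat and u
    assume \<beta>: "\<beta> > 0" and u: "u \<in> weighted_Sobolev r (wt (\<alpha> + real r))"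
      and "real s > - \<alpha> - 1 \<and> s \<le> r \<and> \<not> (N = 0 \<and> s < r)"
    then have s: "\<alpha> + real s > -1" "s \<le> r" and Ns: "s < r \<Longrightarrow> N > 0" by auto
    let ?b = "\<beta> / 2"
    let ?F = "jet_form r (\<alpha> + real r) ?b"
    have b: "?b > 0" using \<beta> by simp
    obtain g where g: "sobolev_jet r u g" "jet r (\<alpha> + real r) g"
      using weighted_Sobolev_jet[OF u] by blast
    obtain p where p: "p \<in> polys (Suc N)" "laguerre_proj r \<alpha> \<beta> N u = expoly ?b p"
      "\<And>q. q \<in> polys (Suc N) \<Longrightarrow> ?F (\<lambda>k x. g k x - poly_jet ?b p k x) (poly_jet ?b q) = 0"
      using laguerre_proj_jet[OF \<gamma> \<beta> g] by blast
    define E where "E = (\<lambda>k x. g k x - poly_jet ?b p k x)"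
    define e where "e = (\<lambda>x. u x - laguerre_proj r \<alpha> \<beta> N u x)"
    note J = jet_poly_jet[OF \<gamma> b]
    have sE: "sobolev_jet r e E" unfolding e_def E_def p(2) by (rule sobolev_jet_diff[OF g(1) sobolev_jet_poly])
    have jE: "jet r (\<alpha> + real r) E" unfolding E_def by (rule jet_diff[OF g(2) J])
    have oE: "?F E (poly_jet ?b q) = 0" if "q \<in> polys (Suc N)" for q
      unfolding E_def by (rule p(3)[OF that])
    have norm_e: "a_norm t \<alpha> \<beta> e = sqrt (jet_form t (\<alpha> + real t) ?b E E)" if "t \<le> r" for t
      by (simp add: a_norm_def a_form_jet_form[OF sE sE that])
    have norm_u: "a_norm r \<alpha> \<beta> u = sqrt (?F g g)"
      by (simp add: a_norm_def a_form_jet_form[OF g(1) g(1) order_refl])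
    have contract: "?F E E \<le> ?F g g"
    proof -
      let ?P = "poly_jet ?b p"
      have gE: "g = (\<lambda>k x. E k x + ?P k x)" by (simp add: E_def)
      have "?F g g = ?F E g + ?F ?P g"
        by (subst (1) gE) (rule jet_form_add_left[OF jE J g(2)])
      also have "\<dots> = ?F g E + ?F g ?P"
        by (simp only: jet_form_commute[of _ _ _ g])
      also have "\<dots> = ?F E E + ?F ?P ?P"
        unfolding gE jet_form_add_left[OF jE J jE] jet_form_add_left[OF jE J J]
        by (simp only: oE[OF p(1)] jet_form_commute[of _ _ _ ?P E] add_0_left add_0_right)
      finally show ?thesis using jet_form_nonneg[of ?b r "\<alpha> + real r" ?P] b by simp
    qed
    have first: "e \<in> weighted_Sobolev s (wt (\<alpha> + real s)) \<and> a_norm s \<alpha> \<beta> e \<le> c * rate \<beta> N s r * a_norm r \<alpha> \<beta> e"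
    proof (cases "s = r")
      case True
      have "a_norm r \<alpha> \<beta> e \<ge> 0" unfolding norm_e[OF order_refl] using b by (intro real_sqrt_ge_zero jet_form_nonneg) simp
      then have "1 * a_norm r \<alpha> \<beta> e \<le> c * a_norm r \<alpha> \<beta> e" using c1 by (intro mult_right_mono)
      then show ?thesis using True sobolev_jet_imp_weighted_Sobolev[OF sE _ jE] by (simp add: rate_def)
    next
      case False
      then have sr: "s < r" using s by simp
      have N: "N > 0" using Ns[OF sr] .
      \<comment> \<open>integration by parts between the exponents \<open>\<alpha> + r\<close> and \<open>\<alpha> + r - 1\<close> is possible since \<open>r - 1 \<ge> s\<close>\<close>
      have g1: "\<alpha> + real r - 1 > -1" using s sr by linarith
      have eq1: "\<alpha> + real r - 1 + 1 = \<alpha> + real r" by simp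
      have o: "orth (\<alpha> + real r) ?b r (Suc N) E"
        using orth_of_pure_branch[OF g1 b, of r E "Suc N"] pure_branch_orthogonal[OF g1 b, of r E "Suc N"] jE oE unfolding eq1 by blast
      have js: "jet s (\<alpha> + real s) E" using descent[OF s(1) b order_refl s(2) jE o] by simp
      have "jet_form s (\<alpha> + real s) ?b E E * (?b * (\<kappa> * real N)) ^ (r - s) \<le> ?F E E"
        by (rule form_descent[OF s(1) b s(2) jE o \<kappa>(1,3)])
      moreover have rw: "?b * (\<kappa> * real N) = (\<beta> * real N) * (\<kappa> / 2)" by simp
      ultimately have le: "jet_form s (\<alpha> + real s) ?b E E * ((\<beta> * real N) * (\<kappa> / 2)) ^ (r - s) \<le> ?F E E"
        by (simp only: rw)
      have "sqrt (jet_form s (\<alpha> + real s) ?b E E) \<le>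
         (1 / (\<kappa> / 2)) ^ r * (\<beta> * real N) powr (- (real (r - s) / 2)) * sqrt (?F E E)"
        by (rule sqrt_rate_bound[OF le]) (use \<kappa> \<beta> N b in \<open>auto intro: jet_form_nonneg\<close>)
      moreover have "- (real (r - s) / 2) = (real s - real r) / 2"
        by (simp only: of_nat_diff[OF less_imp_le[OF sr]] minus_divide_left minus_diff_eq)
      ultimately have "a_norm s \<alpha> \<beta> e \<le> c * rate \<beta> N s r * a_norm r \<alpha> \<beta> e"
        using False by (simp only: norm_e[OF s(2)] norm_e[OF order_refl] c_def rate_def if_False)
      then show ?thesis using sobolev_jet_imp_weighted_Sobolev[OF sE s(2) js] by simp
    qed
    have "0 \<le> c * rate \<beta> N s r" using c1 by (simp add: rate_def)
    then have "c * rate \<beta> N s r * a_norm r \<alpha> \<beta> e \<le> c * rate \<beta> N s r * a_norm r \<alpha> \<beta> u"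
      unfolding norm_e[OF order_refl] norm_u using contract by (intro mult_left_mono) auto
    with first show "let e = (\<lambda>x. u x - laguerre_proj r \<alpha> \<beta> N u x) in
              e \<in> weighted_Sobolev s (wt (\<alpha> + real s)) \<and>
              a_norm s \<alpha> \<beta> e \<le> c * rate \<beta> N s r * a_norm r \<alpha> \<beta> e \<and>
              c * rate \<beta> N s r * a_norm r \<alpha> \<beta> e \<le> c * rate \<beta> N s r * a_norm r \<alpha> \<beta> u"
      by (simp add: Let_def e_def)
  qed
qed

end
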